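(* Let $(X,d)$ be a locally compact length space, $I\subseteq\mathbb{R}$ an open interval and $f:I\to(0,\infty)$ continuous. Then the generalized cone $I\times_f X$, equipped with $(D,\ll,\le,\tau)$, is a strongly causal Lorentzian length space.
   Context: The generalized cone $Y=I\times_f X$ is the set $I\times X$ with metric $D((t,x),(t',x'))=|t-t'|+d(x,x')$. A curve $\gamma=(\alpha,\beta):J\to Y$ is causal if it is $D$-absolutely continuous (so the metric derivative $v_\beta$ exists a.e.), $\alpha$ is strictly monotone, and $-\dot\alpha^2+(f\circ\alpha)^2v_\beta^2\le0$ a.e. (timelike: $<0$ a.e.); future directed if $\dot\alpha>0$ a.e. Length: $L(\gamma)=\int\sqrt{\dot\alpha^2-(f\circ\alpha)^2v_\beta^2}$. Time separation: $\tau(y,y')=\sup\{L(\gamma):\gamma$ future directed causal from $y$ to $y'\}$, or $0$ if there is no such curve. $y\ll y'$ iff there is a future directed timelike curve from $y$ to $y'$; $y\le y'$ iff $y=y'$ or there is a future directed causal curve from $y$ to $y'$. Lorentzian pre-length space: a metric space $(Z,d)$ with a preorder $\le$, a transitive relation $\ll\subseteq\le$, and a lower semicontinuous $\tau:Z\times Z\to[0,\infty]$ satisfying $\tau(x,z)\ge\tau(x,y)+\tau(y,z)$ for $x\le y\le z$, $\tau(x,y)=0$ if $x\not\le y$, and $\tau(x,y)>0\iff x\ll y$. In it, a causal (timelike) curve is a locally Lipschitz curve, non-constant on any subinterval, with $\gamma(t_1)\le\gamma(t_2)$ ($\gamma(t_1)\ll\gamma(t_2)$) for $t_1<t_2$;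 its $\tau$-length is $L_\tau(\gamma)=\inf\sum_i\tau(\gamma(t_i),\gamma(t_{i+1}))$ over partitions. It is a Lorentzian length space (in the sense of Kunzinger–Sämann) if: it is causally path connected (for $x\ll y$ there is a future directed timelike curve from $x$ to $y$, for $x<y$ a future directed causal one); locally causally closed (every point has a neighborhood $U$ such that $x_n\to x\in\bar U$, $y_n\to y\in\bar U$, $x_n\le y_n$ imply $x\le y$); localizable (every point has an open neighborhood $\Omega$ with a bound $C$ on the $d$-length of all causal curves in $\Omega$, and a continuous $\omega:\Omega\times\Omega\to[0,\infty)$ making $\Omega$ with the restricted relations a Lorentzian pre-length space with $I^\pm(y)\cap\Omega\neq\emptyset$ for $y\in\Omega$, such that any $p<q$ in $\Omega$ are joined by a causal curve in $\Omega$ that is maximal among causal curves in $\Omega$ and has $\tau$-length $\omega(p,q)\le\tau(p,q)$); and $\tau=\mathcal{T}$, where $\mathcal{T}(x,y)=\sup\{L_\tau(\gamma):\gamma$ future directed causal from $x$ to $y\}$ (and $0$ if there is none). It is strongly causal if the topology generated by the sets $I^+(p)\cap I^-(q)$ coincides with the metric topology. *)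

theory Defs
  imports "HOL-Analysis.Analysis"
begin

definition is_partition :: "real \<Rightarrow> real \<Rightarrow> nat \<Rightarrow> (nat \<Rightarrow> real) \<Rightarrow> bool" where
  "is_partition a b n t \<longleftrightarrow> 1 \<le> n \<and> t 0 = a \<and> t n = b \<and> (\<forall>i<n. t i < t (Suc i))"

definition curve_length :: "('a \<Rightarrow> 'a \<Rightarrow> real) \<Rightarrow> (real \<Rightarrow> 'a) \<Rightarrow> real \<Rightarrow> real \<Rightarrow> ennreal" where
  "curve_length d c a b =
     (SUP p \<in> {(n, t). is_partition a b n t}.
        ennreal (\<Sum>i<fst p. d (c (snd p i)) (c (snd p (Suc i)))))"

definition length_space :: "'a set \<Rightarrow> ('a \<Rightarrow> 'a \<Rightarrow> real) \<Rightarrow> bool" where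
  "length_space X d \<longleftrightarrow> Metric_space X d \<and>
     (\<forall>x\<in>X. \<forall>y\<in>X. ennreal (d x y) =
        (INF p \<in> {(c, a, b). a < b \<and>
                   continuous_map (top_of_set {a..b}) (Metric_space.mtopology X d) c \<and>
                   c a = x \<and> c b = y}.
           curve_length d (fst p) (fst (snd p)) (snd (snd p))))"

definition cone_dist :: "('a \<Rightarrow> 'a \<Rightarrow> real) \<Rightarrow> real \<times> 'a \<Rightarrow> real \<times> 'a \<Rightarrow> real" where
  "cone_dist d p q = \<bar>fst p - fst q\<bar> + d (snd p) (snd q)"

definition abs_cont_curve :: "('b \<Rightarrow> 'b \<Rightarrow> real) \<Rightarrow> (real \<Rightarrow> 'b) \<Rightarrow> real \<Rightarrow> real \<Rightarrow> bool" where
  "abs_cont_curve D g a b \<longleftrightarrow>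
     (\<forall>e>0. \<exists>\<delta>>0. \<forall>n (s::nat\<Rightarrow>real) t.
        (\<forall>i<n. a \<le> s i \<and> s i \<le> t i \<and> t i \<le> b) \<and>
        (\<forall>i. Suc i < n \<longrightarrow> t i \<le> s (Suc i)) \<and>
        (\<Sum>i<n. t i - s i) < \<delta>
        \<longrightarrow> (\<Sum>i<n. D (g (s i)) (g (t i))) < e)"

definition has_metric_derivative :: "('a \<Rightarrow> 'a \<Rightarrow> real) \<Rightarrow> (real \<Rightarrow> 'a) \<Rightarrow> real set \<Rightarrow> real \<Rightarrow> real \<Rightarrow> bool" where
  "has_metric_derivative d \<beta> J t v \<longleftrightarrow>
     ((\<lambda>s. d (\<beta> s) (\<beta> t) / \<bar>s - t\<bar>) \<longlongrightarrow> v) (at t within J)"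

definition metric_deriv :: "('a \<Rightarrow> 'a \<Rightarrow> real) \<Rightarrow> (real \<Rightarrow> 'a) \<Rightarrow> real set \<Rightarrow> real \<Rightarrow> real" where
  "metric_deriv d \<beta> J t = Lim (at t within J) (\<lambda>s. d (\<beta> s) (\<beta> t) / \<bar>s - t\<bar>)"

definition cone_lq :: "('a \<Rightarrow> 'a \<Rightarrow> real) \<Rightarrow> (real \<Rightarrow> real) \<Rightarrow> (real \<Rightarrow> real) \<Rightarrow> (real \<Rightarrow> 'a)
    \<Rightarrow> real \<Rightarrow> real \<Rightarrow> real \<Rightarrow> real" where
  "cone_lq d f \<alpha> \<beta> a b t = - (deriv \<alpha> t)\<^sup>2 + (f (\<alpha> t))\<^sup>2 * (metric_deriv d \<beta> {a..b} t)\<^sup>2"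

text \<open>Common part of causal/timelike curves gamma = (alpha, beta) : [a,b] -> I \<times> X:
  D-absolutely continuous (so alpha' and v_beta exist a.e.), alpha strictly monotone.\<close>
definition cone_curve :: "real set \<Rightarrow> 'a set \<Rightarrow> ('a \<Rightarrow> 'a \<Rightarrow> real)
    \<Rightarrow> (real \<Rightarrow> real) \<Rightarrow> (real \<Rightarrow> 'a) \<Rightarrow> real \<Rightarrow> real \<Rightarrow> bool" where
  "cone_curve I X d \<alpha> \<beta> a b \<longleftrightarrow> a < b \<and>
     (\<forall>t\<in>{a..b}. \<alpha> t \<in> I \<and> \<beta> t \<in> X) \<and>
     abs_cont_curve (cone_dist d) (\<lambda>t. (\<alpha> t, \<beta> t)) a b \<and>
     ((\<forall>s\<in>{a..b}. \<forall>t\<in>{a..b}. s < t \<longrightarrow> \<alpha> s < \<alpha> t) \<or>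
      (\<forall>s\<in>{a..b}. \<forall>t\<in>{a..b}. s < t \<longrightarrow> \<alpha> t < \<alpha> s)) \<and>
     (AE t in lborel. t \<in> {a..b} \<longrightarrow>
        \<alpha> differentiable (at t) \<and> (\<exists>v. has_metric_derivative d \<beta> {a..b} t v))"

definition cone_causal_curve where
  "cone_causal_curve I X d f \<alpha> \<beta> a b \<longleftrightarrow> cone_curve I X d \<alpha> \<beta> a b \<and>
     (AE t in lborel. t \<in> {a..b} \<longrightarrow> cone_lq d f \<alpha> \<beta> a b t \<le> 0)"

definition cone_timelike_curve where
  "cone_timelike_curve I X d f \<alpha> \<beta> a b \<longleftrightarrow> cone_curve I X d \<alpha> \<beta> a b \<and>
     (AE t in lborel. t \<in> {a..b} \<longrightarrow> cone_lq d f \<alpha> \<beta> a b t < 0)"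

definition future_directed :: "(real \<Rightarrow> real) \<Rightarrow> real \<Rightarrow> real \<Rightarrow> bool" where
  "future_directed \<alpha> a b \<longleftrightarrow> (AE t in lborel. t \<in> {a..b} \<longrightarrow> deriv \<alpha> t > 0)"

definition cone_length where
  "cone_length d f \<alpha> \<beta> a b =
     (\<integral>\<^sup>+ t. indicator {a..b} t *
        ennreal (sqrt ((deriv \<alpha> t)\<^sup>2 - (f (\<alpha> t))\<^sup>2 * (metric_deriv d \<beta> {a..b} t)\<^sup>2)) \<partial>lborel)"

definition cone_fd_causal_from_to where
  "cone_fd_causal_from_to I X d f y y' \<alpha> \<beta> a b \<longleftrightarrow>
     cone_causal_curve I X d f \<alpha> \<beta> a b \<and> future_directed \<alpha> a b \<and>
     (\<alpha> a, \<beta> a) = y \<and> (\<alpha> b, \<beta> b) = y'"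

definition cone_tau :: "real set \<Rightarrow> 'a set \<Rightarrow> ('a \<Rightarrow> 'a \<Rightarrow> real) \<Rightarrow> (real \<Rightarrow> real)
    \<Rightarrow> real \<times> 'a \<Rightarrow> real \<times> 'a \<Rightarrow> ennreal" where
  "cone_tau I X d f y y' =
     (SUP c \<in> {(\<alpha>, \<beta>, a, b). cone_fd_causal_from_to I X d f y y' \<alpha> \<beta> a b}.
        cone_length d f (fst c) (fst (snd c)) (fst (snd (snd c))) (snd (snd (snd c))))"

definition cone_ll :: "real set \<Rightarrow> 'a set \<Rightarrow> ('a \<Rightarrow> 'a \<Rightarrow> real) \<Rightarrow> (real \<Rightarrow> real)
    \<Rightarrow> real \<times> 'a \<Rightarrow> real \<times> 'a \<Rightarrow> bool" where
  "cone_ll I X d f y y' \<longleftrightarrow> (\<exists>\<alpha> \<beta> a b. cone_timelike_curve I X d f \<alpha> \<beta> a b \<and>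
     future_directed \<alpha> a b \<and> (\<alpha> a, \<beta> a) = y \<and> (\<alpha> b, \<beta> b) = y')"

definition cone_le :: "real set \<Rightarrow> 'a set \<Rightarrow> ('a \<Rightarrow> 'a \<Rightarrow> real) \<Rightarrow> (real \<Rightarrow> real)
    \<Rightarrow> real \<times> 'a \<Rightarrow> real \<times> 'a \<Rightarrow> bool" where
  "cone_le I X d f y y' \<longleftrightarrow> y = y' \<or> (\<exists>\<alpha> \<beta> a b. cone_fd_causal_from_to I X d f y y' \<alpha> \<beta> a b)"

definition lower_semicont_tau :: "'z set \<Rightarrow> ('z \<Rightarrow> 'z \<Rightarrow> real) \<Rightarrow> ('z \<Rightarrow> 'z \<Rightarrow> ennreal) \<Rightarrow> bool" where
  "lower_semicont_tau Z d \<tau> \<longleftrightarrow>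
     (\<forall>x\<in>Z. \<forall>y\<in>Z. \<forall>c. c < \<tau> x y \<longrightarrow>
        (\<exists>e>0. \<forall>x'\<in>Z. \<forall>y'\<in>Z. d x x' < e \<longrightarrow> d y y' < e \<longrightarrow> c < \<tau> x' y'))"

definition lorentzian_pre_length_space ::
  "'z set \<Rightarrow> ('z \<Rightarrow> 'z \<Rightarrow> real) \<Rightarrow> ('z \<Rightarrow> 'z \<Rightarrow> bool) \<Rightarrow> ('z \<Rightarrow> 'z \<Rightarrow> bool) \<Rightarrow> ('z \<Rightarrow> 'z \<Rightarrow> ennreal) \<Rightarrow> bool" where
  "lorentzian_pre_length_space Z d le ll \<tau> \<longleftrightarrow>
     Metric_space Z d \<and>
     (\<forall>x\<in>Z. le x x) \<and>
     (\<forall>x\<in>Z. \<forall>y\<in>Z. \<forall>z\<in>Z. le x y \<longrightarrow> le y z \<longrightarrow> le x z) \<and>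
     (\<forall>x\<in>Z. \<forall>y\<in>Z. \<forall>z\<in>Z. ll x y \<longrightarrow> ll y z \<longrightarrow> ll x z) \<and>
     (\<forall>x\<in>Z. \<forall>y\<in>Z. ll x y \<longrightarrow> le x y) \<and>
     lower_semicont_tau Z d \<tau> \<and>
     (\<forall>x\<in>Z. \<forall>y\<in>Z. \<forall>z\<in>Z. le x y \<longrightarrow> le y z \<longrightarrow> \<tau> x y + \<tau> y z \<le> \<tau> x z) \<and>
     (\<forall>x\<in>Z. \<forall>y\<in>Z. \<not> le x y \<longrightarrow> \<tau> x y = 0) \<and>
     (\<forall>x\<in>Z. \<forall>y\<in>Z. 0 < \<tau> x y \<longleftrightarrow> ll x y)"

definition locally_lipschitz_curve :: "('z \<Rightarrow> 'z \<Rightarrow> real) \<Rightarrow> (real \<Rightarrow> 'z) \<Rightarrow> real \<Rightarrow> real \<Rightarrow> bool" where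
  "locally_lipschitz_curve d \<gamma> a b \<longleftrightarrow>
     (\<forall>t\<in>{a..b}. \<exists>e>0. \<exists>K. \<forall>s\<in>{a..b}. \<forall>s'\<in>{a..b}.
        \<bar>s - t\<bar> < e \<longrightarrow> \<bar>s' - t\<bar> < e \<longrightarrow> d (\<gamma> s) (\<gamma> s') \<le> K * \<bar>s - s'\<bar>)"

definition lpls_causal_curve where
  "lpls_causal_curve Z d le \<gamma> a b \<longleftrightarrow> a < b \<and> \<gamma> ` {a..b} \<subseteq> Z \<and>
     locally_lipschitz_curve d \<gamma> a b \<and>
     (\<forall>s t. a \<le> s \<longrightarrow> s < t \<longrightarrow> t \<le> b \<longrightarrow> (\<exists>u\<in>{s..t}. \<gamma> u \<noteq> \<gamma> s)) \<and>
     (\<forall>s t. a \<le> s \<longrightarrow> s < t \<longrightarrow> t \<le> b \<longrightarrow> le (\<gamma> s) (\<gamma> t))"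

definition lpls_timelike_curve where
  "lpls_timelike_curve Z d ll \<gamma> a b \<longleftrightarrow> a < b \<and> \<gamma> ` {a..b} \<subseteq> Z \<and>
     locally_lipschitz_curve d \<gamma> a b \<and>
     (\<forall>s t. a \<le> s \<longrightarrow> s < t \<longrightarrow> t \<le> b \<longrightarrow> (\<exists>u\<in>{s..t}. \<gamma> u \<noteq> \<gamma> s)) \<and>
     (\<forall>s t. a \<le> s \<longrightarrow> s < t \<longrightarrow> t \<le> b \<longrightarrow> ll (\<gamma> s) (\<gamma> t))"

definition tau_length :: "('z \<Rightarrow> 'z \<Rightarrow> ennreal) \<Rightarrow> (real \<Rightarrow> 'z) \<Rightarrow> real \<Rightarrow> real \<Rightarrow> ennreal" where
  "tau_length \<tau> \<gamma> a b =
     (INF p \<in> {(n, t). is_partition a b n t}.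
        (\<Sum>i<fst p. \<tau> (\<gamma> (snd p i)) (\<gamma> (snd p (Suc i)))))"

definition tau_T where
  "tau_T Z d le \<tau> x y =
     (SUP c \<in> {(\<gamma>, a, b). lpls_causal_curve Z d le \<gamma> a b \<and> \<gamma> a = x \<and> \<gamma> b = y}.
        tau_length \<tau> (fst c) (fst (snd c)) (snd (snd c)))"

definition causally_path_connected where
  "causally_path_connected Z d le ll \<longleftrightarrow>
     (\<forall>x\<in>Z. \<forall>y\<in>Z.
        (ll x y \<longrightarrow> (\<exists>\<gamma> a b. lpls_timelike_curve Z d ll \<gamma> a b \<and> \<gamma> a = x \<and> \<gamma> b = y)) \<and>
        (le x y \<and> x \<noteq> y \<longrightarrow> (\<exists>\<gamma> a b. lpls_causal_curve Z d le \<gamma> a b \<and> \<gamma> a = x \<and> \<gamma> b = y)))"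

definition locally_causally_closed where
  "locally_causally_closed Z d le \<longleftrightarrow>
     (\<forall>p\<in>Z. \<exists>U. U \<subseteq> Z \<and>
        (\<exists>V. openin (Metric_space.mtopology Z d) V \<and> p \<in> V \<and> V \<subseteq> U) \<and>
        (\<forall>xs ys x y. (\<forall>n. xs n \<in> Z \<and> ys n \<in> Z \<and> le (xs n) (ys n)) \<and>
            limitin (Metric_space.mtopology Z d) xs x sequentially \<and>
            limitin (Metric_space.mtopology Z d) ys y sequentially \<and>
            x \<in> (Metric_space.mtopology Z d) closure_of U \<and>
            y \<in> (Metric_space.mtopology Z d) closure_of U
            \<longrightarrow> le x y))"

definition localizable where
  "localizable Z d le ll \<tau> \<longleftrightarrow>
     (\<forall>p\<in>Z. \<exists>\<Omega>. openin (Metric_space.mtopology Z d) \<Omega> \<and> p \<in> \<Omega> \<and>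
        (\<exists>C. \<forall>\<gamma> a b. lpls_causal_curve Z d le \<gamma> a b \<and> \<gamma> ` {a..b} \<subseteq> \<Omega>
               \<longrightarrow> curve_length d \<gamma> a b \<le> ennreal C) \<and>
        (\<exists>\<omega> :: 'z \<Rightarrow> 'z \<Rightarrow> real.
           continuous_map (prod_topology (Metric_space.mtopology \<Omega> d) (Metric_space.mtopology \<Omega> d))
             euclideanreal (\<lambda>(x, y). \<omega> x y) \<and>
           (\<forall>x\<in>\<Omega>. \<forall>y\<in>\<Omega>. 0 \<le> \<omega> x y) \<and>
           lorentzian_pre_length_space \<Omega> d le ll (\<lambda>x y. ennreal (\<omega> x y)) \<and>
           (\<forall>y\<in>\<Omega>. (\<exists>z\<in>\<Omega>. ll y z) \<and> (\<exists>z\<in>\<Omega>. ll z y)) \<and>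
           (\<forall>x\<in>\<Omega>. \<forall>y\<in>\<Omega>. le x y \<and> x \<noteq> y \<longrightarrow>
              (\<exists>\<gamma> a b. lpls_causal_curve Z d le \<gamma> a b \<and> \<gamma> ` {a..b} \<subseteq> \<Omega> \<and>
                 \<gamma> a = x \<and> \<gamma> b = y \<and>
                 (\<forall>\<sigma> a' b'. lpls_causal_curve Z d le \<sigma> a' b' \<and> \<sigma> ` {a'..b'} \<subseteq> \<Omega> \<and>
                     \<sigma> a' = x \<and> \<sigma> b' = y \<longrightarrow> tau_length \<tau> \<sigma> a' b' \<le> tau_length \<tau> \<gamma> a b) \<and>
                 tau_length \<tau> \<gamma> a b = ennreal (\<omega> x y) \<and>
                 ennreal (\<omega> x y) \<le> \<tau> x y))))"

definition lorentzian_length_space where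
  "lorentzian_length_space Z d le ll \<tau> \<longleftrightarrow>
     lorentzian_pre_length_space Z d le ll \<tau> \<and>
     causally_path_connected Z d le ll \<and>
     locally_causally_closed Z d le \<and>
     localizable Z d le ll \<tau> \<and>
     (\<forall>x\<in>Z. \<forall>y\<in>Z. \<tau> x y = tau_T Z d le \<tau> x y)"

definition strongly_causal where
  "strongly_causal Z d ll \<longleftrightarrow>
     topology_generated_by {{z\<in>Z. ll p z} \<inter> {z\<in>Z. ll z q} | p q. p \<in> Z \<and> q \<in> Z}
       = Metric_space.mtopology Z d"

end

theory Submission
  imports Defs
begin

text \<open>Put \<open>H' = 1 / f\<close>. Everything is governed by the fibre distance: \<open>(s, x) \<lless> (t, y)\<close> iff \<open>s < t\<close> and
  \<open>d x y < H t - H s\<close>, and \<open>(s, x) \<le> (t, y)\<close> iff \<open>s \<le> t\<close> and \<open>x\<close>, \<open>y\<close> are joined by a curve in \<open>X\<close> of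
  length at most \<open>H t - H s\<close>. Maximising the length of a causal curve over a given fibre distance is
  a concave problem in the fibre speed alone, with explicit Lagrangian solution: if \<open>A\<^sub>l\<close>, \<open>B\<^sub>l\<close> are
  antiderivatives of \<open>l / (f * sqrt (f\<^sup>2 + l\<^sup>2))\<close> and \<open>f / sqrt (f\<^sup>2 + l\<^sup>2)\<close>, then \<open>\<tau> = B\<^sub>l t - B\<^sub>l s\<close> for
  the \<open>l\<close> with \<open>A\<^sub>l t - A\<^sub>l s = d x y\<close>. By duality \<open>\<tau>\<close> is the infimum over \<open>l\<close> of
  \<open>G\<^sub>l t - G\<^sub>l s - l * d x y\<close> with \<open>G\<^sub>l = B\<^sub>l + l * A\<^sub>l\<close>, which gives the reverse triangle inequality and
  upper semicontinuity. Hence \<open>\<tau>\<close> is continuous, and in a small diamond, where the fibre has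
  geodesics, \<open>\<tau>\<close> itself serves as the local time separation. Metric derivatives of rectifiable
  curves are never needed: by local compactness every curve can be replaced by a geodesic polygon.\<close>

section \<open>Integral estimates along absolutely continuous curves\<close>

text \<open>The fibre may fail to be complete or geodesic, so in general neither \<open>d\<close>
  nor \<open>\<tau>\<close> is realised by a curve. Upper bounds therefore use distances only, while
  lower bounds are obtained with slack: a slightly larger multiplier covers more fibre distance than
  required at an arbitrarily small loss of length, and a fibre curve shorter than that always
  exists. This is also why \<lless> and \<tau> are described by \<open>d\<close> alone whereas \<le>
  asks for an actual curve; the descriptions meet where geodesics exist, that is locally, and only
  there are closedness and maximality claimed. The multiplier is a conserved momentum. At fibre
  speed v the length density is sqrt (1 - f^2 v^2), independent of the position in the fibre, so f^2
  v / sqrt (1 - f^2 v^2) is a constant l along an extremal. Solving for v gives the integrand of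
  \<open>A l\<close>, and the density becomes that of \<open>B l\<close>. Only quadratures occur, so
  continuity of \<open>f\<close> is enough. At and beyond the null cone no l solves the constraint;
  there large l force \<tau> to vanish.\<close>

lemma abs_cont_curve_finite_family:
  assumes ac: "abs_cont_curve D \<gamma> a b" and "0 < e"
  obtains \<delta> where "0 < \<delta>"
    "\<And>S. \<lbrakk>finite S; \<And>u v. (u, v) \<in> S \<Longrightarrow> a \<le> u \<and> u < v \<and> v \<le> b;
       \<And>p q. \<lbrakk>p \<in> S; q \<in> S; p \<noteq> q\<rbrakk> \<Longrightarrow> snd p \<le> fst q \<or> snd q \<le> fst p;
       (\<Sum>(u, v)\<in>S. v - u) < \<delta>\<rbrakk> \<Longrightarrow> (\<Sum>(u, v)\<in>S. D (\<gamma> u) (\<gamma> v)) < e"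
proof -
  obtain \<delta> where \<delta>: "0 < \<delta>" and D: "\<And>n (s::nat\<Rightarrow>real) t.
        (\<forall>i<n. a \<le> s i \<and> s i \<le> t i \<and> t i \<le> b) \<and>
        (\<forall>i. Suc i < n \<longrightarrow> t i \<le> s (Suc i)) \<and> (\<Sum>i<n. t i - s i) < \<delta>
        \<longrightarrow> (\<Sum>i<n. D (\<gamma> (s i)) (\<gamma> (t i))) < e"
    using ac \<open>0 < e\<close> unfolding abs_cont_curve_def by blast
  show thesis
  proof (rule that[OF \<delta>])
    fix S assume fin: "finite S" and S: "\<And>u v. (u, v) \<in> S \<Longrightarrow> a \<le> u \<and> u < v \<and> v \<le> b"
      and non: "\<And>p q. \<lbrakk>p \<in> S; q \<in> S; p \<noteq> q\<rbrakk> \<Longrightarrow> snd p \<le> fst q \<or> snd q \<le> fst p"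
      and small: "(\<Sum>(u, v)\<in>S. v - u) < \<delta>"
    have inj: "inj_on fst S"
    proof (rule inj_onI, rule ccontr)
      fix p q assume pq: "p \<in> S" "q \<in> S" "fst p = fst q" "p \<noteq> q"
      have "fst p < snd p" "fst q < snd q"
        by (metis S pq(1) prod.collapse, metis S pq(2) prod.collapse)
      with non[OF pq(1,2,4)] pq(3) show False by auto
    qed
    \<comment> \<open>Absolute continuity is stated for intervals listed from left to right, whereas
      a tagged division yields an unordered set. Left endpoints determine the intervals, so sorting
      them gives the list, and \<open>R\<close> recovers the right ends.\<close>
    define R where "R u = snd (the_inv_into S fst u)" for u
    have R: "(u, R u) \<in> S" if "u \<in> fst ` S" for u
    proof -
      have "the_inv_into S fst u \<in> S" "fst (the_inv_into S fst u) = u"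
        by (rule the_inv_into_into[OF inj that subset_refl], rule f_the_inv_into_f[OF inj that])
      then show ?thesis by (metis R_def prod.collapse)
    qed
    have R2: "R (fst p) = snd p" if "p \<in> S" for p
      using inj that by (simp add: R_def the_inv_into_f_f)
    define xs where "xs = sorted_list_of_set (fst ` S)"
    have xs: "set xs = fst ` S" "distinct xs" "sorted xs"
      using fin by (auto simp: xs_def)
    have reidx: "(\<Sum>i<length xs. h (xs ! i) (R (xs ! i))) = (\<Sum>(u, v)\<in>S. h u v)" for h :: "real \<Rightarrow> real \<Rightarrow> real"
    proof -
      have "(\<Sum>i<length xs. h (xs ! i) (R (xs ! i))) = (\<Sum>u\<in>fst ` S. h u (R u))"
        using sum.reindex_bij_betw[OF bij_betw_nth[OF xs(2) refl refl], of "\<lambda>u. h u (R u)"] xs(1)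
        by simp
      also have "\<dots> = (\<Sum>p\<in>S. h (fst p) (R (fst p)))"
        using inj by (simp add: sum.reindex)
      also have "\<dots> = (\<Sum>(u, v)\<in>S. h u v)"
        by (rule sum.cong) (auto simp: R2 split_beta)
      finally show ?thesis .
    qed
    have mem: "(xs ! i, R (xs ! i)) \<in> S" if "i < length xs" for i
      using R xs(1) that by (metis nth_mem)
    have "(\<Sum>i<length xs. D (\<gamma> (xs ! i)) (\<gamma> (R (xs ! i)))) < e"
    proof (rule D[rule_format], intro conjI allI impI)
      fix i assume i: "i < length xs"
      show "a \<le> xs ! i" "xs ! i \<le> R (xs ! i)" "R (xs ! i) \<le> b"
        using S[OF mem[OF i]] by auto
    next
      fix i assume i: "Suc i < length xs"
      have le: "xs ! i \<le> xs ! Suc i"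
        using xs(3) i by (simp add: sorted_iff_nth_Suc)
      have ne: "xs ! i \<noteq> xs ! Suc i"
        using xs(2) i by (simp add: nth_eq_iff_index_eq)
      have "R (xs ! i) \<le> xs ! Suc i \<or> R (xs ! Suc i) \<le> xs ! i"
        using non[OF mem[of i] mem[of "Suc i"]] i ne by auto
      then show "R (xs ! i) \<le> xs ! Suc i"
        using S[OF mem[OF i]] le by auto
    next
      show "(\<Sum>i<length xs. R (xs ! i) - xs ! i) < \<delta>"
        using small reidx[of "\<lambda>u v. v - u"] by simp
    qed
    then show "(\<Sum>(u, v)\<in>S. D (\<gamma> u) (\<gamma> v)) < e"
      using reidx[of "\<lambda>u v. D (\<gamma> u) (\<gamma> v)"] by simp
  qed
qed

lemma abs_cont_curve_subinterval:
  assumes "abs_cont_curve D \<gamma> a b" "a \<le> s" "t \<le> b"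
  shows "abs_cont_curve D \<gamma> s t"
  unfolding abs_cont_curve_def
proof (intro allI impI)
  fix e :: real assume "0 < e"
  then obtain \<delta> where "0 < \<delta>" and D: "\<And>n (p::nat\<Rightarrow>real) q.
        (\<forall>i<n. a \<le> p i \<and> p i \<le> q i \<and> q i \<le> b) \<and>
        (\<forall>i. Suc i < n \<longrightarrow> q i \<le> p (Suc i)) \<and> (\<Sum>i<n. q i - p i) < \<delta>
        \<longrightarrow> (\<Sum>i<n. D (\<gamma> (p i)) (\<gamma> (q i))) < e"
    using assms(1) unfolding abs_cont_curve_def by blast
  have sub: "\<forall>i<n. a \<le> p i \<and> p i \<le> q i \<and> q i \<le> b"
    if "\<forall>i<n. s \<le> p i \<and> p i \<le> q i \<and> q i \<le> t" for n and p q :: "nat \<Rightarrow> real"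
    using that assms(2,3) by (meson order_trans)
  show "\<exists>\<delta>>0. \<forall>n p q. (\<forall>i<n. s \<le> p i \<and> p i \<le> q i \<and> q i \<le> t) \<and>
        (\<forall>i. Suc i < n \<longrightarrow> q i \<le> p (Suc i)) \<and> (\<Sum>i<n. q i - p i) < \<delta>
        \<longrightarrow> (\<Sum>i<n. D (\<gamma> (p i)) (\<gamma> (q i))) < e"
  proof (intro exI[of _ \<delta>] conjI allI impI \<open>0 < \<delta>\<close>)
    fix n and p q :: "nat \<Rightarrow> real"
    assume *: "(\<forall>i<n. s \<le> p i \<and> p i \<le> q i \<and> q i \<le> t) \<and>
        (\<forall>i. Suc i < n \<longrightarrow> q i \<le> p (Suc i)) \<and> (\<Sum>i<n. q i - p i) < \<delta>"
    show "(\<Sum>i<n. D (\<gamma> (p i)) (\<gamma> (q i))) < e"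
      by (rule D[rule_format]) (use * sub[of n p q] in \<open>intro conjI; blast\<close>)
  qed
qed

lemma abs_cont_curve_Lipschitz:
  assumes "0 \<le> C" "\<And>u v. \<lbrakk>a \<le> u; u \<le> v; v \<le> b\<rbrakk> \<Longrightarrow> D (\<gamma> u) (\<gamma> v) \<le> C * (v - u)"
  shows "abs_cont_curve D \<gamma> a b"
  unfolding abs_cont_curve_def
proof (intro allI impI)
  fix e :: real assume e: "0 < e"
  show "\<exists>\<delta>>0. \<forall>n s t. (\<forall>i<n. a \<le> s i \<and> s i \<le> t i \<and> t i \<le> b) \<and> (\<forall>i. Suc i < n \<longrightarrow> t i \<le> s (Suc i)) \<and>
      (\<Sum>i<n. t i - s i) < \<delta> \<longrightarrow> (\<Sum>i<n. D (\<gamma> (s i)) (\<gamma> (t i))) < e"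
  proof (intro exI[of _ "e / (C + 1)"] conjI allI impI)
    show "0 < e / (C + 1)" using e assms(1) by simp
    fix n and s t :: "nat \<Rightarrow> real"
    assume *: "(\<forall>i<n. a \<le> s i \<and> s i \<le> t i \<and> t i \<le> b) \<and> (\<forall>i. Suc i < n \<longrightarrow> t i \<le> s (Suc i)) \<and>
      (\<Sum>i<n. t i - s i) < e / (C + 1)"
    have "(\<Sum>i<n. D (\<gamma> (s i)) (\<gamma> (t i))) \<le> (\<Sum>i<n. C * (t i - s i))"
      using * by (intro sum_mono assms(2)) auto
    also have "\<dots> \<le> C * (e / (C + 1))"
      using * assms(1) unfolding sum_distrib_left[symmetric] by (intro mult_left_mono) auto
    also have "\<dots> < e" using e assms(1) by (simp add: field_simps)
    finally show "(\<Sum>i<n. D (\<gamma> (s i)) (\<gamma> (t i))) < e" .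
  qed
qed

text \<open>A Cousin partition argument: the intervals tagged by the exceptional null set have small
  total length, so absolute continuity makes their contribution negligible; on all other intervals
  the derivative estimate applies.\<close>

lemma has_integral_le_increment:
  fixes \<psi> :: "real \<Rightarrow> real"
  assumes ab: "a \<le> b" and ac: "abs_cont_curve D \<gamma> a b" and C: "0 \<le> C"
    and dom: "\<And>u v. \<lbrakk>a \<le> u; u \<le> v; v \<le> b\<rbrakk> \<Longrightarrow> \<psi> u - \<psi> v \<le> C * D (\<gamma> u) (\<gamma> v)"
    and L0: "(L0 has_integral l) {a..b}" and N: "negligible N"
    and good: "\<And>t \<eta>. \<lbrakk>t \<in> {a..b}; t \<notin> N; 0 < \<eta>\<rbrakk> \<Longrightarrow> \<exists>\<delta>>0. \<forall>u v.
       a \<le> u \<and> u \<le> t \<and> t \<le> v \<and> v \<le> b \<and> t - \<delta> < u \<and> v < t + \<delta> \<longrightarrow> (L0 t - \<eta>) * (v - u) \<le> \<psi> v - \<psi> u"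
  shows "l \<le> \<psi> b - \<psi> a"
proof (rule field_le_epsilon)
  fix e :: real assume e: "0 < e"
  \<comment> \<open>With the integrand reset to 0 on \<open>N\<close>, a term tagged in
    \<open>N\<close> only asks that \<open>\<psi>\<close> drop by no more than \<open>C * D\<close>
    there.\<close>
  define L where "L t = (if t \<in> N then 0 else L0 t)" for t
  have L: "(L has_integral l) {a..b}"
    by (rule has_integral_spike[OF N _ L0]) (simp add: L_def)
  \<comment> \<open>One third each for the Riemann sum, for the derivative error
    \<open>\<eta>\<close> times the length, and for the intervals tagged in
    \<open>N\<close>.\<close>
  define e1 where "e1 = e / 3"
  define \<eta> where "\<eta> = e1 / (b - a + 1)"
  have pos: "0 < e1" "0 < \<eta>" using e ab by (auto simp: e1_def \<eta>_def)
  have \<eta>le: "\<eta> * (b - a) \<le> e1" using pos ab by (simp add: \<eta>_def field_simps)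
  obtain \<gamma>1 where g1: "gauge \<gamma>1" and L1: "\<And>\<D>. \<D> tagged_division_of {a..b} \<Longrightarrow> \<gamma>1 fine \<D> \<Longrightarrow>
        norm (sum (\<lambda>(x,k). measure lborel k *\<^sub>R L x) \<D> - l) < e1"
    using L pos(1) unfolding has_integral_real by meson
  obtain \<delta> where \<delta>: "0 < \<delta>" and acS: "\<And>S. \<lbrakk>finite S; \<And>u v. (u, v) \<in> S \<Longrightarrow> a \<le> u \<and> u < v \<and> v \<le> b;
       \<And>p q. \<lbrakk>p \<in> S; q \<in> S; p \<noteq> q\<rbrakk> \<Longrightarrow> snd p \<le> fst q \<or> snd q \<le> fst p;
       (\<Sum>(u, v)\<in>S. v - u) < \<delta>\<rbrakk> \<Longrightarrow> (\<Sum>(u, v)\<in>S. D (\<gamma> u) (\<gamma> v)) < e1 / (C + 1)"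
    by (rule abs_cont_curve_finite_family[OF ac, of "e1 / (C + 1)"]) (use pos C in auto)
  have NL: "N \<in> sets lebesgue" "emeasure lebesgue N = 0"
    using N by (auto simp: negligible_iff_null_sets)
  obtain G where G: "open G" "N \<subseteq> G" "G - N \<in> lmeasurable" "emeasure lebesgue (G - N) < ennreal \<delta>"
    using sets_lebesgue_outer_open[OF NL(1) \<delta>] by blast
  have Geq: "G = (G - N) \<union> N" using G(2) by auto
  have Gs: "G \<in> sets lebesgue" by (metis G(1) borel_open sets_completionI_sets sets_lborel)
  have "emeasure lebesgue G \<le> emeasure lebesgue (G - N) + emeasure lebesgue N"
    using G(3) NL(1) by (subst Geq) (intro emeasure_subadditive, auto simp: fmeasurable_def)
  then have Gm: "emeasure lebesgue G < ennreal \<delta>" using NL(2) G(4) by simp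
  have Gl: "G \<in> lmeasurable" using Gm Gs by (auto simp: fmeasurable_def intro: less_trans)
  have Gm': "measure lebesgue G < \<delta>"
    using Gm Gl \<delta> by (simp add: emeasure_eq_measure2 ennreal_less_iff)
  \<comment> \<open>\<open>m\<close> is monotone and grows by at least the length of any interval
    inside \<open>G\<close>. Summed over the division it telescopes, so the intervals tagged in
    \<open>N\<close> have total length at most the measure of \<open>G\<close>, which is below
    \<open>\<delta>\<close>.\<close>
  define m where "m t = measure lebesgue (G \<inter> {a..t})" for t
  have GI: "G \<inter> {c..t} \<in> lmeasurable" for c t
    using Gl by (intro fmeasurable_Int_fmeasurable) auto
  have m_mono: "m u \<le> m v" if "u \<le> v" for u v
    unfolding m_def using that by (intro measure_mono_fmeasurable GI) (auto intro: fmeasurableD[OF GI])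
  have m_eq: "v - u \<le> m v - m u" if "a \<le> u" "u < v" "{u..v} \<subseteq> G" for u v
  proof -
    have "{u<..<v} - G \<inter> {a..u} = {u<..<v}" by auto
    then have "measure lebesgue (G \<inter> {a..u} \<union> {u<..<v}) = measure lebesgue (G \<inter> {a..u}) + measure lebesgue {u<..<v}"
      using measure_Un2[OF GI lmeasurable_box[of u v, unfolded box_real]] by simp
    moreover have "measure lebesgue (G \<inter> {a..u} \<union> {u<..<v}) \<le> m v"
      unfolding m_def using that
      by (intro measure_mono_fmeasurable GI) (auto intro!: sets.Un fmeasurableD[OF GI])
    ultimately show ?thesis using that by (simp add: m_def)
  qed
  have "\<forall>t. \<exists>\<delta>. t \<in> {a..b} \<and> t \<notin> N \<longrightarrow> 0 < \<delta> \<and>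
     (\<forall>u v. a \<le> u \<and> u \<le> t \<and> t \<le> v \<and> v \<le> b \<and> t - \<delta> < u \<and> v < t + \<delta> \<longrightarrow>
         (L0 t - \<eta>) * (v - u) \<le> \<psi> v - \<psi> u)"
    using good[OF _ _ pos(2)] by blast
  from choice[OF this] obtain r where r: "\<And>t. t \<in> {a..b} \<and> t \<notin> N \<Longrightarrow> 0 < r t \<and>
     (\<forall>u v. a \<le> u \<and> u \<le> t \<and> t \<le> v \<and> v \<le> b \<and> t - r t < u \<and> v < t + r t \<longrightarrow>
         (L0 t - \<eta>) * (v - u) \<le> \<psi> v - \<psi> u)"
    by blast
  \<comment> \<open>At tags in \<open>N\<close> the gauge confines the interval to the open set
    \<open>G\<close> of small measure; at the other tags, to a neighbourhood where the derivative
    estimate holds.\<close>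
  define \<gamma>2 where "\<gamma>2 t = (if t \<in> N then G else if t \<in> {a..b} then ball t (r t) else UNIV)" for t
  have \<gamma>2_good: "\<exists>\<delta>>0. \<gamma>2 t = ball t \<delta> \<and> (\<forall>u v. a \<le> u \<and> u \<le> t \<and> t \<le> v \<and> v \<le> b \<and> t - \<delta> < u \<and> v < t + \<delta> \<longrightarrow>
         (L0 t - \<eta>) * (v - u) \<le> \<psi> v - \<psi> u)" if "t \<in> {a..b}" "t \<notin> N" for t
    using r[OF conjI[OF that]] that unfolding \<gamma>2_def by (intro exI[of _ "r t"]) simp
  have g2: "gauge \<gamma>2"
    unfolding gauge_def
  proof
    fix t show "t \<in> \<gamma>2 t \<and> open (\<gamma>2 t)"
    proof (cases "t \<in> {a..b} \<and> t \<notin> N")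
      case True then show ?thesis using \<gamma>2_good[of t] by auto
    next
      case False then show ?thesis using G by (auto simp: \<gamma>2_def)
    qed
  qed
  obtain p where p: "p tagged_division_of {a..b}" and fine: "(\<lambda>t. \<gamma>1 t \<inter> \<gamma>2 t) fine p"
    using fine_division_exists_real[OF gauge_Int[OF g1 g2]] by blast
  have fine1: "\<gamma>1 fine p" and fine2: "\<gamma>2 fine p" using fine by (auto simp: fine_def)
  have pD: "Inf k \<le> x \<and> x \<le> Sup k \<and> k = {Inf k..Sup k} \<and> a \<le> Inf k \<and> Sup k \<le> b \<and> measure lborel k = Sup k - Inf k \<and> k \<subseteq> \<gamma>2 x"
    if "(x, k) \<in> p" for x k
  proof -
    have "\<exists>u v. k = cbox u v" "x \<in> k" "k \<subseteq> {a..b}"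
      using tagged_division_ofD[OF p] that by auto
    then obtain u v where "k = {u..v}" "u \<le> v" "x \<in> k" "k \<subseteq> {a..b}" by auto
    then show ?thesis using fineD[OF fine2 that] by auto
  qed
  have finp: "finite p" using p by blast
  \<comment> \<open>Degenerate intervals are left out: the absolutely continuous family must satisfy
    \<open>u < v\<close>, and on degenerate intervals both sides of the final estimate
    vanish.\<close>
  define B where "B = {q \<in> p. fst q \<in> N \<and> measure lborel (snd q) \<noteq> 0}"
  define J where "J q = (Inf (snd q), Sup (snd q))" for q :: "real \<times> real set"
  have BD: "q \<in> p" if "q \<in> B" for q using that by (simp add: B_def)
  have finB: "finite B" using finp by (simp add: B_def)
  have Blt: "a \<le> Inf (snd q) \<and> Inf (snd q) < Sup (snd q) \<and> Sup (snd q) \<le> b" if "q \<in> B" for q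
    using pD[of "fst q" "snd q"] that by (auto simp: B_def)
  have Bsep: "Sup (snd q) \<le> Inf (snd r) \<or> Sup (snd r) \<le> Inf (snd q)" if "q \<in> B" "r \<in> B" "q \<noteq> r" for q r
  proof (rule ccontr)
    assume H: "\<not> ?thesis"
    have "interior (snd q) \<inter> interior (snd r) = {}"
      using tagged_division_ofD(5)[OF p, of "fst q" "snd q" "fst r" "snd r"] that
      by (auto simp: B_def)
    moreover have "snd q = {Inf (snd q)..Sup (snd q)}" "snd r = {Inf (snd r)..Sup (snd r)}"
      using pD[of "fst q" "snd q"] pD[of "fst r" "snd r"] BD[OF that(1)] BD[OF that(2)] unfolding prod.collapse by blast+
    ultimately have "{Inf (snd q)<..<Sup (snd q)} \<inter> {Inf (snd r)<..<Sup (snd r)} = {}"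
      by (metis interior_atLeastAtMost_real)
    moreover have "(max (Inf (snd q)) (Inf (snd r)) + min (Sup (snd q)) (Sup (snd r))) / 2
       \<in> {Inf (snd q)<..<Sup (snd q)} \<inter> {Inf (snd r)<..<Sup (snd r)}"
      using H Blt[OF that(1)] Blt[OF that(2)] by (auto simp: max_def min_def field_simps)
    ultimately show False by blast
  qed
  have injJ: "inj_on J B"
  proof (rule inj_onI, rule ccontr)
    fix q r assume "q \<in> B" "r \<in> B" "J q = J r" "q \<noteq> r"
    then show False using Bsep[of q r] Blt[of q] Blt[of r] by (auto simp: J_def)
  qed
  have Bsum: "(\<Sum>(u, v)\<in>J ` B. h u v) = (\<Sum>q\<in>B. h (Inf (snd q)) (Sup (snd q)))" for h :: "real \<Rightarrow> real \<Rightarrow> real"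
    by (subst sum.reindex[OF injJ]) (simp add: J_def)
  have "(\<Sum>(u, v)\<in>J ` B. v - u) = (\<Sum>q\<in>B. Sup (snd q) - Inf (snd q))"
    by (rule Bsum)
  also have "\<dots> \<le> (\<Sum>q\<in>B. m (Sup (snd q)) - m (Inf (snd q)))"
  proof (rule sum_mono)
    fix q assume q: "q \<in> B"
    have "snd q \<subseteq> G" using pD[of "fst q" "snd q"] q by (auto simp: B_def \<gamma>2_def)
    moreover have "snd q = {Inf (snd q)..Sup (snd q)}"
      using pD[of "fst q" "snd q"] BD[OF q] unfolding prod.collapse by blast
    ultimately show "Sup (snd q) - Inf (snd q) \<le> m (Sup (snd q)) - m (Inf (snd q))"
      using Blt[OF q] by (intro m_eq) auto
  qed
  also have "\<dots> \<le> (\<Sum>q\<in>p. m (Sup (snd q)) - m (Inf (snd q)))"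
    by (rule sum_mono2) (use finp pD in \<open>force simp: B_def intro!: m_mono\<close>)+
  also have "\<dots> = m b - m a"
    using additive_tagged_division_1[OF ab p, of m] by (simp add: split_beta)
  also have "\<dots> \<le> measure lebesgue G"
    using measure_nonneg[of lebesgue "G \<inter> {a..a}"] unfolding m_def
    by (smt (verit) Gl Int_lower1 GI fmeasurableD measure_mono_fmeasurable)
  finally have "(\<Sum>(u, v)\<in>J ` B. v - u) < \<delta>" using Gm' by simp
  then have "(\<Sum>(u, v)\<in>J ` B. D (\<gamma> u) (\<gamma> v)) < e1 / (C + 1)"
  proof (intro acS)
    fix r s assume "r \<in> J ` B" "s \<in> J ` B" "r \<noteq> s"
    then obtain r' s' where "r = J r'" "s = J s'" "r' \<in> B" "s' \<in> B" "r' \<noteq> s'" by blast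
    then show "snd r \<le> fst s \<or> snd s \<le> fst r" using Bsep[of r' s'] by (simp add: J_def)
  qed (use finB Blt in \<open>auto simp: J_def\<close>)
  then have "(\<Sum>q\<in>B. D (\<gamma> (Inf (snd q))) (\<gamma> (Sup (snd q)))) < e1 / (C + 1)"
    using Bsum[of "\<lambda>u v. D (\<gamma> u) (\<gamma> v)"] by simp
  then have "C * (\<Sum>q\<in>B. D (\<gamma> (Inf (snd q))) (\<gamma> (Sup (snd q)))) \<le> C * (e1 / (C + 1))"
    using C by (intro mult_left_mono) auto
  also have "\<dots> \<le> e1" using C pos by (simp add: field_simps)
  finally have bad: "C * (\<Sum>q\<in>B. D (\<gamma> (Inf (snd q))) (\<gamma> (Sup (snd q)))) \<le> e1" .
  have term_le: "measure lborel (snd q) * L (fst q) - \<eta> * measure lborel (snd q)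
       - (if q \<in> B then C * D (\<gamma> (Inf (snd q))) (\<gamma> (Sup (snd q))) else 0)
       \<le> \<psi> (Sup (snd q)) - \<psi> (Inf (snd q))" if q: "q \<in> p" for q
  proof -
    note qD = pD[of "fst q" "snd q", simplified, OF q]
    consider "q \<in> B" | "measure lborel (snd q) = 0" | "fst q \<notin> N" using q by (auto simp: B_def)
    then show ?thesis
    proof cases
      case 1
      then have "L (fst q) = 0" by (auto simp: B_def L_def)
      moreover have "0 \<le> \<eta> * measure lborel (snd q)" using pos by simp
      ultimately show ?thesis
        using dom[of "Inf (snd q)" "Sup (snd q)"] qD 1 by simp
    next
      case 2
      then show ?thesis using qD by (auto simp: B_def)
    next
      case 3
      have "fst q \<in> {a..b}" using qD by auto
      then obtain \<delta> where "0 < \<delta>" "\<gamma>2 (fst q) = ball (fst q) \<delta>"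
        and *: "\<forall>u v. a \<le> u \<and> u \<le> fst q \<and> fst q \<le> v \<and> v \<le> b \<and> fst q - \<delta> < u \<and> v < fst q + \<delta> \<longrightarrow>
           (L0 (fst q) - \<eta>) * (v - u) \<le> \<psi> v - \<psi> u"
        using \<gamma>2_good 3 by blast
      then have "{Inf (snd q)..Sup (snd q)} \<subseteq> ball (fst q) \<delta>" using qD by auto
      moreover have "Inf (snd q) \<le> Sup (snd q)" using qD by auto
      ultimately have "dist (fst q) (Inf (snd q)) < \<delta>" "dist (fst q) (Sup (snd q)) < \<delta>"
        by (auto simp: subset_eq)
      then have "(L0 (fst q) - \<eta>) * (Sup (snd q) - Inf (snd q)) \<le> \<psi> (Sup (snd q)) - \<psi> (Inf (snd q))"
        using * qD by (auto simp: dist_real_def)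
      moreover have "q \<notin> B" "L (fst q) = L0 (fst q)" using 3 by (auto simp: B_def L_def)
      moreover have "measure lborel (snd q) = Sup (snd q) - Inf (snd q)" using qD by blast
      ultimately show ?thesis by (simp only: if_False) (simp add: algebra_simps)
    qed
  qed
  have "(\<Sum>q\<in>p. measure lborel (snd q) * L (fst q)) - \<eta> * (\<Sum>q\<in>p. measure lborel (snd q))
      - (\<Sum>q\<in>p. if q \<in> B then C * D (\<gamma> (Inf (snd q))) (\<gamma> (Sup (snd q))) else 0)
      \<le> (\<Sum>q\<in>p. \<psi> (Sup (snd q)) - \<psi> (Inf (snd q)))"
    using sum_mono[OF term_le] by (simp add: sum_subtractf sum_distrib_left)
  moreover have "(\<Sum>q\<in>p. \<psi> (Sup (snd q)) - \<psi> (Inf (snd q))) = \<psi> b - \<psi> a"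
    using additive_tagged_division_1[OF ab p, of \<psi>] by (simp add: split_beta)
  moreover have "(\<Sum>q\<in>p. measure lborel (snd q)) = b - a"
    using additive_content_tagged_division[of p a b] p ab by (simp add: split_beta)
  moreover have "(\<Sum>q\<in>p. if q \<in> B then C * D (\<gamma> (Inf (snd q))) (\<gamma> (Sup (snd q))) else 0)
      = C * (\<Sum>q\<in>B. D (\<gamma> (Inf (snd q))) (\<gamma> (Sup (snd q))))"
  proof -
    have "p \<inter> B = B" by (auto simp: B_def)
    then show ?thesis using finp by (simp add: sum.inter_restrict[symmetric] sum_distrib_left)
  qed
  moreover have "\<bar>(\<Sum>q\<in>p. measure lborel (snd q) * L (fst q)) - l\<bar> < e1"
    using L1[OF p fine1] by (simp add: split_beta)
  ultimately have "l \<le> \<psi> b - \<psi> a + 3 * e1" using bad \<eta>le by (smt (verit))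
  then show "l \<le> \<psi> b - \<psi> a + e" by (simp add: e1_def)
qed

section \<open>The optimal speeds of a warping function\<close>

locale warping =
  fixes I :: "real set" and f :: "real \<Rightarrow> real"
  assumes open_I: "open I" and interval_I: "is_interval I"
    and cont_f: "continuous_on I f" and pos_f: "\<And>t. t \<in> I \<Longrightarrow> 0 < f t"
begin

text \<open>The additive constant hidden in the choice is harmless, because only increments of
  antiderivatives enter the estimates.\<close>

definition prim :: "(real \<Rightarrow> real) \<Rightarrow> real \<Rightarrow> real" where
  "prim h = (SOME F. \<forall>x\<in>I. (F has_real_derivative h x) (at x))"

lemma Icc_subset: "\<lbrakk>s \<in> I; t \<in> I\<rbrakk> \<Longrightarrow> {s..t} \<subseteq> I"
  using interval_I unfolding is_interval_1 by (meson atLeastAtMost_iff subsetI)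

text \<open>An oriented integral from a base point \<open>c\<close> treats both sides of
  \<open>c\<close> alike. As \<open>I\<close> is open, \<open>c\<close> and \<open>x\<close> are
  interior to a common compact interval in \<open>I\<close>, where the fundamental theorem
  applies.\<close>

lemma antiderivative_exists:
  assumes h: "continuous_on I h"
  shows "\<exists>F. \<forall>x\<in>I. (F has_real_derivative h x) (at x)"
proof (cases "I = {}")
  case False
  then obtain c where c: "c \<in> I" by blast
  show ?thesis
  proof (intro exI[of _ "\<lambda>u::real. LBINT y=c..u. h y"] ballI)
    fix x assume x: "x \<in> I"
    obtain e1 where e1: "0 < e1" "cball c e1 \<subseteq> I"
      using open_I c open_contains_cball by metis
    obtain e2 where e2: "0 < e2" "cball x e2 \<subseteq> I"
      using open_I x open_contains_cball by metis
    define a where "a = min (c - e1) (x - e2)"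
    define b where "b = max (c + e1) (x + e2)"
    have "c - e1 \<in> I" "x - e2 \<in> I" "c + e1 \<in> I" "x + e2 \<in> I"
      using e1 e2 by (auto simp: subset_eq dist_real_def)
    then have ab: "a \<in> I" "b \<in> I" by (auto simp: a_def b_def min_def max_def)
    have lt: "a < c" "c < b" "a < x" "x < b" using e1 e2 by (auto simp: a_def b_def)
    have "((\<lambda>u::real. LBINT y=c..u. h y) has_vector_derivative h x) (at x within {a..b})"
      using lt by (intro interval_integral_FTC2 continuous_on_subset[OF h] Icc_subset ab) auto
    then show "((\<lambda>u::real. LBINT y=c..u. h y) has_real_derivative h x) (at x)"
      using lt at_within_Icc_at[of a x b] by (simp add: has_real_derivative_iff_has_vector_derivative)
  qed
qed auto

lemma prim_deriv:
  assumes "continuous_on I h" "t \<in> I"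
  shows "(prim h has_real_derivative h t) (at t)"
  using someI_ex[OF antiderivative_exists[OF assms(1)]] assms(2) unfolding prim_def by blast

text \<open>This comparison and its strict form below reduce inequalities between increments of
  \<open>H\<close>, \<open>A\<close>, \<open>B\<close> and \<open>G\<close> to pointwise
  inequalities between their derivatives.\<close>

lemma increment_le:
  fixes F K :: "real \<Rightarrow> real"
  assumes "s \<in> I" "t \<in> I" "s \<le> t"
    and "\<And>x. x \<in> I \<Longrightarrow> (F has_real_derivative h x) (at x)"
    and "\<And>x. x \<in> I \<Longrightarrow> (K has_real_derivative k x) (at x)"
    and le: "\<And>x. x \<in> I \<Longrightarrow> h x \<le> k x"
  shows "F t - F s \<le> K t - K s"
proof -
  have "K s - F s \<le> K t - F t"
  proof (rule DERIV_nonneg_imp_nondecreasing[OF assms(3)])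
    fix x assume "s \<le> x" "x \<le> t"
    then have x: "x \<in> I" using Icc_subset[OF assms(1,2)] by auto
    show "\<exists>y. ((\<lambda>x. K x - F x) has_real_derivative y) (at x) \<and> 0 \<le> y"
      using DERIV_diff[OF assms(5)[OF x] assms(4)[OF x]] le[OF x] by (intro exI[of _ "k x - h x"]) auto
  qed
  then show ?thesis by simp
qed

lemma increment_less:
  fixes F K :: "real \<Rightarrow> real"
  assumes "s \<in> I" "t \<in> I" "s < t"
    and "\<And>x. x \<in> I \<Longrightarrow> (F has_real_derivative h x) (at x)"
    and "\<And>x. x \<in> I \<Longrightarrow> (K has_real_derivative k x) (at x)"
    and le: "\<And>x. x \<in> I \<Longrightarrow> h x < k x"
  shows "F t - F s < K t - K s"
proof -
  have "K s - F s < K t - F t"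
  proof (rule DERIV_pos_imp_increasing[OF assms(3)])
    fix x assume "s \<le> x" "x \<le> t"
    then have x: "x \<in> I" using Icc_subset[OF assms(1,2)] by auto
    show "\<exists>y. ((\<lambda>x. K x - F x) has_real_derivative y) (at x) \<and> 0 < y"
      using DERIV_diff[OF assms(5)[OF x] assms(4)[OF x]] le[OF x] by (intro exI[of _ "k x - h x"]) auto
  qed
  then show ?thesis by simp
qed

text \<open>Antiderivatives chosen separately for each \<open>l\<close> carry no regularity in
  \<open>l\<close>; writing their increments as integrals makes continuity in the multiplier
  accessible.\<close>

lemma prim_integral:
  assumes "continuous_on I h" "s \<in> I" "t \<in> I" "s \<le> t"
  shows "prim h t - prim h s = integral {s..t} h"
proof -
  have "(h has_integral (prim h t - prim h s)) {s..t}"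
    using assms Icc_subset[OF assms(2,3)]
    by (intro fundamental_theorem_of_calculus)
       (auto simp flip: has_real_derivative_iff_has_vector_derivative
          intro!: has_field_derivative_at_within[OF prim_deriv])
  then show ?thesis by (simp add: integral_unique)
qed

text \<open>Parametrised by time, the longest curves over a fibre distance have fibre speed
  \<open>l / (f * sqrt (f\<^sup>2 + l\<^sup>2))\<close> for a Lagrange multiplier \<open>l \<ge> 0\<close>; \<open>A l\<close> measures the fibre
  distance covered, \<open>B l\<close> the length, and \<open>G l\<close> is the dual function. \<open>H\<close> is the null limit of
  \<open>A l\<close> for \<open>l \<rightarrow> \<infinity>\<close>.\<close>

definition hyp :: "real \<Rightarrow> real \<Rightarrow> real" where "hyp l t = sqrt ((f t)\<^sup>2 + l\<^sup>2)"

definition H :: "real \<Rightarrow> real" where "H = prim (\<lambda>t. 1 / f t)"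

definition A :: "real \<Rightarrow> real \<Rightarrow> real" where "A l = prim (\<lambda>t. l / (f t * hyp l t))"

definition B :: "real \<Rightarrow> real \<Rightarrow> real" where "B l = prim (\<lambda>t. f t / hyp l t)"

definition G :: "real \<Rightarrow> real \<Rightarrow> real" where "G l t = B l t + l * A l t"

lemma hyp_pos: "t \<in> I \<Longrightarrow> 0 < hyp l t"
  using pos_f[of t] by (simp add: hyp_def add_pos_nonneg)

lemma hyp_sq: "(hyp l t)\<^sup>2 = (f t)\<^sup>2 + l\<^sup>2"
  by (simp add: hyp_def)

lemma hyp_le: "t \<in> I \<Longrightarrow> 0 \<le> l \<Longrightarrow> hyp l t \<le> l + f t"
  using pos_f[of t] by (auto simp: hyp_def power2_eq_square algebra_simps intro!: real_le_lsqrt)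

lemma cont_f2: "continuous_on (S \<times> T) (\<lambda>(l, t). f t)" if "T \<subseteq> I"
  unfolding split_beta using that
  by (intro continuous_on_compose2[OF cont_f] continuous_intros) auto

lemma H_deriv: "t \<in> I \<Longrightarrow> (H has_real_derivative 1 / f t) (at t)"
  unfolding H_def using pos_f by (intro prim_deriv continuous_intros cont_f) force

lemma cont_A: "continuous_on I (\<lambda>t. l / (f t * hyp l t))"
proof -
  have "f t * hyp l t \<noteq> 0" if "t \<in> I" for t
    using pos_f[OF that] hyp_pos[OF that, of l] by simp
  then show ?thesis unfolding hyp_def by (intro continuous_intros cont_f) auto
qed

lemma cont_B: "continuous_on I (\<lambda>t. f t / hyp l t)"
proof -
  have "hyp l t \<noteq> 0" if "t \<in> I" for t
    using hyp_pos[OF that, of l] by simp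
  then show ?thesis unfolding hyp_def by (intro continuous_intros cont_f) auto
qed

lemma A_deriv: "t \<in> I \<Longrightarrow> (A l has_real_derivative l / (f t * hyp l t)) (at t)"
  unfolding A_def by (rule prim_deriv[OF cont_A])

lemma B_deriv: "t \<in> I \<Longrightarrow> (B l has_real_derivative f t / hyp l t) (at t)"
  unfolding B_def by (rule prim_deriv[OF cont_B])

text \<open>Because \<open>hyp\<^sup>2 = f\<^sup>2 + l\<^sup>2\<close>, the two densities add up to
  \<open>hyp / f\<close>, which is exactly the factor that the Cauchy--Schwarz bound on a causal
  curve produces.\<close>

lemma G_deriv: "t \<in> I \<Longrightarrow> (G l has_real_derivative hyp l t / f t) (at t)"
proof -
  assume t: "t \<in> I"
  have "(G l has_real_derivative f t / hyp l t + l * (l / (f t * hyp l t))) (at t)"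
    unfolding G_def[abs_def] by (rule DERIV_add[OF B_deriv[OF t] DERIV_cmult[OF A_deriv[OF t]]])
  moreover have "f t / hyp l t + l * (l / (f t * hyp l t)) = hyp l t / f t"
    using pos_f[OF t] hyp_pos[OF t, of l] hyp_sq[of l t] by (simp add: field_simps power2_eq_square)
  ultimately show ?thesis by simp
qed

lemma
  assumes "t \<in> I"
  shows isCont_H: "isCont H t" and isCont_A: "isCont (A l) t"
    and isCont_B: "isCont (B l) t" and isCont_G: "isCont (G l) t"
  using assms H_deriv A_deriv B_deriv G_deriv DERIV_isCont by blast+

lemma A_cont_param:
  assumes "s \<in> I" "t \<in> I" "s \<le> t"
  shows "continuous_on UNIV (\<lambda>l. A l t - A l s)"
proof -
  have "f u * sqrt ((f u)\<^sup>2 + l\<^sup>2) \<noteq> 0" if "u \<in> {s..t}" for u l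
    using pos_f[of u] hyp_pos[of u l] Icc_subset[OF assms(1,2)] that by (auto simp: hyp_def)
  then have "continuous_on (UNIV \<times> {s..t}) (\<lambda>(l, t). l / (f t * hyp l t))"
    unfolding hyp_def split_beta
    by (intro continuous_intros cont_f2[unfolded split_beta] Icc_subset[OF assms(1,2)]) auto
  then have "continuous_on UNIV (\<lambda>l. integral (cbox s t) (\<lambda>t. l / (f t * hyp l t)))"
    by (intro integral_continuous_on_param) simp
  then show ?thesis unfolding A_def using prim_integral[OF cont_A assms] by simp
qed

lemma B_cont_param:
  assumes "s \<in> I" "t \<in> I" "s \<le> t"
  shows "continuous_on UNIV (\<lambda>l. B l t - B l s)"
proof -
  have "sqrt ((f u)\<^sup>2 + l\<^sup>2) \<noteq> 0" if "u \<in> {s..t}" for u l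
    using hyp_pos[of u l] Icc_subset[OF assms(1,2)] that by (auto simp: hyp_def)
  then have "continuous_on (UNIV \<times> {s..t}) (\<lambda>(l, t). f t / hyp l t)"
    unfolding hyp_def split_beta
    by (intro continuous_intros cont_f2[unfolded split_beta] Icc_subset[OF assms(1,2)]) auto
  then have "continuous_on UNIV (\<lambda>l. integral (cbox s t) (\<lambda>t. f t / hyp l t))"
    by (intro integral_continuous_on_param) simp
  then show ?thesis unfolding B_def using prim_integral[OF cont_B assms] by simp
qed

lemma H_less: "\<lbrakk>s \<in> I; t \<in> I; s < t\<rbrakk> \<Longrightarrow> H s < H t"
  using increment_less[of s t "\<lambda>_. 0" "\<lambda>_. 0" H "\<lambda>t. 1 / f t"] H_deriv pos_f by simp

lemma H_le: "\<lbrakk>s \<in> I; t \<in> I; s \<le> t\<rbrakk> \<Longrightarrow> H s \<le> H t"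
  using H_less[of s t] by (cases "s = t") auto

lemma B_less: "\<lbrakk>s \<in> I; t \<in> I; s < t\<rbrakk> \<Longrightarrow> B l s < B l t"
  using increment_less[of s t "\<lambda>_. 0" "\<lambda>_. 0" "B l" "\<lambda>t. f t / hyp l t"] B_deriv pos_f hyp_pos by simp

lemma B_le: "\<lbrakk>s \<in> I; t \<in> I; s \<le> t\<rbrakk> \<Longrightarrow> B l s \<le> B l t"
  using B_less[of s t l] by (cases "s = t") auto

lemma G_le: "\<lbrakk>s \<in> I; t \<in> I; s \<le> t\<rbrakk> \<Longrightarrow> G l s \<le> G l t"
  using increment_le[of s t "\<lambda>_. 0" "\<lambda>_. 0" "G l" "\<lambda>t. hyp l t / f t"] G_deriv pos_f hyp_pos
  by (simp add: less_imp_le)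

lemma A_less: "\<lbrakk>s \<in> I; t \<in> I; s < t; 0 < l\<rbrakk> \<Longrightarrow> A l s < A l t"
  using increment_less[of s t "\<lambda>_. 0" "\<lambda>_. 0" "A l" "\<lambda>t. l / (f t * hyp l t)"] A_deriv pos_f hyp_pos
  by simp

lemma A_0: "\<lbrakk>s \<in> I; t \<in> I; s \<le> t\<rbrakk> \<Longrightarrow> A 0 t - A 0 s = 0"
  using increment_le[of s t "A 0" "\<lambda>_. 0" "\<lambda>_. 0" "\<lambda>_. 0"] increment_le[of s t "\<lambda>_. 0" "\<lambda>_. 0" "A 0" "\<lambda>_. 0"]
    A_deriv[of _ 0] by simp

lemma A_increment_nonneg: "\<lbrakk>s \<in> I; t \<in> I; s \<le> t; 0 \<le> l\<rbrakk> \<Longrightarrow> 0 \<le> A l t - A l s"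
  using A_less[of s t l] A_0[of s t] by (cases "s = t"; cases "l = 0") auto

lemma A_integrand_lt: "t \<in> I \<Longrightarrow> l / (f t * hyp l t) < 1 / f t"
proof -
  assume t: "t \<in> I"
  have "l < hyp l t" unfolding hyp_def using pos_f[OF t] by (intro real_less_rsqrt) simp
  then show ?thesis using pos_f[OF t] hyp_pos[OF t, of l] by (simp add: field_simps)
qed

lemma A_lt_H: "\<lbrakk>s \<in> I; t \<in> I; s < t\<rbrakk> \<Longrightarrow> A l t - A l s < H t - H s"
  by (rule increment_less[OF _ _ _ A_deriv H_deriv A_integrand_lt])

lemma A_strict_param: 
  assumes "s \<in> I" "t \<in> I" "s < t" "0 \<le> l" "l < k"
  shows "A l t - A l s < A k t - A k s"
proof (rule increment_less[OF assms(1-3) A_deriv A_deriv])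
  fix x assume x: "x \<in> I"
  \<comment> \<open>Squared, both sides contain \<open>l\<^sup>2 * k\<^sup>2\<close>; what remains
    to compare is \<open>l\<^sup>2 * (f x)\<^sup>2\<close> with
    \<open>k\<^sup>2 * (f x)\<^sup>2\<close>.\<close>
  have "(l * hyp k x)\<^sup>2 < (k * hyp l x)\<^sup>2"
    unfolding power_mult_distrib hyp_sq distrib_left mult.commute[of "k\<^sup>2" "l\<^sup>2"]
    using pos_f[OF x] power_strict_mono[OF assms(5,4), of 2] by simp
  then have "l * hyp k x < k * hyp l x"
    by (rule power2_less_imp_less) (use assms(4,5) hyp_pos[OF x, of l] in auto)
  then show "l / (f x * hyp l x) < k / (f x * hyp k x)"
    using pos_f[OF x] hyp_pos[OF x, of l] hyp_pos[OF x, of k]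
    by (simp add: divide_simps mult.commute mult.left_commute)
qed

text \<open>The rate at which \<open>A l\<close> approaches \<open>H\<close>: by
  \<open>hyp_le\<close> the integrands differ by at most 1 / (l + f), hence by less than 1 / l.
  Large multipliers thus exhaust every distance below the null limit.\<close>

lemma A_lower:
  assumes "s \<in> I" "t \<in> I" "s \<le> t" "0 < l"
  shows "H t - H s - (t - s) / l \<le> A l t - A l s"
proof -
  have "(H t - t / l) - (H s - s / l) \<le> A l t - A l s"
  proof (rule increment_le[OF assms(1-3) _ A_deriv])
    fix x assume x: "x \<in> I"
    show "((\<lambda>t. H t - t / l) has_real_derivative 1 / f x - 1 / l) (at x)"
      by (rule DERIV_diff[OF H_deriv[OF x] DERIV_cdivide[OF DERIV_ident]])
    have "1 / f x - 1 / l \<le> 1 / f x - 1 / (l + f x)"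
      using pos_f[OF x] assms(4) by (simp add: frac_le)
    also have "\<dots> = l / (f x * (l + f x))"
      using pos_f[OF x] assms(4) by (simp add: field_simps)
    also have "\<dots> \<le> l / (f x * hyp l x)"
      using pos_f[OF x] hyp_pos[OF x, of l] hyp_le[OF x, of l] assms(4)
      by (intro divide_left_mono mult_left_mono) auto
    finally show "1 / f x - 1 / l \<le> l / (f x * hyp l x)" .
  qed
  then show ?thesis by (simp add: diff_divide_distrib)
qed

text \<open>It rests on sqrt (f^2 + l^2) \<le> l + f^2 / l. Once a fibre distance is at least
  \<open>H t - H s\<close>, subtracting \<open>l\<close> times that distance leaves at most a
  multiple of 1 / l, so the dual bound can be pushed below any positive number.\<close>

lemma G_upper:
  assumes "s \<in> I" "t \<in> I" "s \<le> t" "0 < l"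
  shows "G l t - G l s \<le> l * (H t - H s) + (prim f t - prim f s) / l"
proof -
  have "G l t - G l s \<le> (l * H t + prim f t / l) - (l * H s + prim f s / l)"
  proof (rule increment_le[OF assms(1-3) G_deriv])
    fix x assume x: "x \<in> I"
    show "((\<lambda>t. l * H t + prim f t / l) has_real_derivative l * (1 / f x) + f x / l) (at x)"
      by (rule DERIV_add[OF DERIV_cmult[OF H_deriv[OF x]] DERIV_cdivide[OF prim_deriv[OF cont_f x]]])
    have "hyp l x \<le> l + (f x)\<^sup>2 / l"
    proof -
      have "(hyp l x)\<^sup>2 \<le> (l + (f x)\<^sup>2 / l)\<^sup>2"
        using assms(4) by (simp add: hyp_sq power2_sum)
      then show ?thesis by (rule power2_le_imp_le) (use assms(4) in auto)
    qed
    then have "hyp l x / f x \<le> (l + (f x)\<^sup>2 / l) / f x"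
      using pos_f[OF x] by (intro divide_right_mono) auto
    then show "hyp l x / f x \<le> l * (1 / f x) + f x / l"
      using pos_f[OF x] assms(4) by (simp add: field_simps power2_eq_square)
  qed
  then show ?thesis by (simp add: right_diff_distrib diff_divide_distrib)
qed

lemma prim_f_le: "\<lbrakk>s \<in> I; t \<in> I; s \<le> t\<rbrakk> \<Longrightarrow> 0 \<le> prim f t - prim f s"
  using increment_le[of s t "\<lambda>_. 0" "\<lambda>_. 0" "prim f" f] prim_deriv[OF cont_f] pos_f
  by (simp add: less_imp_le)

lemma slope_exists:
  assumes "s \<in> I" "t \<in> I" "s < t" "0 \<le> \<delta>" "\<delta> < H t - H s"
  obtains l where "0 \<le> l" "A l t - A l s = \<delta>"
proof -
  \<comment> \<open>Chosen so that the deficit \<open>(t - s) / k\<close> in \<open>A_lower\<close>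
    is exactly the available room \<open>H t - H s - \<delta>\<close>.\<close>
  define k where "k = (t - s) / (H t - H s - \<delta>)"
  have k: "0 < k" using assms by (simp add: k_def)
  have "(t - s) / k = H t - H s - \<delta>" using assms by (simp add: k_def)
  then have "\<delta> \<le> A k t - A k s" using A_lower[of s t k] k assms by simp
  moreover have "A 0 t - A 0 s \<le> \<delta>" using A_0[of s t] assms by simp
  ultimately have "\<exists>l. 0 \<le> l \<and> l \<le> k \<and> A l t - A l s = \<delta>"
    using k continuous_on_subset[OF A_cont_param[of s t] subset_UNIV] assms
    by (intro IVT') auto
  then show thesis using that by blast
qed

text \<open>The source of all slack: since the length depends continuously on the multiplier, a
  small increase keeps it above \<open>c\<close>, while the covered fibre distance strictly grows.
  It compensates for missing geodesics.\<close>

lemma slope_increase: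
  assumes "s \<in> I" "t \<in> I" "s < t" "0 \<le> l" "c < B l t - B l s"
  obtains k where "l < k" "A l t - A l s < A k t - A k s" "c < B k t - B k s"
proof -
  have "isCont (\<lambda>l. B l t - B l s) l"
    using B_cont_param[of s t] assms by (simp add: continuous_on_eq_continuous_at)
  then have "((\<lambda>l. B l t - B l s) \<longlongrightarrow> B l t - B l s) (at_right l)"
    by (simp add: isCont_def filterlim_at_split)
  then have "eventually (\<lambda>k. c < B k t - B k s) (at_right l)"
    using assms(5) by (simp add: order_tendstoD)
  then obtain b where "l < b" "\<And>k. l < k \<Longrightarrow> k < b \<Longrightarrow> c < B k t - B k s"
    by (auto simp: eventually_at_right_field)
  then have "l < (l + b) / 2" "c < B ((l + b) / 2) t - B ((l + b) / 2) s" by auto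
  then show thesis using A_strict_param[OF assms(1-4)] by (intro that) auto
qed

lemma H_Lipschitz:
  assumes "s \<in> I" "t \<in> I"
  obtains C where "0 \<le> C" "\<And>u v. \<lbrakk>s \<le> u; u \<le> v; v \<le> t\<rbrakk> \<Longrightarrow> H v - H u \<le> C * (v - u)"
proof -
  have "continuous_on {s..t} (\<lambda>u. 1 / f u)"
    using pos_f Icc_subset[OF assms]
    by (intro continuous_intros continuous_on_subset[OF cont_f]) force+
  then have "compact ((\<lambda>u. 1 / f u) ` {s..t})" by (intro compact_continuous_image) auto
  then obtain C where C: "\<And>u. u \<in> {s..t} \<Longrightarrow> 1 / f u \<le> C"
    using bounded_imp_bdd_above[OF compact_imp_bounded] unfolding bdd_above_def by (metis imageI)
  show thesis
  proof (rule that[of "\<bar>C\<bar>"])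
    fix u v assume uv: "s \<le> u" "u \<le> v" "v \<le> t"
    have "\<bar>C\<bar> * u - H u \<le> \<bar>C\<bar> * v - H v"
    proof (rule DERIV_nonneg_imp_nondecreasing[OF uv(2)])
      fix x assume x: "u \<le> x" "x \<le> v"
      then have "x \<in> I" using Icc_subset[OF assms] uv by auto
      then have "((\<lambda>x. \<bar>C\<bar> * x - H x) has_real_derivative \<bar>C\<bar> * 1 - 1 / f x) (at x)"
        by (intro DERIV_diff DERIV_cmult DERIV_ident H_deriv)
      then show "\<exists>y. ((\<lambda>x. \<bar>C\<bar> * x - H x) has_real_derivative y) (at x) \<and> 0 \<le> y"
        using C[of x] x uv by (intro exI conjI) auto
    qed
    then show "H v - H u \<le> \<bar>C\<bar> * (v - u)" by (simp add: algebra_simps)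
  qed simp
qed

lemma A_mono: "\<lbrakk>0 \<le> l; u \<in> I; v \<in> I; u \<le> v\<rbrakk> \<Longrightarrow> A l u \<le> A l v"
  using A_increment_nonneg[of u v l] by simp

lemma A_le_H: "\<lbrakk>u \<in> I; v \<in> I; u \<le> v\<rbrakk> \<Longrightarrow> A l v - A l u \<le> H v - H u"
  using A_lt_H[of u v l] by (cases "u = v") auto

end

section \<open>Upper bounds for causal curves\<close>

text \<open>The estimates to the left and to the right of \<open>t\<close> add up, so the bound
  holds for every short interval containing the tag, which is the form that a tagged division calls
  for.\<close>

lemma DERIV_straddle_ge:
  fixes F :: "real \<Rightarrow> real"
  assumes F: "(F has_real_derivative D) (at t)" and "0 < \<eta>"
  obtains \<delta> where "0 < \<delta>"
    "\<And>u v. \<lbrakk>t - \<delta> < u; u \<le> t; t \<le> v; v < t + \<delta>\<rbrakk> \<Longrightarrow> (D - \<eta>) * (v - u) \<le> F v - F u"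
proof -
  have "((\<lambda>y. (F y - F t) / (y - t)) \<longlongrightarrow> D) (at t)"
    using F by (simp add: has_field_derivative_iff)
  then have "eventually (\<lambda>y. D - \<eta> < (F y - F t) / (y - t)) (at t)"
    using \<open>0 < \<eta>\<close> by (auto intro: order_tendstoD)
  then obtain \<delta> where \<delta>: "0 < \<delta>" "\<And>y. y \<noteq> t \<Longrightarrow> dist y t < \<delta> \<Longrightarrow> D - \<eta> < (F y - F t) / (y - t)"
    by (auto simp: eventually_at)
  show thesis
  proof (rule that[OF \<delta>(1)])
    fix u v assume uv: "t - \<delta> < u" "u \<le> t" "t \<le> v" "v < t + \<delta>"
    have "(D - \<eta>) * (v - t) \<le> F v - F t"
      using \<delta>(2)[of v] uv by (cases "v = t") (auto simp: dist_real_def field_simps)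
    moreover have "(D - \<eta>) * (t - u) \<le> F t - F u"
      using \<delta>(2)[of u] uv by (cases "u = t") (auto simp: dist_real_def field_simps)
    ultimately show "(D - \<eta>) * (v - u) \<le> F v - F u" by (simp add: algebra_simps)
  qed
qed

lemma has_metric_derivative_upper:
  assumes "has_metric_derivative d \<beta> J t v" "0 < \<eta>" "d (\<beta> t) (\<beta> t) = 0"
  obtains \<delta> where "0 < \<delta>" "\<And>u. \<lbrakk>u \<in> J; \<bar>u - t\<bar> < \<delta>\<rbrakk> \<Longrightarrow> d (\<beta> u) (\<beta> t) \<le> (v + \<eta>) * \<bar>u - t\<bar>"
proof -
  have "eventually (\<lambda>s. d (\<beta> s) (\<beta> t) / \<bar>s - t\<bar> < v + \<eta>) (at t within J)"
    using assms(1,2) unfolding has_metric_derivative_def by (auto intro: order_tendstoD)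
  then obtain \<delta> where \<delta>: "0 < \<delta>"
      "\<And>y. y \<in> J \<Longrightarrow> y \<noteq> t \<Longrightarrow> dist y t < \<delta> \<Longrightarrow> d (\<beta> y) (\<beta> t) / \<bar>y - t\<bar> < v + \<eta>"
    by (auto simp: eventually_at)
  show thesis
  proof (rule that[OF \<delta>(1)])
    fix u assume "u \<in> J" "\<bar>u - t\<bar> < \<delta>"
    then show "d (\<beta> u) (\<beta> t) \<le> (v + \<eta>) * \<bar>u - t\<bar>"
      using \<delta>(2)[of u] assms(3) by (cases "u = t") (auto simp: dist_real_def pos_divide_less_eq less_imp_le)
  qed
qed

lemma has_metric_derivative_eq:
  assumes "has_metric_derivative d \<beta> {a..b} t v" "a < t" "t < b"
  shows "metric_deriv d \<beta> {a..b} t = v"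
proof -
  have "at t within {a..b} = at t" using assms by (simp add: at_within_Icc_at)
  then show ?thesis using assms(1) unfolding metric_deriv_def has_metric_derivative_def
    by (simp add: tendsto_Lim)
qed

lemma has_metric_derivative_nonneg:
  assumes "has_metric_derivative d \<beta> {a..b} t v" "a < t" "t < b" "\<And>x y. 0 \<le> d x y"
  shows "0 \<le> v"
proof -
  have "at t within {a..b} = at t" using assms by (simp add: at_within_Icc_at)
  then have "((\<lambda>s. d (\<beta> s) (\<beta> t) / \<bar>s - t\<bar>) \<longlongrightarrow> v) (at t)"
    using assms(1) unfolding has_metric_derivative_def by simp
  then show ?thesis
    by (rule tendsto_lowerbound) (simp_all add: assms(4))
qed

lemma AE_lborel_negligible:
  fixes P :: "real \<Rightarrow> bool"
  assumes "AE t in lborel. P t"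
  obtains N where "negligible N" "\<And>t. t \<notin> N \<Longrightarrow> P t"
proof -
  obtain N where "N \<in> null_sets lborel" "{t. \<not> P t} \<subseteq> N"
    using assms by (auto simp: eventually_ae_filter)
  then show thesis
    using that[of N] by (auto simp: negligible_iff_null_sets null_sets_completionI)
qed

text \<open>Cauchy--Schwarz with multiplier \<open>l\<close>: the pointwise form of the Legendre duality between
  the length of a curve and the length of its projection to the fibre.\<close>

lemma lorentz_cauchy_schwarz:
  fixes a q F l :: real
  assumes "0 \<le> q" "q \<le> a" "0 \<le> l" "0 < F"
  shows "sqrt (a\<^sup>2 - q\<^sup>2) + l * (q / F) \<le> sqrt (F\<^sup>2 + l\<^sup>2) / F * a"
proof -
  define x where "x = sqrt (a\<^sup>2 - q\<^sup>2)"
  have x: "0 \<le> x" "x\<^sup>2 = a\<^sup>2 - q\<^sup>2" using assms by (auto simp: x_def power_mono)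
  have "(F * x + l * q)\<^sup>2 = (F\<^sup>2 + l\<^sup>2) * (x\<^sup>2 + q\<^sup>2) - (F * q - l * x)\<^sup>2"
    by (simp add: power2_eq_square algebra_simps)
  also have "\<dots> \<le> (F\<^sup>2 + l\<^sup>2) * a\<^sup>2" using x by simp
  also have "\<dots> = (sqrt (F\<^sup>2 + l\<^sup>2) * a)\<^sup>2" by (simp add: power_mult_distrib)
  finally have "F * x + l * q \<le> sqrt (F\<^sup>2 + l\<^sup>2) * a"
    by (rule power2_le_imp_le) (use assms in auto)
  then have "(F * x + l * q) / F \<le> sqrt (F\<^sup>2 + l\<^sup>2) * a / F"
    using assms by (intro divide_right_mono) auto
  then show ?thesis using assms by (simp add: x_def[symmetric] add_divide_distrib)
qed

locale cone = Metric_space X d + warping I f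
  for X :: "'a set" and d :: "'a \<Rightarrow> 'a \<Rightarrow> real" and I f
begin

text \<open>\<open>cone_curve\<close> also admits strictly decreasing time components. A single
  point with positive derivative refutes that, and one exists because a nonempty open interval is
  not negligible.\<close>

lemma fd_increasing:
  assumes c: "cone_curve I X d \<alpha> \<beta> a b" and fd: "future_directed \<alpha> a b"
    and st: "a \<le> s" "s < t" "t \<le> b"
  shows "\<alpha> s < \<alpha> t"
proof (rule ccontr)
  assume "\<not> \<alpha> s < \<alpha> t"
  then have dec: "\<forall>s\<in>{a..b}. \<forall>t\<in>{a..b}. s < t \<longrightarrow> \<alpha> t < \<alpha> s"
    using c st unfolding cone_curve_def by auto
  have "AE t in lborel. t \<in> {a..b} \<longrightarrow> \<alpha> differentiable (at t) \<and> deriv \<alpha> t > 0"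
    using c fd unfolding cone_curve_def future_directed_def by auto
  then obtain N where N: "negligible N"
    "\<And>t. t \<notin> N \<Longrightarrow> t \<in> {a..b} \<longrightarrow> \<alpha> differentiable (at t) \<and> deriv \<alpha> t > 0"
    using AE_lborel_negligible by blast
  have "a < b" using c by (simp add: cone_curve_def)
  then have "\<not> negligible {a<..<b}"
    using open_not_negligible[of "{a<..<b}"] by auto
  then obtain u where u: "a < u" "u < b" "u \<notin> N"
    using negligible_subset[OF N(1)] by (meson greaterThanLessThan_iff subsetI)
  then have "(\<alpha> has_real_derivative deriv \<alpha> u) (at u)" "0 < deriv \<alpha> u"
    using N(2)[of u] by (auto simp: DERIV_deriv_iff_real_differentiable)
  then obtain e where e: "0 < e" "\<And>h. 0 < h \<Longrightarrow> h < e \<Longrightarrow> \<alpha> u < \<alpha> (u + h)"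
    by (metis DERIV_pos_inc_right)
  define h where "h = min (e / 2) (b - u)"
  have "0 < h" "h < e" "u + h \<le> b" using e(1) u by (auto simp: h_def)
  then show False using e(2)[of h] dec[rule_format, of u "u + h"] u by auto
qed

text \<open>One estimate for two purposes: \<open>K = H\<close> bounds the fibre distance,
  \<open>K = G l\<close> bounds the length. The metric derivative is never integrated. Instead
  \<open>\<psi>\<close> subtracts \<open>l\<close> times the distance from the starting point, a
  function of the parameter whose growth is controlled by the metric derivative; and since
  \<open>K\<close> increases along the curve, \<open>\<psi>\<close> drops by at most
  \<open>l * D\<close> on any interval.\<close>

lemma causal_curve_increment:
  assumes c: "cone_causal_curve I X d f \<alpha> \<beta> a b" and fd: "future_directed \<alpha> a b"
    and st: "a \<le> s" "s \<le> t" "t \<le> b" and l: "0 \<le> l"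
    and K: "\<And>x. x \<in> I \<Longrightarrow> (K has_real_derivative k x) (at x)" "\<And>x. x \<in> I \<Longrightarrow> 0 \<le> k x"
    and L: "(L has_integral r) {s..t}"
    and ineq: "\<And>u a' v. \<lbrakk>u \<in> {a..b}; deriv \<alpha> u = a'; metric_deriv d \<beta> {a..b} u = v; 0 < a'; 0 \<le> v;
        f (\<alpha> u) * v \<le> a'\<rbrakk> \<Longrightarrow> L u + l * v \<le> k (\<alpha> u) * a'"
  shows "r + l * d (\<beta> s) (\<beta> t) \<le> K (\<alpha> t) - K (\<alpha> s)"
proof -
  have cc: "cone_curve I X d \<alpha> \<beta> a b" using c by (simp add: cone_causal_curve_def)
  have mem: "\<alpha> u \<in> I" "\<beta> u \<in> X" if "a \<le> u" "u \<le> b" for u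
    using cc that by (auto simp: cone_curve_def)
  have inc: "\<alpha> u \<le> \<alpha> v" if "a \<le> u" "u \<le> v" "v \<le> b" for u v
    using fd_increasing[OF cc fd, of u v] that by (cases "u = v") auto
  have Kinc: "K x \<le> K y" if "x \<in> I" "y \<in> I" "x \<le> y" for x y
    using increment_le[OF that, of "\<lambda>_. 0" "\<lambda>_. 0" K k] K by simp
  have "AE u in lborel. u \<in> {a..b} \<longrightarrow> \<alpha> differentiable (at u) \<and>
     (\<exists>v. has_metric_derivative d \<beta> {a..b} u v) \<and> deriv \<alpha> u > 0 \<and> cone_lq d f \<alpha> \<beta> a b u \<le> 0"
    using c fd unfolding cone_causal_curve_def cone_curve_def future_directed_def by auto
  then obtain N where N: "negligible N" and P: "\<And>u. u \<notin> N \<Longrightarrow> u \<in> {a..b} \<longrightarrow> \<alpha> differentiable (at u) \<and>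
     (\<exists>v. has_metric_derivative d \<beta> {a..b} u v) \<and> deriv \<alpha> u > 0 \<and> cone_lq d f \<alpha> \<beta> a b u \<le> 0"
    using AE_lborel_negligible by blast
  define \<psi> where "\<psi> u = K (\<alpha> u) - l * d (\<beta> s) (\<beta> u)" for u
  have "r \<le> \<psi> t - \<psi> s"
  proof (rule has_integral_le_increment[OF st(2) _ l _ L])
    show "abs_cont_curve (cone_dist d) (\<lambda>t. (\<alpha> t, \<beta> t)) s t"
      by (rule abs_cont_curve_subinterval[of _ _ a b]) (use cc st in \<open>auto simp: cone_curve_def\<close>)
    \<comment> \<open>At \<open>a\<close> and \<open>b\<close> the limit within
      \<open>{a..b}\<close> is one-sided, so the endpoints are counted as exceptional.\<close>
    show "negligible (N \<union> {a, b})" using N by (simp add: negligible_Un)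
  next
    fix u v assume uv: "s \<le> u" "u \<le> v" "v \<le> t"
    have "d (\<beta> s) (\<beta> v) - d (\<beta> s) (\<beta> u) \<le> d (\<beta> u) (\<beta> v)"
      using triangle[of "\<beta> s" "\<beta> u" "\<beta> v"] mem uv st by auto
    also have "\<dots> \<le> cone_dist d (\<alpha> u, \<beta> u) (\<alpha> v, \<beta> v)" by (simp add: cone_dist_def)
    finally have "l * (d (\<beta> s) (\<beta> v) - d (\<beta> s) (\<beta> u)) \<le> l * cone_dist d (\<alpha> u, \<beta> u) (\<alpha> v, \<beta> v)"
      using l by (intro mult_left_mono)
    moreover have "K (\<alpha> u) \<le> K (\<alpha> v)"
      using uv st by (intro Kinc mem inc) auto
    ultimately show "\<psi> u - \<psi> v \<le> l * cone_dist d (\<alpha> u, \<beta> u) (\<alpha> v, \<beta> v)"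
      by (simp add: \<psi>_def algebra_simps)
  next
    fix u and \<eta> :: real assume u: "u \<in> {s..t}" "u \<notin> N \<union> {a, b}" and \<eta>: "0 < \<eta>"
    have uab: "a < u" "u < b" using u st by auto
    obtain v where v: "has_metric_derivative d \<beta> {a..b} u v"
      and diff: "\<alpha> differentiable (at u)" and pos: "deriv \<alpha> u > 0" and lq: "cone_lq d f \<alpha> \<beta> a b u \<le> 0"
      using P[of u] u uab by auto
    have md: "metric_deriv d \<beta> {a..b} u = v" and v0: "0 \<le> v"
      using has_metric_derivative_eq[OF v uab] has_metric_derivative_nonneg[OF v uab] by auto
    have uI: "\<alpha> u \<in> I" "\<beta> u \<in> X" using mem uab by auto
    have "(f (\<alpha> u) * v)\<^sup>2 \<le> (deriv \<alpha> u)\<^sup>2"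
      using lq by (simp add: cone_lq_def md power_mult_distrib)
    then have "f (\<alpha> u) * v \<le> deriv \<alpha> u"
      using pos by (meson less_imp_le power2_le_imp_le)
    then have Lv: "L u + l * v \<le> k (\<alpha> u) * deriv \<alpha> u"
      using ineq[OF _ refl md pos v0] uab by simp
    have Kd: "((\<lambda>u. K (\<alpha> u)) has_real_derivative k (\<alpha> u) * deriv \<alpha> u) (at u)"
      using DERIV_chain2[where f = K and g = \<alpha>, OF K(1)[OF uI(1)], of "deriv \<alpha> u" UNIV] diff
      by (simp add: DERIV_deriv_iff_real_differentiable)
    obtain \<delta>1 where \<delta>1: "0 < \<delta>1" "\<And>x y. \<lbrakk>u - \<delta>1 < x; x \<le> u; u \<le> y; y < u + \<delta>1\<rbrakk>
        \<Longrightarrow> (k (\<alpha> u) * deriv \<alpha> u - \<eta> / 2) * (y - x) \<le> K (\<alpha> y) - K (\<alpha> x)"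
      using DERIV_straddle_ge[OF Kd, of "\<eta> / 2"] \<eta> by auto
    \<comment> \<open>Half of \<open>\<eta>\<close> pays for the derivative of \<open>K\<close>
      along the curve, the other half for \<open>l\<close> times the error of the metric derivative;
      \<open>l + 1\<close> covers the case \<open>l = 0\<close>.\<close>
    define \<eta>' where "\<eta>' = \<eta> / (2 * (l + 1))"
    have \<eta>': "0 < \<eta>'" "l * \<eta>' \<le> \<eta> / 2" using \<eta> l by (auto simp: \<eta>'_def field_simps)
    obtain \<delta>2 where \<delta>2: "0 < \<delta>2" "\<And>x. \<lbrakk>x \<in> {a..b}; \<bar>x - u\<bar> < \<delta>2\<rbrakk> \<Longrightarrow> d (\<beta> x) (\<beta> u) \<le> (v + \<eta>') * \<bar>x - u\<bar>"
      by (rule has_metric_derivative_upper[OF v \<eta>'(1)]) (use uI in auto)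
    show "\<exists>\<delta>>0. \<forall>x y. s \<le> x \<and> x \<le> u \<and> u \<le> y \<and> y \<le> t \<and> u - \<delta> < x \<and> y < u + \<delta> \<longrightarrow>
        (L u - \<eta>) * (y - x) \<le> \<psi> y - \<psi> x"
    proof (intro exI[of _ "min \<delta>1 \<delta>2"] conjI allI impI)
      show "0 < min \<delta>1 \<delta>2" using \<delta>1 \<delta>2 by simp
      fix x y assume xy: "s \<le> x \<and> x \<le> u \<and> u \<le> y \<and> y \<le> t \<and> u - min \<delta>1 \<delta>2 < x \<and> y < u + min \<delta>1 \<delta>2"
      have m: "\<beta> s \<in> X" "\<beta> x \<in> X" "\<beta> y \<in> X" using mem xy st by auto
      have "d (\<beta> s) (\<beta> y) \<le> d (\<beta> s) (\<beta> x) + d (\<beta> x) (\<beta> u) + d (\<beta> u) (\<beta> y)"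
        using triangle[of "\<beta> s" "\<beta> x" "\<beta> y"] triangle[of "\<beta> x" "\<beta> u" "\<beta> y"] m uI by simp
      also have "\<dots> \<le> d (\<beta> s) (\<beta> x) + (v + \<eta>') * (y - x)"
      proof -
        have "d (\<beta> x) (\<beta> u) \<le> (v + \<eta>') * (u - x)" "d (\<beta> y) (\<beta> u) \<le> (v + \<eta>') * (y - u)"
          using \<delta>2(2)[of x] \<delta>2(2)[of y] xy st by auto
        then show ?thesis by (simp add: commute[of "\<beta> u" "\<beta> y"] algebra_simps)
      qed
      finally have "l * (d (\<beta> s) (\<beta> y) - d (\<beta> s) (\<beta> x)) \<le> l * ((v + \<eta>') * (y - x))"
        using l by (intro mult_left_mono) auto
      moreover have "(k (\<alpha> u) * deriv \<alpha> u - \<eta> / 2) * (y - x) \<le> K (\<alpha> y) - K (\<alpha> x)"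
        using xy by (intro \<delta>1(2)) auto
      moreover have "(L u - \<eta>) * (y - x) \<le> (k (\<alpha> u) * deriv \<alpha> u - \<eta> / 2 - l * v - l * \<eta>') * (y - x)"
        using Lv \<eta>'(2) xy by (intro mult_right_mono) auto
      ultimately show "(L u - \<eta>) * (y - x) \<le> \<psi> y - \<psi> x"
        by (simp add: \<psi>_def algebra_simps)
    qed
  qed
  then show ?thesis using mem[of s] st by (simp add: \<psi>_def)
qed

text \<open>The increment estimate with \<open>l = 1\<close> and zero integrand: causality bounds
  the fibre speed by \<alpha>' / f, which is the derivative of \<open>H\<close> along
  \<alpha>.\<close>

lemma causal_curve_dist_le:
  assumes c: "cone_causal_curve I X d f \<alpha> \<beta> a b" and fd: "future_directed \<alpha> a b"
    and st: "a \<le> s" "s \<le> t" "t \<le> b"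
  shows "d (\<beta> s) (\<beta> t) \<le> H (\<alpha> t) - H (\<alpha> s)"
proof -
  have "0 + 1 * d (\<beta> s) (\<beta> t) \<le> H (\<alpha> t) - H (\<alpha> s)"
  proof (rule causal_curve_increment[OF c fd st _ H_deriv])
    show "((\<lambda>_. 0) has_integral (0::real)) {s..t}" by simp
    fix u a' v assume u: "u \<in> {a..b}" "f (\<alpha> u) * v \<le> a'"
    have "0 < f (\<alpha> u)"
      using c u by (auto simp: cone_causal_curve_def cone_curve_def intro: pos_f)
    with u show "0 + 1 * v \<le> 1 / f (\<alpha> u) * a'" by (simp add: field_simps)
  qed (use pos_f in \<open>auto simp: less_imp_le\<close>)
  then show ?thesis by simp
qed

text \<open>The integrand need not be Borel, so the estimate is proved for the simple functions below it.\<close>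

lemma causal_curve_length_le:
  assumes c: "cone_causal_curve I X d f \<alpha> \<beta> a b" and fd: "future_directed \<alpha> a b" and l: "0 \<le> l"
  shows "cone_length d f \<alpha> \<beta> a b \<le> ennreal (G l (\<alpha> b) - G l (\<alpha> a) - l * d (\<beta> a) (\<beta> b))"
    and "l * d (\<beta> a) (\<beta> b) \<le> G l (\<alpha> b) - G l (\<alpha> a)"
proof -
  have ab: "a < b" using c by (simp add: cone_causal_curve_def cone_curve_def)
  let ?F = "\<lambda>t. indicator {a..b} t *
        ennreal (sqrt ((deriv \<alpha> t)\<^sup>2 - (f (\<alpha> t))\<^sup>2 * (metric_deriv d \<beta> {a..b} t)\<^sup>2))"
  \<comment> \<open>Every integrable minorant of the length density satisfies the bound, by
    Cauchy--Schwarz with q = f v. The zero minorant then shows that the bound is nonnegative, so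
    that \<open>ennreal\<close> does not truncate it.\<close>
  have key: "r + l * d (\<beta> a) (\<beta> b) \<le> G l (\<alpha> b) - G l (\<alpha> a)"
    if L: "(L has_integral r) {a..b}" and le: "\<And>t. t \<in> {a..b} \<Longrightarrow> ennreal (L t) \<le> ?F t" for L r
  proof (rule causal_curve_increment[OF c fd order_refl less_imp_le[OF ab] order_refl l G_deriv _ L])
    fix u a' v assume u: "u \<in> {a..b}" "deriv \<alpha> u = a'" "metric_deriv d \<beta> {a..b} u = v" "0 < a'" "0 \<le> v"
      "f (\<alpha> u) * v \<le> a'"
    have f0: "0 < f (\<alpha> u)"
      using c u by (auto simp: cone_causal_curve_def cone_curve_def intro: pos_f)
    have "(f (\<alpha> u) * v)\<^sup>2 \<le> a'\<^sup>2" using u f0 by (intro power_mono) auto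
    then have "0 \<le> sqrt (a'\<^sup>2 - (f (\<alpha> u) * v)\<^sup>2)" by simp
    moreover have "ennreal (L u) \<le> ennreal (sqrt (a'\<^sup>2 - (f (\<alpha> u) * v)\<^sup>2))"
      using le[OF u(1)] u by (simp add: power_mult_distrib)
    ultimately have "L u \<le> sqrt (a'\<^sup>2 - (f (\<alpha> u) * v)\<^sup>2)"
      by (simp add: ennreal_le_iff)
    moreover have "sqrt (a'\<^sup>2 - (f (\<alpha> u) * v)\<^sup>2) + l * (f (\<alpha> u) * v / f (\<alpha> u)) \<le> hyp l (\<alpha> u) / f (\<alpha> u) * a'"
      unfolding hyp_def using u f0 l by (intro lorentz_cauchy_schwarz) auto
    ultimately show "L u + l * v \<le> hyp l (\<alpha> u) / f (\<alpha> u) * a'" using f0 by simp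
  next
    fix x assume "x \<in> I" then show "0 \<le> hyp l x / f x" using pos_f[of x] hyp_pos[of x l] by simp
  qed
  show 2: "l * d (\<beta> a) (\<beta> b) \<le> G l (\<alpha> b) - G l (\<alpha> a)"
    using key[of "\<lambda>_. 0" 0] by simp
  show "cone_length d f \<alpha> \<beta> a b \<le> ennreal (G l (\<alpha> b) - G l (\<alpha> a) - l * d (\<beta> a) (\<beta> b))"
    unfolding cone_length_def nn_integral_def_finite
  proof (rule SUP_least, clarify)
    fix g assume g: "simple_function lborel g" "g \<le> ?F" "\<forall>x. g x < top"
    have fin: "finite (range g)" using simple_functionD(1)[OF g(1)] by simp
    \<comment> \<open>A simple function below the density takes a finite largest value and vanishes
      off \<open>{a..b}\<close>. Its integral is therefore finite, which turns it into a
      gauge-integrable minorant \<open>L\<close>.\<close>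
    define M where "M = Max (range g)"
    have M: "g x \<le> M" for x using fin by (simp add: M_def)
    have "M \<in> range g" unfolding M_def using fin by (intro Max_in) auto
    then have Mt: "M < top" using g(3) by auto
    have g0: "g x = 0" if "x \<notin> {a..b}" for x
      using le_funD[OF g(2), of x] that by simp
    have "(\<integral>\<^sup>+x. g x \<partial>lborel) \<le> (\<integral>\<^sup>+x. M * indicator {a..b} x \<partial>lborel)"
      using M g0 by (intro nn_integral_mono) (auto simp: indicator_def)
    also have "\<dots> = M * ennreal (b - a)" using ab by (simp add: nn_integral_cmult_indicator)
    also have "\<dots> < top" using Mt by (simp add: ennreal_mult_less_top)
    finally have fin_int: "(\<integral>\<^sup>+x. g x \<partial>lborel) < top" .
    define r where "r = enn2real (\<integral>\<^sup>+x. g x \<partial>lborel)"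
    define L where "L x = enn2real (g x)" for x
    have gL: "g x = ennreal (L x)" for x using g(3) by (simp add: L_def)
    have [measurable]: "g \<in> borel_measurable borel"
      using borel_measurable_simple_function[OF g(1)] by simp
    have "L \<in> borel_measurable borel" unfolding L_def[abs_def] by measurable
    moreover have "(\<integral>\<^sup>+x. ennreal (L x) \<partial>lborel) = ennreal r"
      using fin_int by (simp add: r_def flip: gL)
    ultimately have "(L has_integral r) UNIV"
      by (intro nn_integral_has_integral) (simp_all add: L_def r_def)
    moreover have "L = (\<lambda>x. if x \<in> {a..b} then L x else 0)" using g0 by (auto simp: L_def)
    ultimately have "(L has_integral r) {a..b}"
      by (metis has_integral_restrict_UNIV)
    then have "r + l * d (\<beta> a) (\<beta> b) \<le> G l (\<alpha> b) - G l (\<alpha> a)"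
      by (rule key) (simp only: gL[symmetric] le_funD[OF g(2)])
    then have "ennreal r \<le> ennreal (G l (\<alpha> b) - G l (\<alpha> a) - l * d (\<beta> a) (\<beta> b))"
      by (intro ennreal_leI) simp
    moreover have "integral\<^sup>S lborel g = ennreal r"
      using nn_integral_eq_simple_integral[OF g(1)] fin_int by (simp add: r_def)
    ultimately show "integral\<^sup>S lborel g \<le> ennreal (G l (\<alpha> b) - G l (\<alpha> a) - l * d (\<beta> a) (\<beta> b))" by simp
  qed
qed

end

section \<open>Geodesics and rectifiable curves in the fibre\<close>

lemma lim_1_over_Suc: "(\<lambda>n. 1 / real (Suc n)) \<longlonglongrightarrow> 0"
  using LIMSEQ_inverse_real_of_nat by (simp add: inverse_eq_divide)

lemma is_partition_two: "a < b \<Longrightarrow> is_partition a b 1 (\<lambda>i. if i = 0 then a else b)"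
  by (simp add: is_partition_def)

lemma is_partition_extend:
  assumes "is_partition a s n p" "s < t"
  shows "is_partition a t (Suc n) (p(Suc n := t))"
  using assms by (auto simp: is_partition_def less_Suc_eq)

lemma is_partition_less:
  assumes "is_partition a b n p" "i < j" "j \<le> n"
  shows "p i < p j"
  using assms(2,3)
proof (induction j)
  case (Suc j)
  then have "p j < p (Suc j)" using assms(1) by (auto simp: is_partition_def)
  with Suc show ?case by (cases "i = j") auto
qed auto

lemma is_partition_bounds:
  assumes "is_partition a b n p" "i \<le> n"
  shows "a \<le> p i" "p i \<le> b"
  using is_partition_less[OF assms(1), of 0 i] is_partition_less[OF assms(1), of i n] assms
  by (auto simp: is_partition_def le_less)

lemma curve_length_ge:
  assumes "is_partition a b n p"
  shows "ennreal (\<Sum>i<n. d (c (p i)) (c (p (Suc i)))) \<le> curve_length d c a b"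
  unfolding curve_length_def
  by (rule SUP_upper2[of "(n, p)"]) (use assms in auto)

lemma curve_length_add_dist_le:
  assumes "\<And>x y. 0 \<le> d x y" "a \<le> s" "s < t"
  shows "curve_length d c a s + ennreal (d (c s) (c t)) \<le> curve_length d c a t"
proof (cases "a = s")
  case True
  \<comment> \<open>A single point admits no partition, so its curve length is a supremum over the
    empty set, namely 0.\<close>
  have "\<not> is_partition s s n p" for n p
    using is_partition_less[of s s n p 0 n] by (auto simp: is_partition_def)
  then have "{(n, p). is_partition s s n p} = {}" by simp
  then have "curve_length d c a s = 0" by (simp add: curve_length_def True bot_ennreal)
  moreover have "ennreal (d (c s) (c t)) \<le> curve_length d c s t"
    using curve_length_ge[OF is_partition_two[OF assms(3)], of d c] by simp
  ultimately show ?thesis by (simp add: True)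
next
  case False
  let ?P = "{(n, p). is_partition a s n p}"
  have "a < s" using False assms(2) by simp
  then have ne: "?P \<noteq> {}" using is_partition_two[of a s] by blast
  have "curve_length d c a s + ennreal (d (c s) (c t)) =
      (SUP p\<in>?P. ennreal (\<Sum>i<fst p. d (c (snd p i)) (c (snd p (Suc i)))) + ennreal (d (c s) (c t)))"
    unfolding curve_length_def by (rule ennreal_SUP_add_left[OF ne, symmetric])
  also have "\<dots> \<le> curve_length d c a t"
  proof (rule SUP_least, clarify)
    fix n p assume p: "is_partition a s n p"
    have pn: "p n = s" using p by (simp add: is_partition_def)
    have "ennreal (\<Sum>i<n. d (c (p i)) (c (p (Suc i)))) + ennreal (d (c s) (c t)) =
      ennreal (\<Sum>i<Suc n. d (c ((p(Suc n := t)) i)) (c ((p(Suc n := t)) (Suc i))))"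
      using assms(1) pn by (simp add: ennreal_plus[symmetric] sum_nonneg del: ennreal_plus)
    also have "\<dots> \<le> curve_length d c a t"
      by (rule curve_length_ge[OF is_partition_extend[OF p assms(3)]])
    finally show "ennreal (\<Sum>i<fst (n, p). d (c (snd (n, p) i)) (c (snd (n, p) (Suc i)))) + ennreal (d (c s) (c t))
        \<le> curve_length d c a t" by simp
  qed
  finally show ?thesis .
qed

text \<open>A two-sided limit that mentions no parameter interval, unlike
  \<open>has_metric_derivative\<close>; hence it is local and survives gluing, shifts and
  reparametrisation.\<close>

definition metric_speed :: "('a \<Rightarrow> 'a \<Rightarrow> real) \<Rightarrow> (real \<Rightarrow> 'a) \<Rightarrow> real \<Rightarrow> real \<Rightarrow> bool" where
  "metric_speed d \<beta> t v \<longleftrightarrow> ((\<lambda>s. d (\<beta> s) (\<beta> t) / \<bar>s - t\<bar>) \<longlongrightarrow> v) (at t)"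

lemma metric_speed_local:
  assumes "metric_speed d \<beta> t v" "a < t" "t < b" "\<And>s. a < s \<Longrightarrow> s < b \<Longrightarrow> \<gamma> s = \<beta> s"
  shows "metric_speed d \<gamma> t v"
  unfolding metric_speed_def
  by (rule Lim_transform_within_open[OF assms(1)[unfolded metric_speed_def], of "{a<..<b}"]) (use assms in auto)

lemma metric_speed_shift:
  "metric_speed d \<beta> (t - c) v \<Longrightarrow> metric_speed d (\<lambda>s. \<beta> (s - c)) t v"
  unfolding metric_speed_def using LIM_offset[of _ v "t - c" "- c"] by fastforce

text \<open>The chain rule. A positive derivative keeps \<open>W s\<close> away from
  \<open>W t\<close> for \<open>s\<close> near \<open>t\<close>, so the difference quotient factors
  into the one of \<beta> and the one of \<open>W\<close>.\<close>

lemma metric_speed_reparam: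
  assumes v: "metric_speed d \<beta> (W t - c) v" and W: "(W has_real_derivative w) (at t)" and w: "0 < w"
  shows "metric_speed d (\<lambda>u. \<beta> (W u - c)) t (v * w)"
proof -
  have lim: "((\<lambda>s. (W s - W t) / (s - t)) \<longlongrightarrow> w) (at t)"
    using W by (simp add: has_field_derivative_iff)
  then have "eventually (\<lambda>s. 0 < (W s - W t) / (s - t)) (at t)"
    using w by (rule order_tendstoD)
  then have ne: "eventually (\<lambda>s. W s - c \<noteq> W t - c) (at t)"
    by (rule eventually_mono) auto
  have "(\<lambda>s. W s - c) \<midarrow>t\<rightarrow> W t - c"
    using DERIV_isCont[OF W] by (intro tendsto_intros) (simp add: isCont_def)
  then have "filterlim (\<lambda>s. W s - c) (at (W t - c)) (at t)"
    using ne by (simp add: filterlim_at)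
  from filterlim_compose[OF v[unfolded metric_speed_def] this]
  have "((\<lambda>s. d (\<beta> (W s - c)) (\<beta> (W t - c)) / \<bar>W s - c - (W t - c)\<bar> * \<bar>(W s - W t) / (s - t)\<bar>) \<longlongrightarrow> v * \<bar>w\<bar>) (at t)"
    by (intro tendsto_mult tendsto_rabs lim)
  then have "((\<lambda>s. d (\<beta> (W s - c)) (\<beta> (W t - c)) / \<bar>s - t\<bar>) \<longlongrightarrow> v * \<bar>w\<bar>) (at t)"
    by (rule Lim_transform_eventually) (use ne in \<open>auto elim!: eventually_mono simp: abs_divide\<close>)
  then show ?thesis using w by (simp add: metric_speed_def)
qed

section \<open>Intermediate points and geodesics in locally compact length spaces\<close>

locale locally_compact_length_space = Metric_space X d for X :: "'a set" and d +
  assumes length_space: "length_space X d" and locally_compact: "locally_compact_space mtopology"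
begin

lemma continuous_curveD:
  fixes c :: "real \<Rightarrow> 'a"
  assumes c: "continuous_map (top_of_set {a..b}) mtopology c"
  shows "t \<in> {a..b} \<Longrightarrow> c t \<in> X"
    and "\<lbrakk>t \<in> {a..b}; 0 < e\<rbrakk> \<Longrightarrow> \<exists>\<delta>>0. \<forall>s\<in>{a..b}. \<bar>s - t\<bar> < \<delta> \<longrightarrow> d (c t) (c s) < e"
proof -
  show mem: "c t \<in> X" if "t \<in> {a..b}" for t using c that by (auto simp: continuous_map_def Pi_def)
  show "\<exists>\<delta>>0. \<forall>s\<in>{a..b}. \<bar>s - t\<bar> < \<delta> \<longrightarrow> d (c t) (c s) < e" if t: "t \<in> {a..b}" and e: "0 < e" for t e
  proof -
    have "openin (top_of_set {a..b}) {s \<in> topspace (top_of_set {a..b}). c s \<in> mball (c t) e}"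
      by (rule openin_continuous_map_preimage[OF c]) simp
    then obtain \<delta> where "0 < \<delta>" "\<And>s. s \<in> {a..b} \<Longrightarrow> dist s t < \<delta> \<Longrightarrow> c s \<in> mball (c t) e"
      using t mem[OF t] e unfolding openin_euclidean_subtopology_iff by auto
    then show ?thesis by (auto simp: dist_real_def)
  qed
qed

lemma short_curve:
  assumes "x \<in> X" "y \<in> X" "d x y < L"
  obtains c a b where "a < b" "continuous_map (top_of_set {a..b}) mtopology c" "c a = x" "c b = y"
    "curve_length d c a b < ennreal L"
proof -
  have "ennreal (d x y) < ennreal L" using assms by (simp add: ennreal_less_iff)
  then have "(INF p \<in> {(c, a, b). a < b \<and>
                   continuous_map (top_of_set {a..b}) mtopology c \<and> c a = x \<and> c b = y}.
           curve_length d (fst p) (fst (snd p)) (snd (snd p))) < ennreal L"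
    using bspec[OF bspec[OF conjunct2[OF length_space[unfolded length_space_def]] assms(1)] assms(2)]
    by (simp only:)
  then obtain q where q: "q \<in> {(c, a, b). a < b \<and>
       continuous_map (top_of_set {a..b}) mtopology c \<and> c a = x \<and> c b = y}"
     and len: "curve_length d (fst q) (fst (snd q)) (snd (snd q)) < ennreal L"
    unfolding INF_less_iff by blast
  obtain c a b where "q = (c, a, b)" by (cases q)
  then show thesis using that[of a b c] q len by simp
qed

text \<open>Follow an almost shortest curve until its distance from \<open>x\<close> is exactly
  \<open>s\<close>, which happens by the intermediate value theorem. The partition at that point
  bounds the remaining distance to \<open>y\<close>.\<close>

lemma almost_between:
  assumes xy: "x \<in> X" "y \<in> X" and s: "0 \<le> s" "s \<le> d x y" and e: "0 < e"
  obtains z where "z \<in> X" "d x z = s" "d z y < d x y - s + e"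
proof -
  obtain c a b where ab: "a < b" and c: "continuous_map (top_of_set {a..b}) mtopology c"
    and ends: "c a = x" "c b = y" and len: "curve_length d c a b < ennreal (d x y + e)"
    by (rule short_curve[OF xy, of "d x y + e"]) (use e in auto)
  have "continuous_on {a..b} (\<lambda>t. d x (c t))"
    unfolding continuous_on_iff
  proof (intro ballI allI impI)
    fix t e :: real assume t: "t \<in> {a..b}" and "0 < e"
    then obtain \<delta> where \<delta>: "0 < \<delta>" "\<forall>s\<in>{a..b}. \<bar>s - t\<bar> < \<delta> \<longrightarrow> d (c t) (c s) < e"
      using continuous_curveD(2)[OF c] by blast
    show "\<exists>\<delta>>0. \<forall>s\<in>{a..b}. dist s t < \<delta> \<longrightarrow> dist (d x (c s)) (d x (c t)) < e"
    proof (intro exI[of _ \<delta>] conjI ballI impI \<delta>(1))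
      fix s assume s: "s \<in> {a..b}" "dist s t < \<delta>"
      then have "d (c t) (c s) < e" using \<delta>(2) by (simp add: dist_real_def)
      then show "dist (d x (c s)) (d x (c t)) < e"
        using triangle[of x "c t" "c s"] triangle[of x "c s" "c t"] commute[of "c s" "c t"]
          continuous_curveD(1)[OF c] s t xy by (auto simp: dist_real_def)
    qed
  qed
  then obtain t where t: "a \<le> t" "t \<le> b" "d x (c t) = s"
    using IVT'[of "\<lambda>t. d x (c t)" a s b] ab s ends xy by auto
  have mem: "c t \<in> X" using continuous_curveD(1)[OF c] t by auto
  consider "t = a" | "t = b" | "a < t" "t < b" using t by linarith
  then show thesis
  proof cases
    case 1 then show thesis using that[of "c t"] mem t ends xy e by auto
  next
    case 2 then show thesis using that[of "c t"] mem t ends xy e by auto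
  next
    case 3
    have "is_partition a b 2 (\<lambda>i. if i = 0 then a else if i = 1 then t else b)"
      using 3 by (auto simp: is_partition_def less_Suc_eq numeral_2_eq_2)
    from curve_length_ge[OF this, of d c]
    have "ennreal (d x (c t) + d (c t) y) \<le> curve_length d c a b"
      by (simp add: numeral_2_eq_2 ends)
    with len have "d x (c t) + d (c t) y < d x y + e"
      by (metis ennreal_less_iff add_nonneg_nonneg nonneg order_le_less_trans)
    then show thesis using that[of "c t"] mem t by auto
  qed
qed

text \<open>Almost intermediate points with error tending to 0 stay in the compact ball by the bound
  on \<open>R\<close>, and any limit point of theirs is an exact one.\<close>

lemma between:
  assumes K: "compactin mtopology (mcball p R)" and xy: "x \<in> X" "y \<in> X" and p: "p \<in> X"
    and R: "d p x + d x y \<le> R" and s: "0 \<le> s" "s \<le> d x y"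
  obtains z where "z \<in> X" "d x z = s" "d z y = d x y - s"
proof -
  have "\<exists>z. z \<in> X \<and> d x z = s \<and> d z y < d x y - s + 1 / Suc n" for n
    by (rule almost_between[OF xy s, of "1 / Suc n"]) auto
  then obtain z where z: "\<And>n. z n \<in> X" "\<And>n. d x (z n) = s" "\<And>n::nat. d (z n) y < d x y - s + 1 / Suc n"
    by metis
  have "range z \<subseteq> mcball p R"
  proof clarify
    fix n show "z n \<in> mcball p R"
      using triangle[of p x "z n"] z(1,2)[of n] xy p R s by auto
  qed
  then obtain w r where w: "w \<in> mcball p R" "strict_mono r" "limitin mtopology (z \<circ> r) w sequentially"
    using K unfolding compactin_sequentially by blast
  have wX: "w \<in> X" using w by auto
  have "\<forall>e>0. \<exists>N. \<forall>n\<ge>N. d (z (r n)) w < e"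
    using w(3) unfolding limit_metric_sequentially o_def by blast
  then have lim: "(\<lambda>n. d (z (r n)) w) \<longlonglongrightarrow> 0"
    by (simp add: LIMSEQ_iff)
  have "\<bar>d x w - s\<bar> \<le> d (z (r n)) w" for n
    using triangle[of x w "z (r n)"] triangle[of x "z (r n)" w] z(1,2)[of "r n"] wX xy commute[of w "z (r n)"] by auto
  then have "\<bar>d x w - s\<bar> \<le> 0"
    by (intro LIMSEQ_le_const[OF lim]) auto
  then have 1: "d x w = s" by simp
  have "d w y \<le> d (z (r n)) w + (d x y - s + 1 / Suc (r n))" for n
    using triangle[of w "z (r n)" y] z(1,3)[of "r n"] wX xy commute[of w "z (r n)"] by auto
  moreover have "(\<lambda>n. d (z (r n)) w + (d x y - s + 1 / Suc (r n))) \<longlonglongrightarrow> 0 + (d x y - s + 0)"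
    using LIMSEQ_subseq_LIMSEQ[OF lim_1_over_Suc w(2)]
    by (intro tendsto_intros lim) (simp add: o_def)
  ultimately have "d w y \<le> d x y - s"
    by (intro LIMSEQ_le_const[of _ "d x y - s"]) auto
  moreover have "d x y \<le> d x w + d w y" using triangle[of x w y] wX xy by simp
  ultimately show thesis using that[OF wX 1] 1 by auto
qed

text \<open>A minimising geodesic from \<open>x\<close> to \<open>y\<close>, parametrised by arc
  length.\<close>

definition joined :: "'a \<Rightarrow> 'a \<Rightarrow> bool" where
  "joined x y \<longleftrightarrow> (\<exists>\<beta>. \<beta> 0 = x \<and> \<beta> (d x y) = y \<and> (\<forall>s\<in>{0..d x y}. \<beta> s \<in> X) \<and>
     (\<forall>s\<in>{0..d x y}. \<forall>t\<in>{0..d x y}. d (\<beta> s) (\<beta> t) = \<bar>s - t\<bar>))"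

lemma equidistant_chain:
  assumes K: "compactin mtopology (mcball p R)" and xy: "x \<in> X" "y \<in> X" and p: "p \<in> X"
    and R: "d p x + d x y \<le> R" and h: "0 \<le> h" "d x y = real N * h"
  obtains z where "z 0 = x" "z N = y" "\<And>i. i \<le> N \<Longrightarrow> z i \<in> mcball p R"
    "\<And>i j. i \<le> j \<Longrightarrow> j \<le> N \<Longrightarrow> d (z i) (z j) \<le> real (j - i) * h"
proof -
  \<comment> \<open>Keeping the distance to \<open>y\<close> exact keeps
    \<open>d p w + d w y\<close> within \<open>R\<close>, so \<open>between\<close> can be applied
    again from \<open>w\<close>. Past \<open>N\<close> only membership is demanded, which lets
    dependent choice run over all indices.\<close>
  define Q where "Q n w \<longleftrightarrow> w \<in> X \<and> (n \<le> N \<longrightarrow> d x w \<le> real n * h \<and> d w y = d x y - real n * h) \<and> (n = 0 \<longrightarrow> w = x)"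
    for n w
  have "\<exists>z. \<forall>n. Q n (z n) \<and> (n < N \<longrightarrow> d (z n) (z (Suc n)) = h)"
  proof (rule dependent_nat_choice)
    show "\<exists>w. Q 0 w" using xy by (intro exI[of _ x]) (simp add: Q_def)
  next
    fix w n assume w: "Q n w"
    show "\<exists>w'. Q (Suc n) w' \<and> (n < N \<longrightarrow> d w w' = h)"
    proof (cases "n < N")
      case False then show ?thesis using xy by (intro exI[of _ x]) (simp add: Q_def)
    next
      case True
      have w': "w \<in> X" "d x w \<le> real n * h" "d w y = d x y - real n * h" using w True by (auto simp: Q_def)
      have "real n * h + h \<le> real N * h"
        using mult_right_mono[of "real (Suc n)" "real N" h] True h by (simp add: algebra_simps)
      then have "h \<le> d w y" using w' h by simp
      moreover have "d p w + d w y \<le> R"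
        using triangle[of p x w] w' xy p R by simp
      ultimately obtain w2 where w2: "w2 \<in> X" "d w w2 = h" "d w2 y = d w y - h"
        using between[OF K w'(1) xy(2) p _ h(1)] by metis
      have "Q (Suc n) w2" unfolding Q_def
        using w2 w' triangle[of x w w2] xy by (auto simp: algebra_simps)
      then show ?thesis using w2 by blast
    qed
  qed
  then obtain z where z: "\<And>n. Q n (z n) \<and> (n < N \<longrightarrow> d (z n) (z (Suc n)) = h)"
    by blast
  have zX: "z i \<in> X" for i using z[of i] by (simp add: Q_def)
  have step: "d (z i) (z j) \<le> real (j - i) * h" if "i \<le> j" "j \<le> N" for i j
    using that
  proof (induction j)
    case 0 then show ?case using zX by simp
  next
    case (Suc j)
    show ?case
    proof (cases "i = Suc j")
      case True then show ?thesis using zX by simp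
    next
      case False
      then have "d (z i) (z j) \<le> real (j - i) * h" "d (z j) (z (Suc j)) = h" using Suc z[of j] by auto
      moreover have "real (Suc j - i) * h = real (j - i) * h + h"
        using False Suc by (simp add: Suc_diff_le algebra_simps)
      ultimately show ?thesis using triangle[of "z i" "z j" "z (Suc j)"] zX by simp
    qed
  qed
  show thesis
  proof (rule that[OF _ _ _ step])
    show "z 0 = x" using z[of 0] by (simp add: Q_def)
    have "d (z N) y = 0" using z[of N] h by (simp add: Q_def)
    then show "z N = y" using zX xy by simp
  next
    fix i assume i: "i \<le> N"
    have "real i * h \<le> real N * h" using i h by (intro mult_right_mono) auto
    then show "z i \<in> mcball p R"
      using z[of i] i triangle[of p x "z i"] xy p R h by (auto simp: Q_def)
  qed
qed

text \<open>Step functions through equidistant chains are almost nonexpansive; by Tychonoff's theorem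
  the nested closed sets of such maps have a common element, which is a geodesic.\<close>

lemma joined_in_compact_ball:
  assumes K: "compactin mtopology (mcball p R)" and xy: "x \<in> X" "y \<in> X" and p: "p \<in> X"
    and R: "d p x + d x y \<le> R"
  shows "joined x y"
proof (cases "d x y = 0")
  case True
  then show ?thesis using xy unfolding joined_def by (intro exI[of _ "\<lambda>_. x"]) auto
next
  case False
  define l where "l = d x y"
  have l: "0 < l" using False nonneg[of x y] by (simp add: l_def less_le)
  define T where "T = product_topology (\<lambda>_::real. subtopology mtopology (mcball p R)) {0..l}"
  have T: "topspace T = (\<Pi>\<^sub>E t\<in>{0..l}. mcball p R)"
    by (simp add: T_def) (auto simp: PiE_def Pi_def)
  have comp: "compact_space T"
    unfolding T_def compact_space_product_topology using K by (simp add: compact_space_subtopology)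
  have proj: "continuous_map T mtopology (\<lambda>\<beta>. \<beta> t)" if "t \<in> {0..l}" for t
    using continuous_map_product_projection[OF that, of "\<lambda>_. subtopology mtopology (mcball p R)"]
    unfolding T_def by (rule continuous_map_into_fulltopology)
  have clo: "closedin T {\<beta> \<in> topspace T. d (u \<beta>) (v \<beta>) \<le> c}"
    if "continuous_map T mtopology u" "continuous_map T mtopology v" for u v c
  proof -
    have "continuous_map T euclidean (\<lambda>\<beta>. mdist Self (u \<beta>) (v \<beta>))"
      by (rule continuous_map_mdist) (use that in \<open>simp_all add: mtopology_of_def\<close>)
    then have "closedin T {\<beta> \<in> topspace T. mdist Self (u \<beta>) (v \<beta>) \<in> {..c}}"
      by (rule closedin_continuous_map_preimage) simp
    then show ?thesis by simp
  qed
  have const: "continuous_map T mtopology (\<lambda>_. w)" if "w \<in> X" for w using that by simp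
  have l0: "0 \<in> {0..l}" "l \<in> {0..l}" using l by auto
  \<comment> \<open>Maps with the prescribed ends that are nonexpansive up to an error
    \<open>l / (n + 1)\<close>. Each condition involves at most two coordinates and is closed in the
    product topology, and the decreasing error makes the sets nested.\<close>
  define C where "C n = {\<beta> \<in> topspace T. d (\<beta> 0) x \<le> 0} \<inter> {\<beta> \<in> topspace T. d (\<beta> l) y \<le> 0} \<inter>
     (\<Inter>(s, t)\<in>{0..l} \<times> {0..l}. {\<beta> \<in> topspace T. d (\<beta> s) (\<beta> t) \<le> \<bar>s - t\<bar> + l / real (Suc n)})" for n
  have "(\<Inter>n. C n) \<noteq> {}"
  proof (rule compact_space_imp_nest[OF comp])
    show "closedin T (C n)" for n
      unfolding C_def using l0 xy
      by (intro closedin_Int closedin_INT) (auto intro!: clo proj const)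
    show "decseq C"
    proof (rule decseq_SucI)
      fix n
      have "l / real (Suc (Suc n)) \<le> l / real (Suc n)" using l by (intro divide_left_mono) auto
      then show "C (Suc n) \<subseteq> C n" unfolding C_def by force
    qed
    fix n
    define h where "h = l / real (Suc n)"
    have h: "0 < h" "d x y = real (Suc n) * h" using l by (auto simp: h_def l_def)
    obtain z where z: "z 0 = x" "z (Suc n) = y" "\<And>i. i \<le> Suc n \<Longrightarrow> z i \<in> mcball p R"
      "\<And>i j. i \<le> j \<Longrightarrow> j \<le> Suc n \<Longrightarrow> d (z i) (z j) \<le> real (j - i) * h"
      using equidistant_chain[OF K xy p R less_imp_le[OF h(1)] h(2)] by metis
    \<comment> \<open>The map rounds \<open>t\<close> down to a vertex. This costs at most one step
      \<open>h\<close>, precisely the error allowed in \<open>C n\<close>; at \<open>t = l\<close>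
      the quotient is exactly \<open>Suc n\<close>, so the right end is hit.\<close>
    define k where "k t = nat \<lfloor>t / h\<rfloor>" for t
    define \<beta> where "\<beta> = (\<lambda>t\<in>{0..l}. z (k t))"
    have k: "k t \<le> Suc n" "real (k t) \<le> t / h" "t / h < real (k t) + 1" if "t \<in> {0..l}" for t
    proof -
      have "0 \<le> t / h" using that h by simp
      then show *: "real (k t) \<le> t / h" "t / h < real (k t) + 1" unfolding k_def by linarith+
      have "t / h \<le> l / h" using that h by (intro divide_right_mono) auto
      also have "\<dots> = real (Suc n)" using l by (simp add: h_def)
      finally show "k t \<le> Suc n" using * by linarith
    qed
    have kl: "k l = Suc n"
    proof -
      have "l / h = real (Suc n)" using l by (simp add: h_def)
      then show ?thesis unfolding k_def by (metis floor_of_nat nat_int)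
    qed
    have mono: "k s \<le> k t" if "s \<le> t" for s t
      unfolding k_def using that h by (intro nat_mono floor_mono divide_right_mono) auto
    have lip: "d (\<beta> s) (\<beta> t) \<le> \<bar>s - t\<bar> + h" if st: "s \<in> {0..l}" "t \<in> {0..l}" "s \<le> t" for s t
    proof -
      have "d (\<beta> s) (\<beta> t) \<le> real (k t - k s) * h"
        using z(4)[OF mono[OF st(3)] k(1)[OF st(2)]] st by (simp add: \<beta>_def)
      also have "real (k t - k s) \<le> t / h - s / h + 1"
        using k[OF st(1)] k[OF st(2)] mono[OF st(3)] by linarith
      then have "real (k t - k s) * h \<le> (t / h - s / h + 1) * h"
        using h by (intro mult_right_mono) auto
      also have "\<dots> = \<bar>s - t\<bar> + h" using h st by (simp add: algebra_simps)
      finally show ?thesis .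
    qed
    have "d (\<beta> s) (\<beta> t) \<le> \<bar>s - t\<bar> + h" if "s \<in> {0..l}" "t \<in> {0..l}" for s t
      using lip[of s t] lip[of t s] that commute[of "\<beta> s" "\<beta> t"] by (cases "s \<le> t") auto
    moreover have "\<beta> \<in> topspace T" unfolding T \<beta>_def restrict_PiE_iff using z(3) k(1) by blast
    moreover have "\<beta> 0 = x" "\<beta> l = y" using l kl z by (auto simp: \<beta>_def k_def)
    ultimately have "\<beta> \<in> C n" unfolding C_def h_def using xy by auto
    then show "C n \<noteq> {}" by blast
  qed
  then obtain \<beta> where \<beta>: "\<And>n. \<beta> \<in> C n" by blast
  have \<beta>X: "\<beta> t \<in> X" if "t \<in> {0..l}" for t
    using \<beta>[of 0] that unfolding C_def T PiE_def Pi_def by (auto simp del: in_mcball dest!: bspec simp: in_mcball)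
  have "d (\<beta> 0) x \<le> 0" "d (\<beta> l) y \<le> 0" using \<beta>[of 0] by (auto simp: C_def)
  then have ends: "\<beta> 0 = x" "\<beta> l = y" using \<beta>X l0 xy nonneg by (auto simp: order_antisym_conv)
  have lip: "d (\<beta> s) (\<beta> t) \<le> \<bar>s - t\<bar>" if "s \<in> {0..l}" "t \<in> {0..l}" for s t
  proof (rule LIMSEQ_le_const)
    show "(\<lambda>n. \<bar>s - t\<bar> + l * (1 / real (Suc n))) \<longlonglongrightarrow> \<bar>s - t\<bar>"
      using tendsto_add[OF tendsto_const[of "\<bar>s - t\<bar>"] tendsto_mult[OF tendsto_const[of l] lim_1_over_Suc]] by simp
    show "\<exists>N. \<forall>n\<ge>N. d (\<beta> s) (\<beta> t) \<le> \<bar>s - t\<bar> + l * (1 / real (Suc n))"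
      using \<beta> that unfolding C_def by auto
  qed
  \<comment> \<open>A nonexpansive map on \<open>{0..l}\<close> with ends at distance
    \<open>l\<close> cannot contract anywhere: the triangle inequality through both points leaves no
    slack.\<close>
  have iso: "d (\<beta> s) (\<beta> t) = \<bar>s - t\<bar>" if st: "s \<in> {0..l}" "t \<in> {0..l}" "s \<le> t" for s t
  proof -
    have "l \<le> d x (\<beta> s) + d (\<beta> s) (\<beta> t) + d (\<beta> t) y"
      using triangle[of x "\<beta> s" y] triangle[of "\<beta> s" "\<beta> t" y] \<beta>X st xy by (simp add: l_def)
    moreover have "d x (\<beta> s) \<le> s" "d (\<beta> t) y \<le> l - t"
      using lip[of 0 s] lip[of t l] st ends by auto
    ultimately show ?thesis using lip[OF st(1,2)] st by auto
  qed
  have "d (\<beta> s) (\<beta> t) = \<bar>s - t\<bar>" if "s \<in> {0..l}" "t \<in> {0..l}" for s t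
    using iso[of s t] iso[of t s] that commute[of "\<beta> s" "\<beta> t"] by (cases "s \<le> t") auto
  then show ?thesis unfolding joined_def l_def[symmetric]
    using ends \<beta>X by blast
qed

lemma local_geodesics:
  assumes "p \<in> X"
  obtains \<rho> where "0 < \<rho>" "\<And>x y. x \<in> mball p \<rho> \<Longrightarrow> y \<in> mball p \<rho> \<Longrightarrow> joined x y"
proof -
  obtain U K where U: "openin mtopology U" "compactin mtopology K" "p \<in> U" "U \<subseteq> K"
    using locally_compact assms unfolding locally_compact_space_def by auto
  then obtain r where r: "0 < r" "mcball p r \<subseteq> U" unfolding openin_mtopology_mcball by blast
  have "compactin mtopology (mcball p r)"
    using closed_compactin[OF U(2) _ closedin_mcball] r U(4) by blast
  \<comment> \<open>With a quarter of the radius, \<open>d p x + d x y\<close> is below r / 4 + r /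
    2, hence below \<open>r\<close>.\<close>
  then have "joined x y" if "x \<in> mball p (r / 4)" "y \<in> mball p (r / 4)" for x y
  proof (rule joined_in_compact_ball)
    show "d p x + d x y \<le> r" using triangle[of x p y] that commute[of x p] r(1) by auto
  qed (use that assms in auto)
  then show thesis using that[of "r / 4"] r by auto
qed

end

section \<open>Connections by nonexpansive curves of prescribed duration\<close>

context locally_compact_length_space
begin

text \<open>A curve of length at most \<open>L\<close>, in a nonexpansive parametrisation by
  \<open>{0..L}\<close>. The finite exceptional set makes its lift to the cone admissible without a
  differentiation theorem for Lipschitz curves. The bound \<open>L\<close> has to be attained: for
  \<open>L = d x y\<close> this is a geodesic.\<close>

definition reach :: "real \<Rightarrow> 'a \<Rightarrow> 'a \<Rightarrow> bool" where
  "reach L x y \<longleftrightarrow> 0 \<le> L \<and> (\<exists>\<beta> E. \<beta> 0 = x \<and> \<beta> L = y \<and> (\<forall>t\<in>{0..L}. \<beta> t \<in> X) \<and>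
     (\<forall>s\<in>{0..L}. \<forall>t\<in>{0..L}. d (\<beta> s) (\<beta> t) \<le> \<bar>s - t\<bar>) \<and>
     finite E \<and> (\<forall>t\<in>{0..L} - E. \<exists>v. metric_speed d \<beta> t v))"

lemma reach_dist_le: "reach L x y \<Longrightarrow> d x y \<le> L"
proof -
  assume "reach L x y"
  then obtain \<beta> where "0 \<le> L" "\<beta> 0 = x" "\<beta> L = y" "\<forall>s\<in>{0..L}. \<forall>t\<in>{0..L}. d (\<beta> s) (\<beta> t) \<le> \<bar>s - t\<bar>"
    unfolding reach_def by blast
  then have "d (\<beta> 0) (\<beta> L) \<le> \<bar>0 - L\<bar>" by (meson atLeastAtMost_iff order_refl)
  with \<open>\<beta> 0 = x\<close> \<open>\<beta> L = y\<close> \<open>0 \<le> L\<close> show ?thesis by simp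
qed

lemma reach_joined:
  assumes "joined x y" "d x y \<le> L"
  shows "reach L x y"
proof -
  obtain g where g: "g 0 = x" "g (d x y) = y" "\<And>s. s \<in> {0..d x y} \<Longrightarrow> g s \<in> X"
     "\<And>s t. s \<in> {0..d x y} \<Longrightarrow> t \<in> {0..d x y} \<Longrightarrow> d (g s) (g t) = \<bar>s - t\<bar>"
    using assms(1) unfolding joined_def by blast
  show ?thesis
  proof (cases "L = 0")
    case True
    then have "d x y = 0" using assms(2) nonneg[of x y] by simp
    then show ?thesis unfolding reach_def True
      using g by (intro conjI exI[of _ g] exI[of _ "{0}"]) auto
  next
    case False
    have L: "0 < L" using False assms(2) nonneg[of x y] by linarith
    \<comment> \<open>The geodesic is run at constant speed \<open>k \<le> 1\<close> so that it
      takes time exactly \<open>L\<close>. The ends are exceptional because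
      \<open>metric_speed\<close> is two-sided.\<close>
    define k where "k = d x y / L"
    have k: "0 \<le> k" "k \<le> 1" "L * k = d x y" using L assms(2) by (auto simp: k_def)
    have mem: "t * k \<in> {0..d x y}" if "t \<in> {0..L}" for t
      using that k mult_right_mono[of t L k] by auto
    have dist: "d (g (s * k)) (g (t * k)) = \<bar>s - t\<bar> * k" if "s \<in> {0..L}" "t \<in> {0..L}" for s t
    proof -
      have "\<bar>s * k - t * k\<bar> = \<bar>s - t\<bar> * k"
        using k(1) by (simp add: abs_mult flip: left_diff_distrib)
      then show ?thesis using g(4)[OF mem[OF that(1)] mem[OF that(2)]] by simp
    qed
    have speed: "metric_speed d (\<lambda>t. g (t * k)) t k" if t: "t \<in> {0..L} - {0, L}" for t
      unfolding metric_speed_def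
    proof (rule Lim_transform_within_open[OF tendsto_const, of "{0<..<L}"])
      fix s assume "s \<in> {0<..<L}" "s \<noteq> t"
      then show "k = d (g (s * k)) (g (t * k)) / \<bar>s - t\<bar>" using dist[of s t] t by simp
    qed (use t in auto)
    show ?thesis unfolding reach_def
    proof (intro conjI exI[of _ "\<lambda>t. g (t * k)"] exI[of _ "{0, L}"] ballI)
      fix s t assume "s \<in> {0..L}" "t \<in> {0..L}"
      then show "d (g (s * k)) (g (t * k)) \<le> \<bar>s - t\<bar>"
        using dist[of s t] k(1,2) mult_left_mono[of k 1 "\<bar>s - t\<bar>"] by simp
    next
      fix t assume "t \<in> {0..L} - {0, L}"
      then show "\<exists>v. metric_speed d (\<lambda>t. g (t * k)) t v" using speed by blast
    qed (use L g k mem in auto)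
  qed
qed

lemma reach_refl: "x \<in> X \<Longrightarrow> 0 \<le> L \<Longrightarrow> reach L x x"
  by (rule reach_joined) (auto simp: joined_def)

lemma reach_trans:
  assumes "reach L x y" "reach L' y z"
  shows "reach (L + L') x z"
proof -
  obtain \<beta> E where L: "0 \<le> L" and b: "\<beta> 0 = x" "\<beta> L = y" "\<And>t. t \<in> {0..L} \<Longrightarrow> \<beta> t \<in> X"
     "\<And>s t. s \<in> {0..L} \<Longrightarrow> t \<in> {0..L} \<Longrightarrow> d (\<beta> s) (\<beta> t) \<le> \<bar>s - t\<bar>"
     "finite E" "\<And>t. t \<in> {0..L} - E \<Longrightarrow> \<exists>v. metric_speed d \<beta> t v"
    using assms(1) unfolding reach_def by blast
  obtain \<gamma> F where L': "0 \<le> L'" and c: "\<gamma> 0 = y" "\<gamma> L' = z" "\<And>t. t \<in> {0..L'} \<Longrightarrow> \<gamma> t \<in> X"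
     "\<And>s t. s \<in> {0..L'} \<Longrightarrow> t \<in> {0..L'} \<Longrightarrow> d (\<gamma> s) (\<gamma> t) \<le> \<bar>s - t\<bar>"
     "finite F" "\<And>t. t \<in> {0..L'} - F \<Longrightarrow> \<exists>v. metric_speed d \<gamma> t v"
    using assms(2) unfolding reach_def by blast
  define \<phi> where "\<phi> t = (if t \<le> L then \<beta> t else \<gamma> (t - L))" for t
  \<comment> \<open>The joint becomes exceptional, as the speeds on its two sides may
    differ.\<close>
  define E' where "E' = E \<union> {0, L, L + L'} \<union> (\<lambda>t. t + L) ` F"
  have \<phi>': "\<phi> t = \<gamma> (t - L)" if "L \<le> t" for t using that b(2) c(1) by (auto simp: \<phi>_def)
  have mem: "\<phi> t \<in> X" if "t \<in> {0..L + L'}" for t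
    using that b(3)[of t] c(3)[of "t - L"] by (auto simp: \<phi>_def)
  have lip: "d (\<phi> s) (\<phi> t) \<le> \<bar>s - t\<bar>" if st: "s \<in> {0..L + L'}" "t \<in> {0..L + L'}" "s \<le> t" for s t
  proof -
    consider "t \<le> L" | "L \<le> s" | "s \<le> L" "L \<le> t" by linarith
    then show ?thesis
    proof cases
      case 1 then show ?thesis using b(4)[of s t] st by (simp add: \<phi>_def)
    next
      case 2 then show ?thesis using c(4)[of "s - L" "t - L"] st by (simp add: \<phi>')
    next
      case 3
      have "d (\<phi> s) (\<phi> t) \<le> d (\<phi> s) (\<phi> L) + d (\<phi> L) (\<phi> t)"
        using triangle[OF mem[of s] mem[of L] mem[of t]] st L L' by auto
      also have "d (\<phi> s) (\<phi> L) \<le> L - s" using b(4)[of s L] 3 st by (simp add: \<phi>_def)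
      also have "d (\<phi> L) (\<phi> t) \<le> t - L" using c(4)[of 0 "t - L"] 3 st by (simp add: \<phi>')
      finally show ?thesis using st by simp
    qed
  qed
  have speed: "\<exists>v. metric_speed d \<phi> t v" if t: "t \<in> {0..L + L'} - E'" for t
  proof (cases "t < L")
    case True
    then obtain v where "metric_speed d \<beta> t v" using t b(6)[of t] by (auto simp: E'_def)
    then have "metric_speed d \<phi> t v"
      by (rule metric_speed_local[of _ _ _ _ 0 L]) (use t True in \<open>auto simp: \<phi>_def E'_def\<close>)
    then show ?thesis by blast
  next
    case False
    have "t \<noteq> L" using t by (auto simp: E'_def)
    with False have tL: "L < t" by simp
    have "t - L \<notin> F"
    proof
      assume "t - L \<in> F"
      then have "t \<in> (\<lambda>t. t + L) ` F" by (intro image_eqI[of _ _ "t - L"]) auto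
      then show False using t by (auto simp: E'_def)
    qed
    then obtain v where "metric_speed d \<gamma> (t - L) v" using t c(6)[of "t - L"] tL by auto
    then have "metric_speed d (\<lambda>s. \<gamma> (s - L)) t v" by (rule metric_speed_shift)
    then have "metric_speed d \<phi> t v"
      by (rule metric_speed_local[of _ _ _ _ L "t + 1"]) (use tL in \<open>auto simp: \<phi>'\<close>)
    then show ?thesis by blast
  qed
  show ?thesis unfolding reach_def
  proof (intro conjI exI[of _ \<phi>] exI[of _ E'] ballI)
    fix s t assume "s \<in> {0..L + L'}" "t \<in> {0..L + L'}"
    then show "d (\<phi> s) (\<phi> t) \<le> \<bar>s - t\<bar>"
      using lip[of s t] lip[of t s] commute[of "\<phi> s" "\<phi> t"] by (cases "s \<le> t") auto
  qed (use L L' b c \<phi>' mem speed in \<open>auto simp: \<phi>_def E'_def\<close>)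
qed

lemma reach_mono: "\<lbrakk>reach L x y; L \<le> L'; y \<in> X\<rbrakk> \<Longrightarrow> reach L' x y"
  using reach_trans[of L x y "L' - L" y] reach_refl[of y "L' - L"] by simp

text \<open>A curve is replaced by a geodesic polygon with vertices on it: the polygon is no longer than
  the curve, but has a metric derivative outside a finite set.\<close>

lemma reach_polygon:
  fixes a b :: real
  assumes "a \<le> b" and mem: "\<And>t. t \<in> {a..b} \<Longrightarrow> c t \<in> X"
    and cont: "\<And>t e. t \<in> {a..b} \<Longrightarrow> 0 < e \<Longrightarrow> \<exists>\<delta>>0. \<forall>s\<in>{a..b}. \<bar>s - t\<bar> < \<delta> \<longrightarrow> d (c t) (c s) < e"
    and bound: "\<And>s t. \<lbrakk>a \<le> s; s \<le> t; t \<le> b\<rbrakk> \<Longrightarrow> d (c s) (c t) \<le> \<sigma> t - \<sigma> s"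
  shows "reach (\<sigma> b - \<sigma> a) (c a) (c b)"
proof -
  \<comment> \<open>Bisection replaces an explicit subdivision: \<open>P\<close> passes from
    adjacent intervals to their union, and it holds for short ones because their ends map into a
    ball with geodesics.\<close>
  define P where "P u v \<longleftrightarrow> (a \<le> u \<and> u \<le> v \<and> v \<le> b \<longrightarrow> reach (\<sigma> v - \<sigma> u) (c u) (c v))" for u v
  have "P a b"
  proof (rule Bolzano[OF assms(1)])
    fix u v w assume *: "P u v" "P v w" "u \<le> v" "v \<le> w"
    show "P u w" unfolding P_def
    proof
      assume "a \<le> u \<and> u \<le> w \<and> w \<le> b"
      then have "reach (\<sigma> v - \<sigma> u) (c u) (c v)" "reach (\<sigma> w - \<sigma> v) (c v) (c w)"
        using * by (auto simp: P_def)
      from reach_trans[OF this] show "reach (\<sigma> w - \<sigma> u) (c u) (c w)" by simp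
    qed
  next
    fix t assume "a \<le> t" "t \<le> b"
    then have t: "t \<in> {a..b}" by simp
    obtain \<rho> where \<rho>: "0 < \<rho>" "\<And>x y. x \<in> mball (c t) \<rho> \<Longrightarrow> y \<in> mball (c t) \<rho> \<Longrightarrow> joined x y"
      using local_geodesics[OF mem[OF t]] by metis
    obtain \<delta> where \<delta>: "0 < \<delta>" "\<forall>s\<in>{a..b}. \<bar>s - t\<bar> < \<delta> \<longrightarrow> d (c t) (c s) < \<rho>"
      using cont[OF t \<rho>(1)] by blast
    show "\<exists>\<delta>>0. \<forall>u v. u \<le> t \<and> t \<le> v \<and> v - u < \<delta> \<longrightarrow> P u v"
    proof (intro exI[of _ \<delta>] conjI allI impI \<delta>(1))
      fix u v assume uv: "u \<le> t \<and> t \<le> v \<and> v - u < \<delta>"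
      show "P u v" unfolding P_def
      proof
        assume ab: "a \<le> u \<and> u \<le> v \<and> v \<le> b"
        have "d (c t) (c u) < \<rho>" "d (c t) (c v) < \<rho>" using \<delta>(2) uv ab by auto
        then have "joined (c u) (c v)" using mem t ab by (intro \<rho>(2)) auto
        then show "reach (\<sigma> v - \<sigma> u) (c u) (c v)" using ab bound by (intro reach_joined) auto
      qed
    qed
  qed
  then show ?thesis using assms(1) by (simp add: P_def)
qed

text \<open>This lets pieces of a curve supplied by \<open>reach\<close> be compared in the causal
  order: each piece realises \<open>reach\<close> for its own duration.\<close>

lemma reach_nonexpansive:
  fixes a b :: real
  assumes "a \<le> b" "\<And>t. t \<in> {a..b} \<Longrightarrow> c t \<in> X"
    and "\<And>s t. \<lbrakk>s \<in> {a..b}; t \<in> {a..b}\<rbrakk> \<Longrightarrow> d (c s) (c t) \<le> \<bar>s - t\<bar>"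
  shows "reach (b - a) (c a) (c b)"
proof (rule reach_polygon[where \<sigma> = "\<lambda>t. t", OF assms(1,2)])
  fix t e :: real assume t: "t \<in> {a..b}" and e: "0 < e"
  show "\<exists>\<delta>>0. \<forall>s\<in>{a..b}. \<bar>s - t\<bar> < \<delta> \<longrightarrow> d (c t) (c s) < e"
  proof (intro exI[of _ e] conjI ballI impI e)
    fix s assume "s \<in> {a..b}" "\<bar>s - t\<bar> < e"
    then show "d (c t) (c s) < e" using assms(3)[OF t, of s] by linarith
  qed
next
  fix s t assume "a \<le> s" "s \<le> t" "t \<le> b"
  then show "d (c s) (c t) \<le> t - s" using assms(3)[of s t] by auto
qed

text \<open>A length space provides a curve shorter than \<open>L\<close>; its arc-length function
  serves as \<open>\<sigma>\<close> for the polygon.\<close>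

lemma reach_dist_less:
  assumes xy: "x \<in> X" "y \<in> X" "d x y < L"
  shows "reach L x y"
proof -
  obtain c a b where ab: "a < b" and c: "continuous_map (top_of_set {a..b}) mtopology c"
    and ends: "c a = x" "c b = y" and len: "curve_length d c a b < ennreal L"
    using short_curve[OF xy] by blast
  define \<sigma> where "\<sigma> t = enn2real (curve_length d c a t)" for t
  have mem: "c t \<in> X" if "t \<in> {a..b}" for t using continuous_curveD(1)[OF c that] .
  have fin: "curve_length d c a t < top" if "a \<le> t" "t \<le> b" for t
  proof (cases "t = b")
    case False
    then have "curve_length d c a t + ennreal (d (c t) (c b)) \<le> curve_length d c a b"
      using that by (intro curve_length_add_dist_le) auto
    then have "curve_length d c a t \<le> curve_length d c a b"
      by (meson le_iff_add order_trans order_refl)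
    also have "\<dots> < top" by (rule less_trans[OF len ennreal_less_top])
    finally show ?thesis .
  next
    case True
    show ?thesis unfolding True by (rule less_trans[OF len ennreal_less_top])
  qed
  have "reach (\<sigma> b - \<sigma> a) (c a) (c b)"
  proof (rule reach_polygon[OF less_imp_le[OF ab] mem])
    fix s t assume st: "a \<le> s" "s \<le> t" "t \<le> b"
    show "d (c s) (c t) \<le> \<sigma> t - \<sigma> s"
    proof (cases "s = t")
      case True then show ?thesis using mem st by simp
    next
      case False
      then have "curve_length d c a s + ennreal (d (c s) (c t)) \<le> curve_length d c a t"
        using st by (intro curve_length_add_dist_le) auto
      moreover have "curve_length d c a s = ennreal (\<sigma> s)" "curve_length d c a t = ennreal (\<sigma> t)"
        using fin[of s] fin[of t] st by (auto simp: \<sigma>_def)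
      moreover have \<sigma>0: "0 \<le> \<sigma> s" "0 \<le> \<sigma> t" by (simp_all add: \<sigma>_def)
      ultimately have "ennreal (\<sigma> s + d (c s) (c t)) \<le> ennreal (\<sigma> t)"
        by (simp only: ennreal_plus nonneg)
      then have "\<sigma> s + d (c s) (c t) \<le> \<sigma> t" using \<sigma>0(2) by (simp only: ennreal_le_iff)
      then show ?thesis by simp
    qed
  qed (use continuous_curveD(2)[OF c] in auto)
  moreover have "\<sigma> b - \<sigma> a \<le> L"
  proof -
    have "curve_length d c a b = ennreal (\<sigma> b)" using fin[of b] ab by (simp add: \<sigma>_def)
    moreover have \<sigma>0: "0 \<le> \<sigma> a" "0 \<le> \<sigma> b" by (simp_all add: \<sigma>_def)
    ultimately have "\<sigma> b < L" using len by (simp only: ennreal_less_iff)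
    then show ?thesis using \<sigma>0 by simp
  qed
  ultimately show ?thesis using reach_mono[of _ x y L] ends xy by auto
qed

end

section \<open>The causal relations and the time separation\<close>

locale length_cone = cone X d I f + locally_compact_length_space X d
  for X :: "'a set" and d :: "'a \<Rightarrow> 'a \<Rightarrow> real" and I f
begin

abbreviation "Z \<equiv> I \<times> X"
abbreviation "D \<equiv> cone_dist d"
abbreviation "le \<equiv> cone_le I X d f"
abbreviation "ll \<equiv> cone_ll I X d f"
abbreviation "\<tau> \<equiv> cone_tau I X d f"
abbreviation "causal_curve \<equiv> lpls_causal_curve Z D le"

text \<open>Time itself is the parameter, and the fibre curve is run at the rate \<open>W\<close>.
  Taking \<open>W = H\<close> gives causal curves, and \<open>W = A k\<close> with
  \<open>k > 0\<close> gives timelike ones with controlled length.\<close>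

lemma graph_curve:
  assumes I: "s \<in> I" "t \<in> I" "s < t" and reach: "reach (W t - W s) x y"
    and W: "\<And>u. u \<in> I \<Longrightarrow> (W has_real_derivative w u) (at u)"
    and w: "\<And>u. u \<in> I \<Longrightarrow> 0 < w u" "\<And>u. u \<in> I \<Longrightarrow> w u \<le> 1 / f u"
  obtains \<beta> where "cone_fd_causal_from_to I X d f (s, x) (t, y) (\<lambda>u. u) \<beta> s t"
    "AE u in lborel. u \<in> {s..t} \<longrightarrow> 0 \<le> metric_deriv d \<beta> {s..t} u \<and> metric_deriv d \<beta> {s..t} u \<le> w u"
proof -
  define L where "L = W t - W s"
  obtain \<phi> E where L: "0 \<le> L" and p: "\<phi> 0 = x" "\<phi> L = y" "\<And>t. t \<in> {0..L} \<Longrightarrow> \<phi> t \<in> X"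
     "\<And>s t. s \<in> {0..L} \<Longrightarrow> t \<in> {0..L} \<Longrightarrow> d (\<phi> s) (\<phi> t) \<le> \<bar>s - t\<bar>"
     "finite E" "\<And>t. t \<in> {0..L} - E \<Longrightarrow> \<exists>v. metric_speed d \<phi> t v"
    using reach unfolding reach_def L_def by blast
  define \<beta> where "\<beta> u = \<phi> (W u - W s)" for u
  have st: "u \<in> I" if "u \<in> {s..t}" for u using Icc_subset[OF I(1,2)] that by auto
  have Wless: "W u < W v" if "u \<in> I" "v \<in> I" "u < v" for u v
    using increment_less[OF that, of "\<lambda>_. 0" "\<lambda>_. 0" W w] W w(1) by simp
  have Wle: "W u \<le> W v" if "u \<in> I" "v \<in> I" "u \<le> v" for u v
    using Wless[of u v] that by (cases "u = v") auto
  have WH: "W v - W u \<le> H v - H u" if "u \<in> I" "v \<in> I" "u \<le> v" for u v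
    by (rule increment_le[OF that W H_deriv w(2)])
  have dom: "W u - W s \<in> {0..L}" if "u \<in> {s..t}" for u
    using Wle[of s u] Wle[of u t] st[OF that] I that by (auto simp: L_def)
  have \<beta>X: "\<beta> u \<in> X" if "u \<in> {s..t}" for u using p(3)[OF dom[OF that]] by (simp add: \<beta>_def)
  obtain C where C: "0 \<le> C" "\<And>u v. \<lbrakk>s \<le> u; u \<le> v; v \<le> t\<rbrakk> \<Longrightarrow> H v - H u \<le> C * (v - u)"
    using H_Lipschitz[OF I(1,2)] by blast
  have ac: "abs_cont_curve (cone_dist d) (\<lambda>u. (u, \<beta> u)) s t"
  proof (rule abs_cont_curve_Lipschitz[of "C + 1"])
    show "0 \<le> C + 1" using C by simp
    fix u v assume uv: "s \<le> u" "u \<le> v" "v \<le> t"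
    then have "d (\<beta> u) (\<beta> v) \<le> W v - W u"
      using p(4)[OF dom[of u] dom[of v]] Wle[of u v] st[of u] st[of v] by (simp add: \<beta>_def)
    also have "\<dots> \<le> C * (v - u)" using WH[of u v] st[of u] st[of v] C(2)[OF uv] uv by simp
    finally show "cone_dist d (u, \<beta> u) (v, \<beta> v) \<le> (C + 1) * (v - u)"
      using uv by (simp add: cone_dist_def algebra_simps)
  qed
  \<comment> \<open>\<open>W\<close> is strictly increasing, so the finitely many exceptional fibre
    parameters have finitely many preimages.\<close>
  define N where "N = {s, t} \<union> {u \<in> {s..t}. W u - W s \<in> E}"
  have "finite {u \<in> {s..t}. W u - W s \<in> E}"
  proof (rule finite_imageD)
    show "finite ((\<lambda>u. W u - W s) ` {u \<in> {s..t}. W u - W s \<in> E})"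
      by (rule finite_subset[OF _ p(5)]) auto
    show "inj_on (\<lambda>u. W u - W s) {u \<in> {s..t}. W u - W s \<in> E}"
    proof (rule inj_onI)
      fix u v assume "u \<in> {u \<in> {s..t}. W u - W s \<in> E}" "v \<in> {u \<in> {s..t}. W u - W s \<in> E}" "W u - W s = W v - W s"
      then show "u = v" using Wless[of u v] Wless[of v u] st[of u] st[of v] by (cases u v rule: linorder_cases) auto
    qed
  qed
  then have "finite N" by (simp add: N_def)
  then have "N \<in> null_sets lborel" by (rule finite_imp_null_set_lborel)
  then have AE_N: "AE u in lborel. u \<notin> N" by (rule AE_not_in)
  have speed: "\<exists>v. has_metric_derivative d \<beta> {s..t} u v \<and> metric_deriv d \<beta> {s..t} u = v \<and> 0 \<le> v \<and> v \<le> w u"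
    if u: "u \<in> {s..t}" "u \<notin> N" for u
  proof -
    have uI: "u \<in> I" and u': "s < u" "u < t" using st u by (auto simp: N_def)
    define z where "z = W u - W s"
    have z: "0 < z" "z < L" "z \<notin> E"
      using Wless[of s u] Wless[of u t] uI I u' u by (auto simp: z_def L_def N_def)
    then obtain v where v: "metric_speed d \<phi> z v" using p(6)[of z] by auto
    have "v \<le> 1"
    proof (rule tendsto_upperbound[OF v[unfolded metric_speed_def]])
      have "eventually (\<lambda>q. q \<in> {0<..<L}) (at z)" using z by (intro eventually_at_in_open') auto
      then show "eventually (\<lambda>q. d (\<phi> q) (\<phi> z) / \<bar>q - z\<bar> \<le> 1) (at z)"
      proof (rule eventually_mono)
        fix q assume "q \<in> {0<..<L}"
        then show "d (\<phi> q) (\<phi> z) / \<bar>q - z\<bar> \<le> 1"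
          using p(4)[of q z] z by (simp add: divide_le_eq_1)
      qed
    qed simp
    moreover have "0 \<le> v" by (rule tendsto_lowerbound[OF v[unfolded metric_speed_def]]) simp_all
    ultimately have bounds: "0 \<le> v * w u" "v * w u \<le> w u"
      using w(1)[OF uI] mult_right_mono[of v 1 "w u"] by auto
    have "metric_speed d \<beta> u (v * w u)"
      using metric_speed_reparam[OF v[unfolded z_def] W[OF uI] w(1)[OF uI]] unfolding \<beta>_def[abs_def] .
    then have "has_metric_derivative d \<beta> {s..t} u (v * w u)"
      unfolding metric_speed_def has_metric_derivative_def by (rule tendsto_within_subset) simp
    then show ?thesis using has_metric_derivative_eq u' bounds by blast
  qed
  have "cone_fd_causal_from_to I X d f (s, x) (t, y) (\<lambda>u. u) \<beta> s t"
    unfolding cone_fd_causal_from_to_def cone_causal_curve_def cone_curve_def future_directed_def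
  proof (intro conjI)
    show "AE u in lborel. u \<in> {s..t} \<longrightarrow> (\<lambda>u. u) differentiable at u \<and> (\<exists>v. has_metric_derivative d \<beta> {s..t} u v)"
      by (rule AE_mp[OF AE_N]) (use speed in \<open>auto intro!: AE_I2\<close>)
    show "AE u in lborel. u \<in> {s..t} \<longrightarrow> cone_lq d f (\<lambda>u. u) \<beta> s t u \<le> 0"
    proof (rule AE_mp[OF AE_N], intro AE_I2 impI)
      fix u assume "u \<notin> N" "u \<in> {s..t}"
      then obtain v where v: "metric_deriv d \<beta> {s..t} u = v" "0 \<le> v" "v \<le> w u" and uI: "u \<in> I"
        using speed st by blast
      have "f u * v \<le> f u * (1 / f u)" using v w(2)[OF uI] pos_f[OF uI] by (intro mult_left_mono) auto
      then have "f u * v \<le> 1" using pos_f[OF uI] by simp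
      then have "(f u * v)\<^sup>2 \<le> 1" using v pos_f[OF uI] by (simp add: power_le_one)
      then show "cone_lq d f (\<lambda>u. u) \<beta> s t u \<le> 0"
        by (simp add: cone_lq_def v power_mult_distrib)
    qed
  qed (use I st \<beta>X ac p in \<open>auto simp: \<beta>_def L_def\<close>)
  moreover have "AE u in lborel. u \<in> {s..t} \<longrightarrow> 0 \<le> metric_deriv d \<beta> {s..t} u \<and> metric_deriv d \<beta> {s..t} u \<le> w u"
    by (rule AE_mp[OF AE_N]) (use speed in \<open>auto intro!: AE_I2\<close>)
  ultimately show thesis using that by blast
qed

text \<open>Along a causal curve \<open>H (\<alpha> u)\<close> dominates the fibre distances, so a
  polygon of the right length replaces the fibre component. Conversely a curve realising
  \<open>reach\<close> lifts at the null rate \<open>H\<close>.\<close>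

lemma cone_le_iff:
  assumes "s \<in> I" "t \<in> I" "x \<in> X" "y \<in> X"
  shows "le (s, x) (t, y) \<longleftrightarrow> s \<le> t \<and> reach (H t - H s) x y"
proof
  assume le: "le (s, x) (t, y)"
  show "s \<le> t \<and> reach (H t - H s) x y"
  proof (cases "(s, x) = (t, y)")
    case True then show ?thesis using reach_refl[of x 0] assms by simp
  next
    case False
    then obtain \<alpha> \<beta> a b where c: "cone_causal_curve I X d f \<alpha> \<beta> a b" and fd: "future_directed \<alpha> a b"
      and ends: "(\<alpha> a, \<beta> a) = (s, x)" "(\<alpha> b, \<beta> b) = (t, y)"
      using le unfolding cone_le_def cone_fd_causal_from_to_def by blast
    have cc: "cone_curve I X d \<alpha> \<beta> a b" using c by (simp add: cone_causal_curve_def)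
    have ab: "a < b" and mem: "\<And>u. u \<in> {a..b} \<Longrightarrow> \<beta> u \<in> X" using cc by (auto simp: cone_curve_def)
    have ac: "abs_cont_curve (cone_dist d) (\<lambda>t. (\<alpha> t, \<beta> t)) a b" using cc by (simp add: cone_curve_def)
    have "reach (H (\<alpha> b) - H (\<alpha> a)) (\<beta> a) (\<beta> b)"
    proof (rule reach_polygon[where \<sigma> = "\<lambda>u. H (\<alpha> u)", OF less_imp_le[OF ab] mem])
      fix u e assume u: "u \<in> {a..b}" and e: "0 < (e::real)"
      obtain \<delta> where \<delta>: "\<delta> > 0" and D: "\<And>n (s::nat\<Rightarrow>real) t.
        (\<forall>i<n. a \<le> s i \<and> s i \<le> t i \<and> t i \<le> b) \<and>
        (\<forall>i. Suc i < n \<longrightarrow> t i \<le> s (Suc i)) \<and> (\<Sum>i<n. t i - s i) < \<delta>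
        \<longrightarrow> (\<Sum>i<n. cone_dist d (\<alpha> (s i), \<beta> (s i)) (\<alpha> (t i), \<beta> (t i))) < e"
        using ac e unfolding abs_cont_curve_def by blast
      \<comment> \<open>For a family consisting of one interval, absolute continuity is uniform
        continuity.\<close>
      have D1: "d (\<beta> p) (\<beta> q) < e" if "a \<le> p" "p \<le> q" "q \<le> b" "q - p < \<delta>" for p q
        using D[of 1 "\<lambda>_. p" "\<lambda>_. q"] that abs_ge_zero[of "\<alpha> p - \<alpha> q"] by (simp add: cone_dist_def)
      show "\<exists>\<delta>>0. \<forall>s\<in>{a..b}. \<bar>s - u\<bar> < \<delta> \<longrightarrow> d (\<beta> u) (\<beta> s) < e"
      proof (intro exI[of _ \<delta>] conjI ballI impI \<delta>)
        fix p assume "p \<in> {a..b}" "\<bar>p - u\<bar> < \<delta>"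
        then show "d (\<beta> u) (\<beta> p) < e"
          using D1[of u p] D1[of p u] u commute[of "\<beta> p" "\<beta> u"] by (cases "u \<le> p") auto
      qed
    qed (auto intro: causal_curve_dist_le[OF c fd])
    then show ?thesis using ends fd_increasing[OF cc fd order_refl ab order_refl] by simp
  qed
next
  assume r: "s \<le> t \<and> reach (H t - H s) x y"
  show "le (s, x) (t, y)"
  proof (cases "s = t")
    case True
    then have "d x y \<le> 0" using r reach_dist_le by force
    then have "x = y" using assms nonneg[of x y] by simp
    then show ?thesis using True by (simp add: cone_le_def)
  next
    case False
    then have st: "s < t" using r by simp
    obtain \<beta> where "cone_fd_causal_from_to I X d f (s, x) (t, y) (\<lambda>u. u) \<beta> s t"
      by (rule graph_curve[OF assms(1,2) st conjunct2[OF r] H_deriv]) (use pos_f in auto)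
    then show ?thesis unfolding cone_le_def by blast
  qed
qed

text \<open>Weak duality: each multiplier bounds every competing curve. Where no curve competes, the
  supremum is 0.\<close>

lemma tau_upper:
  assumes "0 \<le> l"
  shows "\<tau> (s, x) (t, y) \<le> ennreal (G l t - G l s - l * d x y)"
  unfolding cone_tau_def
proof (rule SUP_least, clarsimp)
  fix \<alpha> \<beta> a b assume "cone_fd_causal_from_to I X d f (s, x) (t, y) \<alpha> \<beta> a b"
  then have c: "cone_causal_curve I X d f \<alpha> \<beta> a b" "future_directed \<alpha> a b"
    and "\<alpha> a = s" "\<beta> a = x" "\<alpha> b = t" "\<beta> b = y" by (auto simp: cone_fd_causal_from_to_def)
  then show "cone_length d f \<alpha> \<beta> a b \<le> ennreal (G l t - G l s - l * d x y)"
    using causal_curve_length_le(1)[OF c assms] by simp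
qed

text \<open>Nonnegativity of the dual bounds, which allows them to be added inside
  \<open>ennreal\<close> in the reverse triangle inequality.\<close>

lemma le_increment:
  assumes "le (s, x) (t, y)" "0 \<le> l" "x \<in> X"
  shows "l * d x y \<le> G l t - G l s"
proof (cases "(s, x) = (t, y)")
  case False
  then obtain \<alpha> \<beta> a b where "cone_fd_causal_from_to I X d f (s, x) (t, y) \<alpha> \<beta> a b"
    using assms(1) unfolding cone_le_def by blast
  then have c: "cone_causal_curve I X d f \<alpha> \<beta> a b" "future_directed \<alpha> a b"
    and "\<alpha> a = s" "\<beta> a = x" "\<alpha> b = t" "\<beta> b = y" by (auto simp: cone_fd_causal_from_to_def)
  then show ?thesis using causal_curve_length_le(2)[OF c assms(2)] by simp
qed (use assms in auto)

text \<open>Fibre speed at most \<open>l / (f * hyp)\<close> leaves length density at least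
  \<open>f / hyp\<close>. An inequality suffices here, so the fibre curve may be shorter than the
  duration it is given.\<close>

lemma tau_lower:
  assumes I: "s \<in> I" "t \<in> I" "s < t" and l: "0 < l" and reach: "reach (A l t - A l s) x y"
  shows "ennreal (B l t - B l s) \<le> \<tau> (s, x) (t, y)"
proof -
  obtain \<beta> where c: "cone_fd_causal_from_to I X d f (s, x) (t, y) (\<lambda>u. u) \<beta> s t"
    and AE: "AE u in lborel. u \<in> {s..t} \<longrightarrow> 0 \<le> metric_deriv d \<beta> {s..t} u
        \<and> metric_deriv d \<beta> {s..t} u \<le> l / (f u * hyp l u)"
    by (rule graph_curve[OF I reach A_deriv])
       (use l pos_f hyp_pos A_integrand_lt in \<open>auto simp: less_imp_le\<close>)
  have st: "u \<in> I" if "u \<in> {s..t}" for u using Icc_subset[OF I(1,2)] that by auto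
  have "((\<lambda>u. f u / hyp l u) has_integral (B l t - B l s)) {s..t}"
    using I st by (intro fundamental_theorem_of_calculus)
       (auto simp flip: has_real_derivative_iff_has_vector_derivative
          intro!: has_field_derivative_at_within[OF B_deriv])
  then have "ennreal (B l t - B l s) = (\<integral>\<^sup>+u. ennreal (f u / hyp l u) * indicator {s..t} u \<partial>lborel)"
    using st pos_f hyp_pos by (intro nn_integral_has_integral_lebesgue'[symmetric]) (auto simp: less_imp_le)
  also have "\<dots> \<le> cone_length d f (\<lambda>u. u) \<beta> s t"
    unfolding cone_length_def
  proof (rule nn_integral_mono_AE, rule AE_mp[OF AE], intro AE_I2 impI)
    fix u assume u: "u \<in> {s..t} \<longrightarrow> 0 \<le> metric_deriv d \<beta> {s..t} u \<and> metric_deriv d \<beta> {s..t} u \<le> l / (f u * hyp l u)"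
    show "ennreal (f u / hyp l u) * indicator {s..t} u \<le> indicator {s..t} u *
       ennreal (sqrt ((deriv (\<lambda>u. u) u)\<^sup>2 - (f u)\<^sup>2 * (metric_deriv d \<beta> {s..t} u)\<^sup>2))"
    proof (cases "u \<in> {s..t}")
      case True
      define v where "v = metric_deriv d \<beta> {s..t} u"
      have v: "0 \<le> v" "v \<le> l / (f u * hyp l u)" using u True by (auto simp: v_def)
      have fh: "0 < f u" "0 < hyp l u" using pos_f hyp_pos st[OF True] by auto
      have "(f u)\<^sup>2 * v\<^sup>2 \<le> (f u)\<^sup>2 * (l / (f u * hyp l u))\<^sup>2"
        using v by (intro mult_left_mono power_mono) auto
      also have "\<dots> = 1 - (f u / hyp l u)\<^sup>2"
      proof -
        have "(f u)\<^sup>2 * (l / (f u * hyp l u))\<^sup>2 = ((hyp l u)\<^sup>2 - (f u)\<^sup>2) / (hyp l u)\<^sup>2"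
          using fh(1) by (simp add: hyp_sq power_divide power_mult_distrib)
        then show ?thesis using fh(2) by (simp add: power_divide diff_divide_distrib)
      qed
      finally have "(f u / hyp l u)\<^sup>2 \<le> 1 - (f u)\<^sup>2 * v\<^sup>2" by simp
      then have "f u / hyp l u \<le> sqrt (1 - (f u)\<^sup>2 * v\<^sup>2)" by (rule real_le_rsqrt)
      then show ?thesis using True by (simp add: v_def ennreal_leI)
    qed simp
  qed
  also have "\<dots> \<le> \<tau> (s, x) (t, y)"
    unfolding cone_tau_def using c by (intro SUP_upper2[of "(\<lambda>u. u, \<beta>, s, t)"]) auto
  finally show ?thesis .
qed

text \<open>If \<open>d x y\<close> equals the increment of \<open>A l\<close>, a fibre curve of
  that length may not exist. Any larger multiplier leaves room for one, and its length comes
  arbitrarily close to that of \<open>l\<close>.\<close>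

lemma tau_lower_dist:
  assumes I: "s \<in> I" "t \<in> I" "s < t" and l: "0 \<le> l" and xy: "x \<in> X" "y \<in> X" and le: "d x y \<le> A l t - A l s"
  shows "ennreal (B l t - B l s) \<le> \<tau> (s, x) (t, y)"
proof (rule ccontr)
  assume "\<not> ?thesis"
  then have less: "\<tau> (s, x) (t, y) < ennreal (B l t - B l s)" by simp
  define r where "r = enn2real (\<tau> (s, x) (t, y))"
  have "\<tau> (s, x) (t, y) < top" using less by (rule less_trans) simp
  then have r: "\<tau> (s, x) (t, y) = ennreal r" by (simp add: r_def)
  have r0: "0 \<le> r" by (simp add: r_def)
  have "r < B l t - B l s" using less r0 by (simp only: r ennreal_less_iff)
  then obtain k where k: "l < k" "A l t - A l s < A k t - A k s" "r < B k t - B k s"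
    using slope_increase[OF I l] by blast
  have "ennreal (B k t - B k s) \<le> \<tau> (s, x) (t, y)"
    using k le l by (intro tau_lower[OF I] reach_dist_less xy) auto
  then have "B k t - B k s \<le> r" using r0 by (simp only: r ennreal_le_iff)
  then show False using k(3) by simp
qed

text \<open>Strong duality: when \<open>l\<close> solves the constraint, \<open>G - l * d\<close>
  collapses to \<open>B\<close>, and the two bounds coincide.\<close>

lemma tau_eq:
  assumes I: "s \<in> I" "t \<in> I" "s < t" and l: "0 \<le> l" and xy: "x \<in> X" "y \<in> X" and eq: "A l t - A l s = d x y"
  shows "\<tau> (s, x) (t, y) = ennreal (B l t - B l s)"
proof (rule antisym)
  have "G l t - G l s - l * d x y = B l t - B l s" by (simp add: G_def eq[symmetric] algebra_simps)
  then show "\<tau> (s, x) (t, y) \<le> ennreal (B l t - B l s)" using tau_upper[OF l, of s x t y] by simp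
qed (use tau_lower_dist[OF I l xy] eq in simp)

lemma tau_slope:
  assumes I: "s \<in> I" "t \<in> I" "s < t" and xy: "x \<in> X" "y \<in> X" and less: "d x y < H t - H s"
  obtains l where "0 \<le> l" "A l t - A l s = d x y" "\<tau> (s, x) (t, y) = ennreal (B l t - B l s)"
proof -
  obtain l where "0 \<le> l" "A l t - A l s = d x y"
    by (rule slope_exists[OF I _ less]) auto
  then show thesis using that tau_eq[OF I _ xy] by blast
qed

lemma tau_eq_0:
  assumes "s \<in> I" "t \<in> I" "x \<in> X" "y \<in> X" and "\<not> (s < t \<and> d x y < H t - H s)"
  shows "\<tau> (s, x) (t, y) = 0"
proof (cases "s < t")
  case True
  then have ge: "H t - H s \<le> d x y" using assms by simp
  define F where "F = prim f t - prim f s"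
  have F: "0 \<le> F" using prim_f_le[of s t] assms True by (simp add: F_def)
  have "\<tau> (s, x) (t, y) \<le> ennreal e" if e: "0 < e" for e
  proof -
    \<comment> \<open>Then \<open>F / l\<close> is below \<open>e\<close>, and the summand 1 keeps
      \<open>l\<close> positive when \<open>F = 0\<close>.\<close>
    define l where "l = (F + 1) / e"
    have l: "0 < l" using F e by (simp add: l_def)
    have "G l t - G l s \<le> l * (H t - H s) + F / l"
      using G_upper[OF assms(1,2) less_imp_le[OF True] l] by (simp add: F_def)
    also have "\<dots> \<le> l * d x y + e"
    proof (intro add_mono mult_left_mono ge)
      show "F / l \<le> e" using F e by (simp add: l_def field_simps)
    qed (use l in simp)
    finally have "ennreal (G l t - G l s - l * d x y) \<le> ennreal e" by (intro ennreal_leI) simp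
    then show ?thesis using tau_upper[of l s x t y] l by simp
  qed
  note small = this
  have "\<tau> (s, x) (t, y) \<le> 0"
    by (rule ennreal_le_epsilon) (simp add: small)
  then show ?thesis by simp
next
  case False
  have "\<not> cone_fd_causal_from_to I X d f (s, x) (t, y) \<alpha> \<beta> a b" for \<alpha> \<beta> a b
  proof
    assume "cone_fd_causal_from_to I X d f (s, x) (t, y) \<alpha> \<beta> a b"
    then have "cone_curve I X d \<alpha> \<beta> a b" "future_directed \<alpha> a b" "\<alpha> a = s" "\<alpha> b = t"
      by (auto simp: cone_fd_causal_from_to_def cone_causal_curve_def)
    then show False using fd_increasing[of \<alpha> \<beta> a b a b] False by (auto simp: cone_curve_def)
  qed
  then have "{(\<alpha>, \<beta>, a, b). cone_fd_causal_from_to I X d f (s, x) (t, y) \<alpha> \<beta> a b} = {}" by simp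
  then show ?thesis by (simp only: cone_tau_def) (simp add: bot_ennreal)
qed

text \<open>Strictness is the issue. Equality of fibre distance and \<open>H\<close>-increment
  between the ends would spread to every subinterval, making the metric derivative equal to
  \<alpha>' / f at a generic point, which contradicts timelikeness there. For the converse, room
  below the null limit permits a fibre speed strictly below 1 / f.\<close>

lemma cone_ll_iff:
  assumes "s \<in> I" "t \<in> I" "x \<in> X" "y \<in> X"
  shows "ll (s, x) (t, y) \<longleftrightarrow> s < t \<and> d x y < H t - H s"
proof
  assume "ll (s, x) (t, y)"
  then obtain \<alpha> \<beta> a b where tl: "cone_timelike_curve I X d f \<alpha> \<beta> a b" and fd: "future_directed \<alpha> a b"
    and "(\<alpha> a, \<beta> a) = (s, x)" "(\<alpha> b, \<beta> b) = (t, y)"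
    unfolding cone_ll_def by blast
  then have ends: "\<alpha> a = s" "\<beta> a = x" "\<alpha> b = t" "\<beta> b = y" by simp_all
  have cc: "cone_curve I X d \<alpha> \<beta> a b" and neg: "AE u in lborel. u \<in> {a..b} \<longrightarrow> cone_lq d f \<alpha> \<beta> a b u < 0"
    using tl by (auto simp: cone_timelike_curve_def)
  then have c: "cone_causal_curve I X d f \<alpha> \<beta> a b"
    unfolding cone_causal_curve_def by (auto elim!: eventually_mono)
  have ab: "a < b" and mem: "\<And>u. u \<in> {a..b} \<Longrightarrow> \<beta> u \<in> X" "\<And>u. u \<in> {a..b} \<Longrightarrow> \<alpha> u \<in> I"
    using cc by (auto simp: cone_curve_def)
  have st: "s < t" using fd_increasing[OF cc fd order_refl ab order_refl] ends by simp
  have "d x y < H t - H s"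
  proof (rule ccontr)
    assume "\<not> d x y < H t - H s"
    then have ge: "H (\<alpha> b) - H (\<alpha> a) \<le> d (\<beta> a) (\<beta> b)" using ends by simp
    \<comment> \<open>The three pieces obey the upper bound separately and attain it jointly, so
      none of them can fall short.\<close>
    have eq: "d (\<beta> p) (\<beta> q) = H (\<alpha> q) - H (\<alpha> p)" if "a \<le> p" "p \<le> q" "q \<le> b" for p q
    proof -
      have "d (\<beta> a) (\<beta> b) \<le> d (\<beta> a) (\<beta> p) + d (\<beta> p) (\<beta> q) + d (\<beta> q) (\<beta> b)"
        using triangle[of "\<beta> a" "\<beta> p" "\<beta> b"] triangle[of "\<beta> p" "\<beta> q" "\<beta> b"] mem(1) that by auto
      moreover have "d (\<beta> a) (\<beta> p) \<le> H (\<alpha> p) - H (\<alpha> a)" "d (\<beta> p) (\<beta> q) \<le> H (\<alpha> q) - H (\<alpha> p)"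
        "d (\<beta> q) (\<beta> b) \<le> H (\<alpha> b) - H (\<alpha> q)"
        using that by (auto intro!: causal_curve_dist_le[OF c fd])
      ultimately show ?thesis using ge by linarith
    qed
    have "AE u in lborel. u \<in> {a..b} \<longrightarrow> \<alpha> differentiable (at u) \<and>
       (\<exists>v. has_metric_derivative d \<beta> {a..b} u v) \<and> deriv \<alpha> u > 0 \<and> cone_lq d f \<alpha> \<beta> a b u < 0"
      using cc fd neg unfolding cone_curve_def future_directed_def by auto
    then obtain N where N: "negligible N" and P: "\<And>u. u \<notin> N \<Longrightarrow> u \<in> {a..b} \<longrightarrow> \<alpha> differentiable (at u) \<and>
       (\<exists>v. has_metric_derivative d \<beta> {a..b} u v) \<and> deriv \<alpha> u > 0 \<and> cone_lq d f \<alpha> \<beta> a b u < 0"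
      using AE_lborel_negligible by blast
    have "\<not> negligible {a<..<b}"
      using open_not_negligible[of "{a<..<b}"] ab by auto
    then obtain u where u: "a < u" "u < b" "u \<notin> N"
      using negligible_subset[OF N] by (meson greaterThanLessThan_iff subsetI)
    obtain v where v: "has_metric_derivative d \<beta> {a..b} u v"
      and diff: "\<alpha> differentiable (at u)" and pos: "deriv \<alpha> u > 0" and lq: "cone_lq d f \<alpha> \<beta> a b u < 0"
      using P[of u] u by auto
    have uI: "\<alpha> u \<in> I" using mem u by auto
    have fpos: "0 < f (\<alpha> u)" by (rule pos_f[OF uI])
    have "((\<lambda>u. H (\<alpha> u)) has_real_derivative 1 / f (\<alpha> u) * deriv \<alpha> u) (at u)"
      using DERIV_chain2[where f = H and g = \<alpha>, OF H_deriv[OF uI], of "deriv \<alpha> u" UNIV] diff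
      by (simp add: DERIV_deriv_iff_real_differentiable)
    then have lim: "((\<lambda>q. (H (\<alpha> q) - H (\<alpha> u)) / (q - u)) \<longlongrightarrow> deriv \<alpha> u / f (\<alpha> u)) (at u)"
      by (simp add: has_field_derivative_iff)
    have "((\<lambda>q. d (\<beta> q) (\<beta> u) / \<bar>q - u\<bar>) \<longlongrightarrow> deriv \<alpha> u / f (\<alpha> u)) (at u)"
    proof (rule Lim_transform_within_open[OF lim, of "{a<..<b}"])
      fix q assume q: "q \<in> {a<..<b}" "q \<noteq> u"
      show "(H (\<alpha> q) - H (\<alpha> u)) / (q - u) = d (\<beta> q) (\<beta> u) / \<bar>q - u\<bar>"
      proof (cases "q < u")
        case True
        then have "d (\<beta> q) (\<beta> u) = H (\<alpha> u) - H (\<alpha> q)" using eq[of q u] q u by auto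
        then show ?thesis using True minus_divide_divide[of "H (\<alpha> q) - H (\<alpha> u)" "q - u"] by simp
      next
        case False
        then have "d (\<beta> u) (\<beta> q) = H (\<alpha> q) - H (\<alpha> u)" using eq[of u q] q u by auto
        then show ?thesis using False by (simp add: commute[of "\<beta> q" "\<beta> u"])
      qed
    qed (use u in auto)
    moreover have "at u within {a..b} = at u" using u by (simp add: at_within_Icc_at)
    ultimately have "has_metric_derivative d \<beta> {a..b} u (deriv \<alpha> u / f (\<alpha> u))"
      by (simp add: has_metric_derivative_def)
    then have "metric_deriv d \<beta> {a..b} u = deriv \<alpha> u / f (\<alpha> u)"
      by (rule has_metric_derivative_eq) (use u in auto)
    then show False using lq fpos by (simp add: cone_lq_def power_divide)
  qed
  with st show "s < t \<and> d x y < H t - H s" by blast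
next
  assume *: "s < t \<and> d x y < H t - H s"
  then have st: "s < t" and less: "d x y < H t - H s" by auto
  obtain l where l: "0 \<le> l" "A l t - A l s = d x y"
    by (rule slope_exists[OF assms(1,2) st _ less]) auto
  \<comment> \<open>A fibre curve of length exactly \<open>d x y\<close> may be missing; the larger
    multiplier makes room for one and stays strictly below the null speed.\<close>
  obtain k where k: "l < k" "A l t - A l s < A k t - A k s"
    by (rule slope_increase[OF assms(1,2) st l(1), of 0]) (use B_less[OF assms(1,2) st] in auto)
  have reach: "reach (A k t - A k s) x y" using k l assms by (intro reach_dist_less) auto
  obtain \<beta> where c: "cone_fd_causal_from_to I X d f (s, x) (t, y) (\<lambda>u. u) \<beta> s t"
    and AE: "AE u in lborel. u \<in> {s..t} \<longrightarrow> 0 \<le> metric_deriv d \<beta> {s..t} u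
        \<and> metric_deriv d \<beta> {s..t} u \<le> k / (f u * hyp k u)"
    by (rule graph_curve[OF assms(1,2) st reach A_deriv])
       (use k l pos_f hyp_pos A_integrand_lt in \<open>auto simp: less_imp_le\<close>)
  have "AE u in lborel. u \<in> {s..t} \<longrightarrow> cone_lq d f (\<lambda>u. u) \<beta> s t u < 0"
  proof (rule AE_mp[OF AE], intro AE_I2 impI)
    fix u assume u: "u \<in> {s..t}" "u \<in> {s..t} \<longrightarrow> 0 \<le> metric_deriv d \<beta> {s..t} u
        \<and> metric_deriv d \<beta> {s..t} u \<le> k / (f u * hyp k u)"
    define v where "v = metric_deriv d \<beta> {s..t} u"
    have uI: "u \<in> I" using Icc_subset[OF assms(1,2)] u by auto
    have v: "0 \<le> v" "v < 1 / f u" using u A_integrand_lt[OF uI, of k] by (auto simp: v_def)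
    have "0 \<le> f u * v" "f u * v < 1" using v pos_f[OF uI] by (auto simp: field_simps)
    then have "(f u * v)\<^sup>2 < 1" by (simp add: power_less_one_iff)
    then show "cone_lq d f (\<lambda>u. u) \<beta> s t u < 0" by (simp add: cone_lq_def v_def power_mult_distrib)
  qed
  then have "cone_timelike_curve I X d f (\<lambda>u. u) \<beta> s t"
    using c by (simp add: cone_timelike_curve_def cone_fd_causal_from_to_def cone_causal_curve_def)
  then show "ll (s, x) (t, y)"
    using c unfolding cone_ll_def cone_fd_causal_from_to_def by blast
qed

end

section \<open>The Lorentzian length space\<close>

lemma increment_isCont:
  fixes F :: "real \<Rightarrow> real"
  assumes "isCont F s" "isCont F t" "0 < \<eta>"
  obtains e where "0 < e"
    "\<And>s' t'. \<lbrakk>\<bar>s - s'\<bar> < e; \<bar>t - t'\<bar> < e\<rbrakk> \<Longrightarrow> \<bar>(F t' - F s') - (F t - F s)\<bar> < \<eta>"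
proof -
  obtain e1 where e1: "0 < e1" "\<And>s'. \<bar>s' - s\<bar> < e1 \<Longrightarrow> \<bar>F s' - F s\<bar> < \<eta> / 2"
    using assms(1,3) unfolding continuous_at_eps_delta dist_real_def by (metis half_gt_zero)
  obtain e2 where e2: "0 < e2" "\<And>t'. \<bar>t' - t\<bar> < e2 \<Longrightarrow> \<bar>F t' - F t\<bar> < \<eta> / 2"
    using assms(2,3) unfolding continuous_at_eps_delta dist_real_def by (metis half_gt_zero)
  show thesis
  proof (rule that[of "min e1 e2"])
    fix s' t' assume "\<bar>s - s'\<bar> < min e1 e2" "\<bar>t - t'\<bar> < min e1 e2"
    then have "\<bar>F s' - F s\<bar> < \<eta> / 2" "\<bar>F t' - F t\<bar> < \<eta> / 2"
      using e1(2)[of s'] e2(2)[of t'] by (simp_all add: abs_minus_commute)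
    then show "\<bar>(F t' - F s') - (F t - F s)\<bar> < \<eta>" by linarith
  qed (use e1 e2 in simp)
qed

lemma lorentzian_pre_length_space_subset:
  assumes Z: "lorentzian_pre_length_space Z D le ll \<tau>" and "Z' \<subseteq> Z"
  shows "lorentzian_pre_length_space Z' D le ll \<tau>"
proof -
  have sub: "x \<in> Z" if "x \<in> Z'" for x using assms(2) that by blast
  show ?thesis
    unfolding lorentzian_pre_length_space_def
  proof (intro conjI ballI)
    show "Metric_space Z' D"
      using Z by (intro Metric_space.subspace[OF _ assms(2)]) (simp add: lorentzian_pre_length_space_def)
    have lsc: "lower_semicont_tau Z D \<tau>" using Z by (simp add: lorentzian_pre_length_space_def)
    show "lower_semicont_tau Z' D \<tau>"
      unfolding lower_semicont_tau_def
    proof (intro ballI allI impI)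
      fix x y c assume xy: "x \<in> Z'" "y \<in> Z'" and c: "c < \<tau> x y"
      obtain e where "e > 0" "\<forall>x'\<in>Z. \<forall>y'\<in>Z. D x x' < e \<longrightarrow> D y y' < e \<longrightarrow> c < \<tau> x' y'"
        using lsc[unfolded lower_semicont_tau_def, rule_format, OF sub[OF xy(1)] sub[OF xy(2)] c] by blast
      then show "\<exists>e>0. \<forall>x'\<in>Z'. \<forall>y'\<in>Z'. D x x' < e \<longrightarrow> D y y' < e \<longrightarrow> c < \<tau> x' y'"
        using sub by blast
    qed
  next
    have t1: "\<forall>x\<in>Z. \<forall>y\<in>Z. \<forall>z\<in>Z. le x y \<longrightarrow> le y z \<longrightarrow> le x z"
      using Z unfolding lorentzian_pre_length_space_def by (elim conjE)
    have t2: "\<forall>x\<in>Z. \<forall>y\<in>Z. \<forall>z\<in>Z. ll x y \<longrightarrow> ll y z \<longrightarrow> ll x z"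
      using Z unfolding lorentzian_pre_length_space_def by (elim conjE)
    fix x y z assume "x \<in> Z'" "y \<in> Z'" "z \<in> Z'"
    then show "le x y \<longrightarrow> le y z \<longrightarrow> le x z" "ll x y \<longrightarrow> ll y z \<longrightarrow> ll x z"
      using t1 t2 sub by blast+
  qed (use Z in \<open>simp_all add: lorentzian_pre_length_space_def sub\<close>)
qed

lemma tau_length_le:
  assumes "a < b"
  shows "tau_length \<tau> \<gamma> a b \<le> \<tau> (\<gamma> a) (\<gamma> b)"
  unfolding tau_length_def
  by (rule INF_lower2[of "(1, \<lambda>i. if i = 0 then a else b)"]) (use is_partition_two[OF assms] in auto)

section \<open>The metric of the cone and semicontinuity of the time separation\<close>

context length_cone
begin

lemma Metric_space_cone: "Metric_space Z D"
proof
  fix p q r :: "real \<times> 'a"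
  show "0 \<le> D p q" by (simp add: cone_dist_def)
  show "D p q = D q p" by (simp add: cone_dist_def abs_minus_commute commute)
  show "D p q = 0 \<longleftrightarrow> p = q" if "p \<in> Z" "q \<in> Z"
    using that zero[of "snd p" "snd q"] nonneg[of "snd p" "snd q"]
    by (auto simp: cone_dist_def add_nonneg_eq_0_iff prod_eq_iff)
  show "D p r \<le> D p q + D q r" if "p \<in> Z" "q \<in> Z" "r \<in> Z"
    using that triangle[of "snd p" "snd q" "snd r"] by (auto simp: cone_dist_def)
qed

interpretation Y: Metric_space Z D by (rule Metric_space_cone)

lemma cone_dist_bounds: "D (s, x) (s', x') < e \<Longrightarrow> \<bar>s - s'\<bar> < e \<and> d x x' < e"
  using nonneg[of x x'] abs_ge_zero[of "s - s'"] unfolding cone_dist_def fst_conv snd_conv by linarith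

lemma dist_perturb:
  assumes "x \<in> X" "x' \<in> X" "y \<in> X" "y' \<in> X" "d x x' < e" "d y y' < e"
  shows "\<bar>d x' y' - d x y\<bar> < 2 * e"
  using triangle[of x' x y'] triangle[of x y y'] triangle[of x x' y] triangle[of x' y' y]
    commute[of x' x] commute[of y' y] assms by auto

lemma tau_less_top: "\<tau> (s, x) (t, y) < top"
  using tau_upper[of 0 s x t y] by (rule le_less_trans) simp_all

lemma tau_pos_iff:
  assumes "s \<in> I" "t \<in> I" "x \<in> X" "y \<in> X"
  shows "0 < \<tau> (s, x) (t, y) \<longleftrightarrow> ll (s, x) (t, y)"
proof
  assume "0 < \<tau> (s, x) (t, y)"
  then show "ll (s, x) (t, y)" using tau_eq_0[OF assms] cone_ll_iff[OF assms] by fastforce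
next
  assume "ll (s, x) (t, y)"
  then have st: "s < t" and less: "d x y < H t - H s" using cone_ll_iff[OF assms] by auto
  obtain l where "\<tau> (s, x) (t, y) = ennreal (B l t - B l s)"
    by (rule tau_slope[OF assms(1,2) st assms(3,4) less])
  then show "0 < \<tau> (s, x) (t, y)" using B_less[OF assms(1,2) st, of l] by simp
qed

text \<open>A slightly enlarged multiplier \<open>k\<close> leaves strict room both in the covered
  distance and in the length. Both survive small changes of the endpoints with \<open>k\<close> kept
  fixed.\<close>

lemma tau_lsc:
  assumes "s \<in> I" "t \<in> I" "x \<in> X" "y \<in> X" and c: "c < \<tau> (s, x) (t, y)"
  obtains e where "0 < e"
    "\<And>p q. \<lbrakk>p \<in> Z; q \<in> Z; D (s, x) p < e; D (t, y) q < e\<rbrakk> \<Longrightarrow> c < \<tau> p q"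
proof -
  have "0 < \<tau> (s, x) (t, y)" using c by (rule le_less_trans[rotated]) simp
  then have st: "s < t" and less: "d x y < H t - H s"
    using tau_pos_iff cone_ll_iff assms by auto
  obtain l where l: "0 \<le> l" "A l t - A l s = d x y" "\<tau> (s, x) (t, y) = ennreal (B l t - B l s)"
    by (rule tau_slope[OF assms(1,2) st assms(3,4) less])
  define r where "r = enn2real c"
  have r: "c = ennreal r" "0 \<le> r" using less_trans[OF c tau_less_top] by (auto simp: r_def)
  have "r < B l t - B l s" using c unfolding l(3) r(1) ennreal_less_iff[OF r(2)] .
  then obtain k where k: "l < k" "A l t - A l s < A k t - A k s" "r < B k t - B k s"
    using slope_increase[OF assms(1,2) st l(1)] by blast
  define \<eta> where "\<eta> = (A k t - A k s - d x y) / 2"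
  have \<eta>: "0 < \<eta>" using k l by (simp add: \<eta>_def)
  obtain e1 where e1: "0 < e1" "\<And>s' t'. \<lbrakk>\<bar>s - s'\<bar> < e1; \<bar>t - t'\<bar> < e1\<rbrakk>
      \<Longrightarrow> \<bar>(A k t' - A k s') - (A k t - A k s)\<bar> < \<eta>"
    using increment_isCont[OF isCont_A[OF assms(1)] isCont_A[OF assms(2)] \<eta>] by blast
  obtain e2 where e2: "0 < e2" "\<And>s' t'. \<lbrakk>\<bar>s - s'\<bar> < e2; \<bar>t - t'\<bar> < e2\<rbrakk>
      \<Longrightarrow> \<bar>(B k t' - B k s') - (B k t - B k s)\<bar> < B k t - B k s - r"
    using increment_isCont[OF isCont_B[OF assms(1)] isCont_B[OF assms(2)], of "B k t - B k s - r" k] k(3) by auto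
  \<comment> \<open>The four bounds control the change of \<open>A k\<close>, the change of
    \<open>B k\<close>, the change of the fibre distance (at most \<open>2 * e\<close>), and the
    order of the two times.\<close>
  define e where "e = Min {e1, e2, \<eta> / 2, (t - s) / 2}"
  have e: "0 < e" "e \<le> e1" "e \<le> e2" "e \<le> \<eta> / 2" "e \<le> (t - s) / 2"
  proof -
    show "0 < e" using e1(1) e2(1) \<eta> st by (auto simp: e_def)
  qed (unfold e_def, (rule Min_le; simp)+)
  show thesis
  proof (rule that[OF e(1)])
    fix p q assume pq: "p \<in> Z" "q \<in> Z" "D (s, x) p < e" "D (t, y) q < e"
    obtain s' x' t' y' where p: "p = (s', x')" and q: "q = (t', y')" by (cases p, cases q) auto
    have mem: "s' \<in> I" "x' \<in> X" "t' \<in> I" "y' \<in> X" using pq p q by auto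
    have b: "\<bar>s - s'\<bar> < e" "d x x' < e" "\<bar>t - t'\<bar> < e" "d y y' < e"
      using pq(3,4) cone_dist_bounds unfolding p q by blast+
    have st': "s' < t'" using b(1,3) e(5) unfolding abs_less_iff by argo
    have "d x' y' < d x y + \<eta>" using dist_perturb[OF assms(3) mem(2) assms(4) mem(4) b(2,4)] e(4) by linarith
    moreover have "A k t - A k s - \<eta> < A k t' - A k s'" using e1(2)[of s' t'] b e by linarith
    ultimately have "d x' y' \<le> A k t' - A k s'" using \<eta>_def by (simp add: field_simps)
    then have "ennreal (B k t' - B k s') \<le> \<tau> p q"
      unfolding p q using k l by (intro tau_lower_dist mem st') auto
    moreover have "r < B k t' - B k s'" using e2(2)[of s' t'] b e by linarith
    then have "c < ennreal (B k t' - B k s')" using r by (simp add: ennreal_less_iff)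
    ultimately show "c < \<tau> p q" by simp
  qed
qed

text \<open>By duality one multiplier has its bound below \<open>c\<close>, and for this fixed
  multiplier the bound is continuous in the endpoints, so it works nearby too.\<close>

lemma tau_usc:
  assumes "s \<in> I" "t \<in> I" "x \<in> X" "y \<in> X" and c: "\<tau> (s, x) (t, y) < ennreal c"
  obtains e where "0 < e"
    "\<And>p q. \<lbrakk>p \<in> Z; q \<in> Z; D (s, x) p < e; D (t, y) q < e\<rbrakk> \<Longrightarrow> \<tau> p q < ennreal c"
proof -
  have c0: "0 < c" using c by (metis ennreal_eq_0_iff not_less not_less_zero)
  obtain l where l: "0 \<le> l" "G l t - G l s - l * d x y < c"
  proof -
    consider "t \<le> s" | "s < t" "d x y < H t - H s" | "s < t" "H t - H s \<le> d x y" by linarith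
    then show thesis
    proof cases
      case 1
      then show thesis using that[of 0] G_le[OF assms(2,1), of 0] c0 by simp
    next
      case 2
      obtain l where l: "0 \<le> l" "A l t - A l s = d x y" "\<tau> (s, x) (t, y) = ennreal (B l t - B l s)"
        by (rule tau_slope[OF assms(1,2) 2(1) assms(3,4) 2(2)])
      have "B l t - B l s < c"
        using c B_le[OF assms(1,2) less_imp_le[OF 2(1)], of l] unfolding l(3) by (simp add: ennreal_less_iff)
      moreover have "G l t - G l s - l * d x y = B l t - B l s"
        by (simp add: G_def l(2)[symmetric] algebra_simps)
      ultimately show thesis using that l(1) by simp
    next
      case 3
      define F where "F = prim f t - prim f s"
      have F: "0 \<le> F" using prim_f_le[of s t] assms 3 by (simp add: F_def)
      define l where "l = (F + 1) / c"
      have l: "0 < l" using F c0 by (simp add: l_def)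
      have "G l t - G l s \<le> l * (H t - H s) + F / l"
        using G_upper[OF assms(1,2) less_imp_le[OF 3(1)] l] by (simp add: F_def)
      also have "\<dots> < l * d x y + c"
      proof (rule add_le_less_mono)
        show "l * (H t - H s) \<le> l * d x y" using l 3 by (intro mult_left_mono) auto
        show "F / l < c" using F c0 by (simp add: l_def field_simps)
      qed
      finally show thesis using that[of l] l by simp
    qed
  qed
  define \<eta> where "\<eta> = (c - (G l t - G l s - l * d x y)) / 2"
  have \<eta>: "0 < \<eta>" using l by (simp add: \<eta>_def)
  obtain e1 where e1: "0 < e1" "\<And>s' t'. \<lbrakk>\<bar>s - s'\<bar> < e1; \<bar>t - t'\<bar> < e1\<rbrakk>
      \<Longrightarrow> \<bar>(G l t' - G l s') - (G l t - G l s)\<bar> < \<eta>"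
    using increment_isCont[OF isCont_G[OF assms(1)] isCont_G[OF assms(2)] \<eta>] by blast
  \<comment> \<open>A positive substitute for \<open>l\<close> in the denominator, since the
    multiplier may be 0.\<close>
  define m where "m = l + 1"
  have m: "0 < m" "l \<le> m" using l by (auto simp: m_def)
  define e where "e = min e1 (\<eta> / (2 * m))"
  have e: "0 < e" "e \<le> e1" "e \<le> \<eta> / (2 * m)" using e1(1) \<eta> m by (auto simp: e_def)
  have le: "l * (2 * e) \<le> \<eta>"
  proof -
    have "l * (2 * e) \<le> m * (2 * (\<eta> / (2 * m)))"
      using e m by (intro mult_mono) auto
    then show ?thesis using m by simp
  qed
  show thesis
  proof (rule that[OF e(1)])
    fix p q assume pq: "p \<in> Z" "q \<in> Z" "D (s, x) p < e" "D (t, y) q < e"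
    obtain s' x' t' y' where p: "p = (s', x')" and q: "q = (t', y')" by (cases p, cases q) auto
    have mem: "s' \<in> I" "x' \<in> X" "t' \<in> I" "y' \<in> X" using pq p q by auto
    have b: "\<bar>s - s'\<bar> < e" "d x x' < e" "\<bar>t - t'\<bar> < e" "d y y' < e"
      using pq(3,4) cone_dist_bounds unfolding p q by blast+
    have "d x y - d x' y' \<le> 2 * e"
      using dist_perturb[OF assms(3) mem(2) assms(4) mem(4) b(2,4)] by linarith
    then have "l * (d x y - d x' y') \<le> l * (2 * e)" using l by (intro mult_left_mono)
    then have "l * d x y - l * d x' y' \<le> \<eta>" using le by (simp add: right_diff_distrib)
    moreover have "G l t' - G l s' < G l t - G l s + \<eta>" using e1(2)[of s' t'] b e by linarith
    ultimately have "G l t' - G l s' - l * d x' y' < c" by (simp add: \<eta>_def field_simps)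
    then have "ennreal (G l t' - G l s' - l * d x' y') < ennreal c" using c0 by (rule ennreal_lessI[rotated])
    then show "\<tau> p q < ennreal c"
      unfolding p q using tau_upper[OF l(1), of s' x' t' y'] by (rule le_less_trans[rotated])
  qed
qed

section \<open>Push-up, the reverse triangle inequality and the pre-length space axioms\<close>

lemma cone_le_refl: "le p p"
  by (simp add: cone_le_def)

lemma le_dist:
  assumes "s \<in> I" "t \<in> I" "x \<in> X" "y \<in> X" "le (s, x) (t, y)"
  shows "s \<le> t" "d x y \<le> H t - H s"
  using assms cone_le_iff reach_dist_le by auto

lemma cone_le_trans:
  assumes "p \<in> Z" "q \<in> Z" "r \<in> Z" "le p q" "le q r"
  shows "le p r"
proof -
  obtain s x t y u z where *: "p = (s, x)" "q = (t, y)" "r = (u, z)" by (cases p, cases q, cases r) auto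
  have "s \<le> t" "t \<le> u" "reach (H t - H s) x y" "reach (H u - H t) y z"
    using assms cone_le_iff unfolding * by auto
  then show ?thesis
    using reach_trans[of "H t - H s" x y "H u - H t" z] assms cone_le_iff unfolding * by auto
qed

lemma ll_imp_le:
  assumes "p \<in> Z" "q \<in> Z" "ll p q"
  shows "le p q"
  using assms by (cases p, cases q) (auto simp: cone_ll_iff cone_le_iff intro: reach_dist_less)

text \<open>Push-up: a strict fibre inequality added to a weak one stays strict.\<close>

lemma
  assumes "p \<in> Z" "q \<in> Z" "r \<in> Z"
  shows ll_le_trans: "ll p q \<Longrightarrow> le q r \<Longrightarrow> ll p r" and le_ll_trans: "le p q \<Longrightarrow> ll q r \<Longrightarrow> ll p r"
proof -
  obtain s x t y u z where *: "p = (s, x)" "q = (t, y)" "r = (u, z)" by (cases p, cases q, cases r) auto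
  have mem: "s \<in> I" "t \<in> I" "u \<in> I" "x \<in> X" "y \<in> X" "z \<in> X" using assms by (auto simp: *)
  show "ll p r" if "ll p q" "le q r"
    using that le_dist[of t u y z] triangle[of x y z] mem unfolding * by (auto simp: cone_ll_iff)
  show "ll p r" if "le p q" "ll q r"
    using that le_dist[of s t x y] triangle[of x y z] mem unfolding * by (auto simp: cone_ll_iff)
qed

text \<open>Apply the optimal multiplier of the outer pair to both inner pairs: the dual bounds add
  up, and the triangle inequality in the fibre points in the right direction. If the outer pair is
  not chronological, neither inner pair is, and all separations vanish.\<close>

lemma reverse_triangle:
  assumes "p \<in> Z" "q \<in> Z" "r \<in> Z" "le p q" "le q r"
  shows "\<tau> p q + \<tau> q r \<le> \<tau> p r"
proof -
  obtain s x t y u z where *: "p = (s, x)" "q = (t, y)" "r = (u, z)" by (cases p, cases q, cases r) auto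
  have mem: "s \<in> I" "t \<in> I" "u \<in> I" "x \<in> X" "y \<in> X" "z \<in> X" using assms by (auto simp: *)
  have tri: "d x z \<le> d x y + d y z" using triangle mem by blast
  note le1 = le_dist[OF mem(1,2,4,5) assms(4)[unfolded *]] and le2 = le_dist[OF mem(2,3,5,6) assms(5)[unfolded *]]
  show ?thesis
  proof (cases "s < u \<and> d x z < H u - H s")
    case True
    then obtain l where l: "0 \<le> l" "A l u - A l s = d x z" "\<tau> (s, x) (u, z) = ennreal (B l u - B l s)"
      using tau_slope[OF mem(1,3) _ mem(4,6)] by blast
    have "\<tau> p q + \<tau> q r \<le> ennreal (G l t - G l s - l * d x y) + ennreal (G l u - G l t - l * d y z)"
      unfolding * by (intro add_mono tau_upper l)
    also have "\<dots> = ennreal ((G l t - G l s - l * d x y) + (G l u - G l t - l * d y z))"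
      using le_increment[OF assms(4)[unfolded *] l(1)] le_increment[OF assms(5)[unfolded *] l(1)] mem
      by (intro ennreal_plus[symmetric]) auto
    also have "\<dots> \<le> ennreal (B l u - B l s)"
    proof (rule ennreal_leI)
      have "l * d x z \<le> l * (d x y + d y z)" using tri l by (intro mult_left_mono)
      moreover have "B l u - B l s = G l u - G l s - l * d x z"
        by (simp add: G_def l(2)[symmetric] algebra_simps)
      ultimately show "(G l t - G l s - l * d x y) + (G l u - G l t - l * d y z) \<le> B l u - B l s"
        by (simp add: algebra_simps)
    qed
    finally show ?thesis by (simp add: * l(3))
  next
    case False
    then have "\<not> (s < t \<and> d x y < H t - H s)" "\<not> (t < u \<and> d y z < H u - H t)"
      using le1 le2 tri by linarith+
    then show ?thesis using tau_eq_0 mem by (simp add: *)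
  qed
qed

lemma cone_pre_length_space: "lorentzian_pre_length_space Z D le ll \<tau>"
  unfolding lorentzian_pre_length_space_def
proof (intro conjI ballI impI)
  show "lower_semicont_tau Z D \<tau>"
    unfolding lower_semicont_tau_def
  proof (intro ballI allI impI)
    fix p q c assume "p \<in> Z" "q \<in> Z" "c < \<tau> p q"
    moreover obtain s x t y where "p = (s, x)" "q = (t, y)" by (cases p, cases q) auto
    ultimately show "\<exists>e>0. \<forall>x'\<in>Z. \<forall>y'\<in>Z. D p x' < e \<longrightarrow> D q y' < e \<longrightarrow> c < \<tau> x' y'"
      using tau_lsc[of s t x y c] by (metis mem_Sigma_iff)
  qed
next
  fix p q assume pq: "p \<in> Z" "q \<in> Z"
  show iff: "0 < \<tau> p q \<longleftrightarrow> ll p q" using tau_pos_iff pq by auto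
  assume "\<not> le p q"
  then have "\<not> ll p q" using ll_imp_le pq by blast
  then have "\<not> 0 < \<tau> p q" unfolding iff .
  then show "\<tau> p q = 0" by simp
next
  fix p q r assume "p \<in> Z" "q \<in> Z" "r \<in> Z" "ll p q" "ll q r"
  then show "ll p r" using ll_le_trans[of p q r] ll_imp_le[of q r] by blast
next
  fix p q r assume "p \<in> Z" "q \<in> Z" "r \<in> Z" "le p q" "le q r"
  then show "le p r" "\<tau> p q + \<tau> q r \<le> \<tau> p r" by (rule cone_le_trans, rule reverse_triangle)
next
  fix p q assume "p \<in> Z" "q \<in> Z" "ll p q"
  then show "le p q" by (rule ll_imp_le)
qed (rule Metric_space_cone cone_le_refl)+

text \<open>The curves \<open>u \<mapsto> (u, c (W u - W s))\<close> with \<open>W = A l\<close> and \<open>W = H\<close> serve as (almost) maximal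
  timelike and as causal curves, respectively.\<close>

context
  fixes s t :: real and W :: "real \<Rightarrow> real" and c :: "real \<Rightarrow> 'a"
  assumes I: "s \<in> I" "t \<in> I" "s < t"
    and W_mono: "\<And>u v. \<lbrakk>u \<in> I; v \<in> I; u \<le> v\<rbrakk> \<Longrightarrow> W u \<le> W v"
    and W_le: "\<And>u v. \<lbrakk>u \<in> I; v \<in> I; u \<le> v\<rbrakk> \<Longrightarrow> W v - W u \<le> H v - H u"
    and c_mem: "\<And>p. p \<in> {0..W t - W s} \<Longrightarrow> c p \<in> X"
    and c_lip: "\<And>p q. \<lbrakk>p \<in> {0..W t - W s}; q \<in> {0..W t - W s}\<rbrakk> \<Longrightarrow> d (c p) (c q) \<le> \<bar>p - q\<bar>"
begin

lemma graph_dom: "u \<in> {s..t} \<Longrightarrow> u \<in> I \<and> W u - W s \<in> {0..W t - W s}"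
  using Icc_subset[OF I(1,2)] W_mono[of s u] W_mono[of u t] I by auto

lemma graph_dist: "\<lbrakk>s \<le> u; u \<le> v; v \<le> t\<rbrakk> \<Longrightarrow> d (c (W u - W s)) (c (W v - W s)) \<le> W v - W u"
  using graph_dom[of u] graph_dom[of v] W_mono[of u v] c_lip[of "W u - W s" "W v - W s"] by auto

lemma graph_le: 
  assumes "s \<le> u" "u \<le> v" "v \<le> t"
  shows "le (u, c (W u - W s)) (v, c (W v - W s))"
proof -
  have uv: "u \<in> I" "v \<in> I" "W u - W s \<in> {0..W t - W s}" "W v - W s \<in> {0..W t - W s}"
    using graph_dom[of u] graph_dom[of v] assms by auto
  have "reach ((W v - W s) - (W u - W s)) (c (W u - W s)) (c (W v - W s))"
    using uv W_mono[of u v] assms by (intro reach_nonexpansive c_mem c_lip) auto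
  then have "reach (H v - H u) (c (W u - W s)) (c (W v - W s))"
    by (rule reach_mono) (use W_le[of u v] uv assms c_mem in auto)
  then show ?thesis using cone_le_iff uv assms c_mem by simp
qed

lemma graph_lipschitz: "locally_lipschitz_curve D (\<lambda>u. (u, c (W u - W s))) s t"
proof -
  obtain C where C: "0 \<le> C" "\<And>u v. \<lbrakk>s \<le> u; u \<le> v; v \<le> t\<rbrakk> \<Longrightarrow> H v - H u \<le> C * (v - u)"
    using H_Lipschitz[OF I(1,2)] by blast
  have *: "D (u, c (W u - W s)) (v, c (W v - W s)) \<le> (C + 1) * \<bar>u - v\<bar>" if "s \<le> u" "u \<le> v" "v \<le> t" for u v
    using graph_dist[OF that] W_le[of u v] graph_dom[of u] graph_dom[of v] C(2)[OF that] that
    by (simp add: cone_dist_def algebra_simps)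
  have "D (u, c (W u - W s)) (v, c (W v - W s)) \<le> (C + 1) * \<bar>u - v\<bar>" if "u \<in> {s..t}" "v \<in> {s..t}" for u v
    using *[of u v] *[of v u] that Y.commute[of "(u, c (W u - W s))" "(v, c (W v - W s))"]
    by (cases "u \<le> v") (auto simp: abs_minus_commute)
  then show ?thesis unfolding locally_lipschitz_curve_def
    by (intro ballI exI[of _ "1::real"] exI[of _ "C + 1"] conjI impI) auto
qed

lemma graph_image: "(\<lambda>u. (u, c (W u - W s))) ` {s..t} \<subseteq> Z"
  using graph_dom c_mem by auto

lemma graph_lpls_causal: "causal_curve (\<lambda>u. (u, c (W u - W s))) s t"
  unfolding lpls_causal_curve_def
proof (intro conjI allI impI I graph_lipschitz graph_image)
  fix u v assume uv: "s \<le> u" "u < v" "v \<le> t"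
  show "le (u, c (W u - W s)) (v, c (W v - W s))" using uv by (intro graph_le) auto
  show "\<exists>w\<in>{u..v}. (w, c (W w - W s)) \<noteq> (u, c (W u - W s))"
    using uv by (intro bexI[of _ v]) auto
qed

lemma graph_lpls_timelike:
  assumes "\<And>u v. \<lbrakk>u \<in> I; v \<in> I; u < v\<rbrakk> \<Longrightarrow> W v - W u < H v - H u"
  shows "lpls_timelike_curve Z D ll (\<lambda>u. (u, c (W u - W s))) s t"
  unfolding lpls_timelike_curve_def
proof (intro conjI allI impI I graph_lipschitz graph_image)
  fix u v assume uv: "s \<le> u" "u < v" "v \<le> t"
  then have "u \<in> I" "v \<in> I" "c (W u - W s) \<in> X" "c (W v - W s) \<in> X"
    using graph_dom[of u] graph_dom[of v] c_mem by auto
  then show "ll (u, c (W u - W s)) (v, c (W v - W s))"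
    using graph_dist[of u v] assms[of u v] uv by (simp add: cone_ll_iff)
  show "\<exists>w\<in>{u..v}. (w, c (W w - W s)) \<noteq> (u, c (W u - W s))"
    using uv by (intro bexI[of _ v]) auto
qed

text \<open>On every piece of a partition \<open>\<tau>\<close> is at least the increment of
  \<open>B l\<close>, and these increments telescope to a bound independent of the
  partition.\<close>

lemma graph_tau_length:
  assumes W: "W = A l" "0 \<le> l"
  shows "ennreal (B l t - B l s) \<le> tau_length \<tau> (\<lambda>u. (u, c (W u - W s))) s t"
  unfolding tau_length_def
proof (rule INF_greatest, clarsimp)
  fix n p assume p: "is_partition s t n p"
  have less: "p i < p (Suc i)" and le: "s \<le> p i" "p (Suc i) \<le> t" if "i < n" for i
    using is_partition_bounds[OF p, of i] is_partition_bounds[OF p, of "Suc i"] p that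
    by (auto simp: is_partition_def)
  have mem: "p i \<in> I" "p (Suc i) \<in> I" "c (W (p i) - W s) \<in> X" "c (W (p (Suc i)) - W s) \<in> X" if "i < n" for i
    using graph_dom[of "p i"] graph_dom[of "p (Suc i)"] c_mem less[OF that] le[OF that] by auto
  have "ennreal (B l t - B l s) = ennreal (\<Sum>i<n. B l (p (Suc i)) - B l (p i))"
    using p by (simp add: sum_lessThan_telescope[of "\<lambda>i. B l (p i)"] is_partition_def)
  also have "\<dots> = (\<Sum>i<n. ennreal (B l (p (Suc i)) - B l (p i)))"
    using B_le mem less by (intro sum_ennreal[symmetric]) (auto simp: less_imp_le)
  also have "\<dots> \<le> (\<Sum>i<n. \<tau> (p i, c (W (p i) - W s)) (p (Suc i), c (W (p (Suc i)) - W s)))"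
  proof (rule sum_mono)
    fix i assume "i \<in> {..<n}"
    then have i: "i < n" by simp
    show "ennreal (B l (p (Suc i)) - B l (p i)) \<le> \<tau> (p i, c (W (p i) - W s)) (p (Suc i), c (W (p (Suc i)) - W s))"
      using graph_dist[of "p i" "p (Suc i)"] less[OF i] le[OF i] W
      by (intro tau_lower_dist mem i) auto
  qed
  finally show "ennreal (B l t - B l s) \<le> (\<Sum>i<n. \<tau> (p i, c (W (p i) - W s)) (p (Suc i), c (W (p (Suc i)) - W s)))" .
qed

end

text \<open>Almost maximal curves, available although \<open>\<tau>\<close> may not be attained.
  With \<open>r = 0\<close> they give timelike connectedness, with general \<open>r\<close> the
  equality of \<open>\<tau>\<close> and its intrinsic version.\<close>

lemma timelike_graph:
  assumes "s \<in> I" "t \<in> I" "x \<in> X" "y \<in> X" "s < t" and r: "r < \<tau> (s, x) (t, y)"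
  obtains \<gamma> where "lpls_timelike_curve Z D ll \<gamma> s t" "causal_curve \<gamma> s t"
    "\<gamma> s = (s, x)" "\<gamma> t = (t, y)" "r < tau_length \<tau> \<gamma> s t"
proof -
  have "0 < \<tau> (s, x) (t, y)" using r by (rule le_less_trans[rotated]) simp
  then have st: "s < t" and less: "d x y < H t - H s"
    using tau_pos_iff cone_ll_iff assms by auto
  obtain l where l: "0 \<le> l" "A l t - A l s = d x y" "\<tau> (s, x) (t, y) = ennreal (B l t - B l s)"
    by (rule tau_slope[OF assms(1,2) st assms(3,4) less])
  define r' where "r' = enn2real r"
  have r': "r = ennreal r'" "0 \<le> r'" using less_trans[OF r tau_less_top] by (auto simp: r'_def)
  have "r' < B l t - B l s" using r unfolding l(3) r'(1) ennreal_less_iff[OF r'(2)] .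
  then obtain k where k: "l < k" "A l t - A l s < A k t - A k s" "r' < B k t - B k s"
    using slope_increase[OF assms(1,2) st l(1)] by blast
  have "reach (A k t - A k s) x y" using k l assms by (intro reach_dist_less) auto
  then obtain c where c: "c 0 = x" "c (A k t - A k s) = y" "\<And>p. p \<in> {0..A k t - A k s} \<Longrightarrow> c p \<in> X"
    "\<And>p q. \<lbrakk>p \<in> {0..A k t - A k s}; q \<in> {0..A k t - A k s}\<rbrakk> \<Longrightarrow> d (c p) (c q) \<le> \<bar>p - q\<bar>"
    unfolding reach_def by blast
  have k0: "0 \<le> k" using l k by simp
  show thesis
  proof (rule that[of "\<lambda>u. (u, c (A k u - A k s))"])
    show "lpls_timelike_curve Z D ll (\<lambda>u. (u, c (A k u - A k s))) s t"
      by (rule graph_lpls_timelike[OF assms(1,2) st A_mono[OF k0] A_le_H c(3,4) A_lt_H])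
    show "causal_curve (\<lambda>u. (u, c (A k u - A k s))) s t"
      by (rule graph_lpls_causal[OF assms(1,2) st A_mono[OF k0] A_le_H c(3,4)])
    have "ennreal (B k t - B k s) \<le> tau_length \<tau> (\<lambda>u. (u, c (A k u - A k s))) s t"
      by (rule graph_tau_length[OF assms(1,2) st A_mono[OF k0] A_le_H c(3,4) refl k0])
    moreover have "r < ennreal (B k t - B k s)" using r' k(3) by (simp add: ennreal_less_iff)
    ultimately show "r < tau_length \<tau> (\<lambda>u. (u, c (A k u - A k s))) s t" by simp
  qed (use c in auto)
qed

lemma cone_path_connected: "causally_path_connected Z D le ll"
  unfolding causally_path_connected_def
proof (intro ballI conjI impI)
  fix p q assume pq: "p \<in> Z" "q \<in> Z"
  obtain s x t y where *: "p = (s, x)" "q = (t, y)" by (cases p, cases q) auto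
  have mem: "s \<in> I" "t \<in> I" "x \<in> X" "y \<in> X" using pq by (auto simp: *)
  show "\<exists>\<gamma> a b. lpls_timelike_curve Z D ll \<gamma> a b \<and> \<gamma> a = p \<and> \<gamma> b = q" if "ll p q"
    using that timelike_graph[OF mem, of 0] tau_pos_iff[OF mem] cone_ll_iff[OF mem] unfolding * by metis
  assume "le p q \<and> p \<noteq> q"
  then have le: "s \<le> t" "reach (H t - H s) x y" and ne: "(s, x) \<noteq> (t, y)"
    using cone_le_iff[OF mem] unfolding * by auto
  have st: "s < t"
  proof (rule ccontr)
    assume "\<not> s < t"
    then have "s = t" using le by simp
    then show False using ne reach_dist_le[OF le(2)] mem nonneg[of x y] by simp
  qed
  obtain c where c: "c 0 = x" "c (H t - H s) = y" "\<And>p. p \<in> {0..H t - H s} \<Longrightarrow> c p \<in> X"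
    "\<And>p q. \<lbrakk>p \<in> {0..H t - H s}; q \<in> {0..H t - H s}\<rbrakk> \<Longrightarrow> d (c p) (c q) \<le> \<bar>p - q\<bar>"
    using le(2) unfolding reach_def by blast
  have curve: "causal_curve (\<lambda>u. (u, c (H u - H s))) s t"
    by (rule graph_lpls_causal[OF mem(1,2) st H_le order_refl c(3,4)])
  show "\<exists>\<gamma> a b. causal_curve \<gamma> a b \<and> \<gamma> a = p \<and> \<gamma> b = q"
    by (rule exI[of _ "\<lambda>u. (u, c (H u - H s))"], rule exI[of _ s], rule exI[of _ t]) (simp add: curve c(1,2) *)
qed

lemma tau_eq_tau_T:
  assumes "p \<in> Z" "q \<in> Z"
  shows "\<tau> p q = tau_T Z D le \<tau> p q"
proof (rule antisym)
  obtain s x t y where *: "p = (s, x)" "q = (t, y)" by (cases p, cases q) auto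
  have mem: "s \<in> I" "t \<in> I" "x \<in> X" "y \<in> X" using assms by (auto simp: *)
  show "\<tau> p q \<le> tau_T Z D le \<tau> p q"
  proof (rule ccontr)
    assume "\<not> ?thesis"
    then have less: "tau_T Z D le \<tau> (s, x) (t, y) < \<tau> (s, x) (t, y)" by (simp add: *)
    then have "0 < \<tau> (s, x) (t, y)" by (rule le_less_trans[rotated]) simp
    then have st: "s < t" using tau_pos_iff cone_ll_iff mem by auto
    obtain \<gamma> where g: "causal_curve \<gamma> s t" "\<gamma> s = (s, x)" "\<gamma> t = (t, y)"
      "tau_T Z D le \<tau> (s, x) (t, y) < tau_length \<tau> \<gamma> s t"
      using timelike_graph[OF mem st less] by metis
    have "tau_length \<tau> \<gamma> s t \<le> tau_T Z D le \<tau> (s, x) (t, y)"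
      unfolding tau_T_def using g by (intro SUP_upper2[of "(\<gamma>, s, t)"]) auto
    with g(4) show False by simp
  qed
  show "tau_T Z D le \<tau> p q \<le> \<tau> p q"
    unfolding tau_T_def
  proof (rule SUP_least, clarify)
    fix \<gamma> a b assume "causal_curve \<gamma> a b"
    then show "tau_length \<tau> (fst (\<gamma>, a, b)) (fst (snd (\<gamma>, a, b))) (snd (snd (\<gamma>, a, b))) \<le> \<tau> (\<gamma> a) (\<gamma> b)"
      using tau_length_le[of a b \<tau> \<gamma>] by (simp add: lpls_causal_curve_def)
  qed
qed

text \<open>Only the inequality between distance and \<open>H\<close>-increment passes to the limit.
  In the boundary case it yields a causal curve only if the fibre points are joined by a geodesic,
  so \<open>U\<close> is taken over a ball where they are.\<close>

lemma cone_causally_closed: "locally_causally_closed Z D le"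
  unfolding locally_causally_closed_def
proof
  fix p assume p: "p \<in> Z"
  obtain t0 x0 where p0: "p = (t0, x0)" by (cases p)
  have x0: "x0 \<in> X" using p p0 by auto
  obtain \<rho> where \<rho>: "0 < \<rho>" "\<And>x y. x \<in> mball x0 \<rho> \<Longrightarrow> y \<in> mball x0 \<rho> \<Longrightarrow> joined x y"
    using local_geodesics[OF x0] by metis
  \<comment> \<open>Half the radius, so that limit points of \<open>U\<close> still lie over the
    open ball of radius \<open>\<rho>\<close>.\<close>
  define U where "U = {z \<in> Z. d x0 (snd z) < \<rho> / 2}"
  have open_U: "openin Y.mtopology U"
    unfolding Y.openin_mtopology
  proof (intro conjI allI impI)
    fix z assume z: "z \<in> U"
    show "\<exists>r>0. Y.mball z r \<subseteq> U"
    proof (intro exI[of _ "\<rho> / 2 - d x0 (snd z)"] conjI subsetI)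
      fix w assume "w \<in> Y.mball z (\<rho> / 2 - d x0 (snd z))"
      then have w: "w \<in> Z" "D z w < \<rho> / 2 - d x0 (snd z)" by auto
      then have "d (snd z) (snd w) < \<rho> / 2 - d x0 (snd z)"
        using cone_dist_bounds[of "fst z" "snd z" "fst w" "snd w"] by simp
      then show "w \<in> U" using triangle[of x0 "snd z" "snd w"] x0 w(1) z by (auto simp: U_def)
    qed (use z in \<open>auto simp: U_def\<close>)
  qed (auto simp: U_def)
  have p_U: "p \<in> U" using p x0 \<rho>(1) by (simp add: U_def p0)
  have clos: "z \<in> Z \<and> snd z \<in> mball x0 \<rho>" if z: "z \<in> Y.mtopology closure_of U" for z
  proof -
    have zm: "z \<in> Z" and "\<forall>r>0. \<exists>w\<in>U. w \<in> Y.mball z r"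
      using z unfolding Y.metric_closure_of by blast+
    then have "\<exists>w\<in>U. w \<in> Y.mball z (\<rho> / 2)" using half_gt_zero[OF \<rho>(1)] by blast
    then obtain w where w: "w \<in> U" "D z w < \<rho> / 2" by auto
    then have "d (snd z) (snd w) < \<rho> / 2"
      using cone_dist_bounds[of "fst z" "snd z" "fst w" "snd w" "\<rho> / 2"] by simp
    then show ?thesis
      using triangle[of x0 "snd w" "snd z"] w zm x0 commute[of "snd w" "snd z"] by (auto simp: U_def)
  qed
  have closed: "le z w"
    if le: "\<forall>n. zs n \<in> Z \<and> ws n \<in> Z \<and> le (zs n) (ws n)"
      and zs: "limitin Y.mtopology zs z sequentially" and ws: "limitin Y.mtopology ws w sequentially"
      and z: "z \<in> Y.mtopology closure_of U" and w: "w \<in> Y.mtopology closure_of U" for zs ws z w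
  proof -
    obtain s x t y where *: "z = (s, x)" "w = (t, y)" by (cases z, cases w) auto
    have mem: "s \<in> I" "t \<in> I" "x \<in> X" "y \<in> X" and xy: "joined x y"
      using clos[OF z] clos[OF w] by (auto simp: * intro: \<rho>(2))
    have Dz: "(\<lambda>n. D (zs n) z) \<longlonglongrightarrow> 0" and Dw: "(\<lambda>n. D (ws n) w) \<longlonglongrightarrow> 0"
      using zs ws unfolding Y.limit_metric_sequentially by (simp_all add: LIMSEQ_iff) meson+
    have "(\<lambda>n. fst (zs n) - s) \<longlonglongrightarrow> 0"
      by (rule Lim_null_comparison[OF _ Dz]) (simp add: cone_dist_def *)
    then have s: "(\<lambda>n. fst (zs n)) \<longlonglongrightarrow> s" by (simp add: LIM_zero_iff)
    have "(\<lambda>n. fst (ws n) - t) \<longlonglongrightarrow> 0"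
      by (rule Lim_null_comparison[OF _ Dw]) (simp add: cone_dist_def *)
    then have t: "(\<lambda>n. fst (ws n)) \<longlonglongrightarrow> t" by (simp add: LIM_zero_iff)
    have le': "fst (zs n) \<le> fst (ws n)" "d (snd (zs n)) (snd (ws n)) \<le> H (fst (ws n)) - H (fst (zs n))"
      "snd (zs n) \<in> X" "snd (ws n) \<in> X" for n
      using le_dist[of "fst (zs n)" "fst (ws n)" "snd (zs n)" "snd (ws n)"] le by (auto simp: mem_Times_iff)
    have "s \<le> t" by (rule LIMSEQ_le[OF s t]) (use le' in blast)
    have "(\<lambda>n. D (zs n) z + (H (fst (ws n)) - H (fst (zs n))) + D (ws n) w) \<longlonglongrightarrow> 0 + (H t - H s) + 0"
      by (intro tendsto_intros Dz Dw isCont_tendsto_compose[OF isCont_H[OF mem(1)] s]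
           isCont_tendsto_compose[OF isCont_H[OF mem(2)] t])
    moreover have "d x y \<le> D (zs n) z + (H (fst (ws n)) - H (fst (zs n))) + D (ws n) w" for n
    proof -
      have "d x y \<le> d x (snd (zs n)) + d (snd (zs n)) (snd (ws n)) + d (snd (ws n)) y"
        using triangle[of x "snd (zs n)" y] triangle[of "snd (zs n)" "snd (ws n)" y] mem le'(3,4)[of n] by simp
      moreover have "d x (snd (zs n)) \<le> D (zs n) z" "d (snd (ws n)) y \<le> D (ws n) w"
        by (simp_all add: cone_dist_def * commute[of x])
      ultimately show ?thesis using le'(2)[of n] by linarith
    qed
    ultimately have "d x y \<le> 0 + (H t - H s) + 0" by (intro LIMSEQ_le_const) auto
    then have "reach (H t - H s) x y" by (intro reach_joined xy) simp
    then show "le z w" using cone_le_iff[OF mem] \<open>s \<le> t\<close> by (simp add: *)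
  qed
  show "\<exists>U. U \<subseteq> Z \<and> (\<exists>V. openin Y.mtopology V \<and> p \<in> V \<and> V \<subseteq> U) \<and>
        (\<forall>xs ys x y. (\<forall>n. xs n \<in> Z \<and> ys n \<in> Z \<and> le (xs n) (ys n)) \<and>
            limitin Y.mtopology xs x sequentially \<and> limitin Y.mtopology ys y sequentially \<and>
            x \<in> Y.mtopology closure_of U \<and> y \<in> Y.mtopology closure_of U \<longrightarrow> le x y)"
  proof (rule exI[of _ U], intro conjI exI[of _ U] open_U p_U subset_refl)
    show "U \<subseteq> Z" by (auto simp: U_def)
  qed (use closed in blast)
qed

section \<open>Chronological diamonds, strong causality and localisation\<close>

definition diamond :: "real \<times> 'a \<Rightarrow> real \<times> 'a \<Rightarrow> (real \<times> 'a) set" where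
  "diamond p q = {z \<in> Z. ll p z} \<inter> {z \<in> Z. ll z q}"

text \<open>Both conditions say that \<open>\<tau>\<close> to or from a fixed vertex is positive, an
  open condition by lower semicontinuity.\<close>

lemma open_diamond:
  assumes "p \<in> Z" "q \<in> Z"
  shows "openin Y.mtopology (diamond p q)"
  unfolding Y.openin_mtopology
proof (intro conjI allI impI)
  fix z assume z: "z \<in> diamond p q"
  obtain s x t y u w where *: "p = (s, x)" "z = (t, y)" "q = (u, w)" by (cases p, cases z, cases q) auto
  have mem: "s \<in> I" "t \<in> I" "u \<in> I" "x \<in> X" "y \<in> X" "w \<in> X" using assms z by (auto simp: * diamond_def)
  have pos: "0 < \<tau> (s, x) (t, y)" "0 < \<tau> (t, y) (u, w)"
    using tau_pos_iff mem z by (auto simp: * diamond_def)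
  obtain e1 where e1: "0 < e1" "\<And>p q. \<lbrakk>p \<in> Z; q \<in> Z; D (s, x) p < e1; D (t, y) q < e1\<rbrakk> \<Longrightarrow> 0 < \<tau> p q"
    using tau_lsc[OF mem(1,2,4,5) pos(1)] by metis
  obtain e2 where e2: "0 < e2" "\<And>p q. \<lbrakk>p \<in> Z; q \<in> Z; D (t, y) p < e2; D (u, w) q < e2\<rbrakk> \<Longrightarrow> 0 < \<tau> p q"
    using tau_lsc[OF mem(2,3,5,6) pos(2)] by metis
  show "\<exists>r>0. Y.mball z r \<subseteq> diamond p q"
  proof (intro exI[of _ "min e1 e2"] conjI subsetI)
    fix z' assume "z' \<in> Y.mball z (min e1 e2)"
    then have z': "z' \<in> Z" "D (t, y) z' < e1" "D (t, y) z' < e2" by (auto simp: *)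
    have "0 < \<tau> (s, x) z'" "0 < \<tau> z' (u, w)"
      using e1(2)[of "(s, x)" z'] e2(2)[of z' "(u, w)"] z' mem e1(1) e2(1) by (auto simp: cone_dist_def)
    then show "z' \<in> diamond p q"
      using z'(1) tau_pos_iff mem by (auto simp: diamond_def *)
  qed (use e1 e2 in simp)
qed (auto simp: diamond_def)

text \<open>The vertices lie over the same fibre point, so the fibre extent is limited by the
  increment of \<open>H\<close> alone. This gives both a neighbourhood base and the localising
  neighbourhoods.\<close>

lemma small_diamond:
  assumes "t \<in> I" "x \<in> X" "0 < \<eta>"
  obtains \<epsilon> where "0 < \<epsilon>" "\<epsilon> < \<eta>" "t - \<epsilon> \<in> I" "t + \<epsilon> \<in> I" "H (t + \<epsilon>) - H (t - \<epsilon>) < \<eta>"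
    "(t, x) \<in> diamond (t - \<epsilon>, x) (t + \<epsilon>, x)"
    "\<And>u y. (u, y) \<in> diamond (t - \<epsilon>, x) (t + \<epsilon>, x) \<Longrightarrow>
       u \<in> I \<and> y \<in> X \<and> t - \<epsilon> < u \<and> u < t + \<epsilon> \<and> d x y < H (t + \<epsilon>) - H (t - \<epsilon>)"
proof -
  obtain r where r: "0 < r" "cball t r \<subseteq> I" using open_I assms(1) open_contains_cball by metis
  obtain e where e: "0 < e" "\<And>s' t'. \<lbrakk>\<bar>t - s'\<bar> < e; \<bar>t - t'\<bar> < e\<rbrakk> \<Longrightarrow> \<bar>(H t' - H s') - (H t - H t)\<bar> < \<eta>"
    using increment_isCont[OF isCont_H[OF assms(1)] isCont_H[OF assms(1)] assms(3)] by blast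
  \<comment> \<open>\<open>r\<close> keeps the vertices in \<open>I\<close>, \<open>e / 2\<close>
    keeps the increment of \<open>H\<close> below \<open>\<eta>\<close>, and
    \<open>\<eta> / 2\<close> limits the time extent.\<close>
  define \<epsilon> where "\<epsilon> = Min {r, e / 2, \<eta> / 2}"
  have \<epsilon>: "0 < \<epsilon>" "\<epsilon> \<le> r" "\<epsilon> < e" "\<epsilon> < \<eta>" using r(1) e(1) assms(3) by (auto simp: \<epsilon>_def Min_less_iff)
  have I: "t - \<epsilon> \<in> I" "t + \<epsilon> \<in> I" using r(2) \<epsilon> by (auto simp: subset_eq dist_real_def)
  show thesis
  proof (rule that[OF \<epsilon>(1,4) I])
    show "H (t + \<epsilon>) - H (t - \<epsilon>) < \<eta>" using e(2)[of "t - \<epsilon>" "t + \<epsilon>"] \<epsilon> by simp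
    show "(t, x) \<in> diamond (t - \<epsilon>, x) (t + \<epsilon>, x)"
      using assms I \<epsilon>(1) H_less[of "t - \<epsilon>" t] H_less[of t "t + \<epsilon>"] by (simp add: diamond_def cone_ll_iff)
    fix u y assume "(u, y) \<in> diamond (t - \<epsilon>, x) (t + \<epsilon>, x)"
    then have "u \<in> I" "y \<in> X" "t - \<epsilon> < u" "u < t + \<epsilon>" "d x y < H u - H (t - \<epsilon>)"
      using cone_ll_iff I assms(2) by (auto simp: diamond_def)
    then show "u \<in> I \<and> y \<in> X \<and> t - \<epsilon> < u \<and> u < t + \<epsilon> \<and> d x y < H (t + \<epsilon>) - H (t - \<epsilon>)"
      using H_le[of u "t + \<epsilon>"] I by simp
  qed
qed

lemma cone_strongly_causal: "strongly_causal Z D ll"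
proof -
  let ?S = "{{z \<in> Z. ll p z} \<inter> {z \<in> Z. ll z q} |p q. p \<in> Z \<and> q \<in> Z}"
  have "openin (topology_generated_by ?S) U \<longleftrightarrow> openin Y.mtopology U" for U
  proof
    assume "openin (topology_generated_by ?S) U"
    then have "generate_topology_on ?S U" by (rule openin_topology_generated_by)
    then show "openin Y.mtopology U"
    proof induction
      case (UN K) then show ?case by (intro openin_Union) auto
    next
      case (Basis U) then show ?case using open_diamond unfolding diamond_def by blast
    qed auto
  next
    assume U: "openin Y.mtopology U"
    have "\<exists>V. openin (topology_generated_by ?S) V \<and> z \<in> V \<and> V \<subseteq> U" if z: "z \<in> U" for z
    proof -
      obtain t x where *: "z = (t, x)" by (cases z)
      obtain r where r: "0 < r" "Y.mball z r \<subseteq> U" using U z unfolding Y.openin_mtopology by blast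
      have mem: "t \<in> I" "x \<in> X" using U z unfolding Y.openin_mtopology * by auto
      \<comment> \<open>One half of \<open>r\<close> for the time difference, one for the fibre
        distance.\<close>
      have "0 < r / 2" using r by simp
      then obtain \<epsilon> where e: "0 < \<epsilon>" "\<epsilon> < r / 2" "t - \<epsilon> \<in> I" "t + \<epsilon> \<in> I" "H (t + \<epsilon>) - H (t - \<epsilon>) < r / 2"
        "(t, x) \<in> diamond (t - \<epsilon>, x) (t + \<epsilon>, x)"
        and sub: "\<And>u y. (u, y) \<in> diamond (t - \<epsilon>, x) (t + \<epsilon>, x) \<Longrightarrow>
         u \<in> I \<and> y \<in> X \<and> t - \<epsilon> < u \<and> u < t + \<epsilon> \<and> d x y < H (t + \<epsilon>) - H (t - \<epsilon>)"
        by (rule small_diamond[OF mem]) blast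
      have "diamond (t - \<epsilon>, x) (t + \<epsilon>, x) \<in> ?S" using e(3,4) mem unfolding diamond_def by blast
      then have "openin (topology_generated_by ?S) (diamond (t - \<epsilon>, x) (t + \<epsilon>, x))"
        by (rule topology_generated_by_Basis)
      moreover have "diamond (t - \<epsilon>, x) (t + \<epsilon>, x) \<subseteq> Y.mball z r"
      proof clarify
        fix u y assume uy: "(u, y) \<in> diamond (t - \<epsilon>, x) (t + \<epsilon>, x)"
        have "\<bar>t - u\<bar> + d x y < r" using sub[OF uy] e by linarith
        then show "(u, y) \<in> Y.mball z r" using sub[OF uy] mem by (simp add: * cone_dist_def)
      qed
      ultimately show ?thesis using e(6) r(2) * by blast
    qed
    then show "openin (topology_generated_by ?S) U" by (subst openin_subopen) blast
  qed
  then show ?thesis unfolding strongly_causal_def by (simp only: topology_eq) simp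
qed

lemma ll_interpolate:
  assumes "p \<in> Z" "q \<in> Z" "ll p q"
  obtains z where "z \<in> Z" "ll p z" "ll z q"
proof -
  obtain \<gamma> a b where g: "lpls_timelike_curve Z D ll \<gamma> a b" "\<gamma> a = p" "\<gamma> b = q"
    using cone_path_connected assms unfolding causally_path_connected_def by metis
  have ab: "a < b" and im: "\<gamma> ` {a..b} \<subseteq> Z"
    and ll: "\<And>s t. a \<le> s \<Longrightarrow> s < t \<Longrightarrow> t \<le> b \<Longrightarrow> ll (\<gamma> s) (\<gamma> t)"
    using g(1) unfolding lpls_timelike_curve_def by blast+
  show thesis
  proof (rule that[of "\<gamma> ((a + b) / 2)"])
    show "\<gamma> ((a + b) / 2) \<in> Z" using im ab by auto
    show "ll p (\<gamma> ((a + b) / 2))" using ll[of a "(a + b) / 2"] ab g by simp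
    show "ll (\<gamma> ((a + b) / 2)) q" using ll[of "(a + b) / 2" b] ab g by simp
  qed
qed

text \<open>Along a causal curve \<open>D\<close> is dominated by the increment of time plus
  \<open>H\<close> of time, which telescopes over any partition.\<close>

lemma causal_curve_length_bound:
  assumes "causal_curve \<gamma> a b"
    and T: "\<And>u. u \<in> {a..b} \<Longrightarrow> t1 \<le> fst (\<gamma> u) \<and> fst (\<gamma> u) \<le> t2" and "t1 \<in> I" "t2 \<in> I"
  shows "curve_length D \<gamma> a b \<le> ennreal (t2 - t1 + (H t2 - H t1))"
  unfolding curve_length_def
proof (rule SUP_least, clarsimp, rule ennreal_leI)
  fix n p assume p: "is_partition a b n p"
  define \<phi> where "\<phi> u = fst (\<gamma> u) + H (fst (\<gamma> u))" for u
  have ab: "a < b" and im: "\<gamma> ` {a..b} \<subseteq> Z"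
    and le: "\<And>s t. a \<le> s \<Longrightarrow> s < t \<Longrightarrow> t \<le> b \<Longrightarrow> le (\<gamma> s) (\<gamma> t)"
    using assms(1) unfolding lpls_causal_curve_def by blast+
  have mem: "fst (\<gamma> u) \<in> I" "snd (\<gamma> u) \<in> X" if "a \<le> u" "u \<le> b" for u
  proof -
    have "\<gamma> u \<in> Z" using im that by auto
    then show "fst (\<gamma> u) \<in> I" "snd (\<gamma> u) \<in> X" by auto
  qed
  have "(\<Sum>i<n. D (\<gamma> (p i)) (\<gamma> (p (Suc i)))) \<le> (\<Sum>i<n. \<phi> (p (Suc i)) - \<phi> (p i))"
  proof (rule sum_mono)
    fix i assume "i \<in> {..<n}"
    then have i: "a \<le> p i" "p i < p (Suc i)" "p (Suc i) \<le> b"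
      using is_partition_bounds[OF p, of i] is_partition_bounds[OF p, of "Suc i"] p
      by (auto simp: is_partition_def)
    have m: "fst (\<gamma> (p i)) \<in> I" "fst (\<gamma> (p (Suc i))) \<in> I" "snd (\<gamma> (p i)) \<in> X" "snd (\<gamma> (p (Suc i))) \<in> X"
      using mem[of "p i"] mem[of "p (Suc i)"] i by auto
    show "D (\<gamma> (p i)) (\<gamma> (p (Suc i))) \<le> \<phi> (p (Suc i)) - \<phi> (p i)"
      using le_dist[OF m] le[OF i] by (simp add: cone_dist_def \<phi>_def)
  qed
  also have "\<dots> = \<phi> b - \<phi> a"
    using p by (simp add: sum_lessThan_telescope[of "\<lambda>i. \<phi> (p i)"] is_partition_def)
  also have "\<dots> \<le> t2 - t1 + (H t2 - H t1)"
    using H_le[of t1 "fst (\<gamma> a)"] H_le[of "fst (\<gamma> b)" t2] T[of a] T[of b] mem[of a] mem[of b] ab assms(3,4)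
    by (simp add: \<phi>_def)
  finally show "(\<Sum>i<n. D (\<gamma> (p i)) (\<gamma> (p (Suc i)))) \<le> t2 - t1 + (H t2 - H t1)" .
qed

lemma tau_continuous:
  assumes "\<Omega> \<subseteq> Z"
  shows "continuous_map (prod_topology (Metric_space.mtopology \<Omega> D) (Metric_space.mtopology \<Omega> D))
    euclideanreal (\<lambda>(p, q). enn2real (\<tau> p q))"
proof -
  interpret \<Omega>: Metric_space \<Omega> D using Y.subspace[OF assms] .
  let ?T = "prod_topology \<Omega>.mtopology \<Omega>.mtopology"
  have fin: "\<tau> p q < top" for p q using tau_less_top[of "fst p" "snd p" "fst q" "snd q"] by simp
  have openI: "openin (?T)
      {z \<in> topspace (?T). P (case z of (p, q) \<Rightarrow> enn2real (\<tau> p q))}"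
    if nbhd: "\<And>p q. \<lbrakk>p \<in> \<Omega>; q \<in> \<Omega>; P (enn2real (\<tau> p q))\<rbrakk> \<Longrightarrow> \<exists>e>0. \<forall>p'\<in>Z. \<forall>q'\<in>Z.
        D p p' < e \<longrightarrow> D q q' < e \<longrightarrow> P (enn2real (\<tau> p' q'))" for P
    unfolding openin_prod_topology_alt
  proof (intro allI impI)
    fix p q assume "(p, q) \<in> {z \<in> topspace (?T). P (case z of (p, q) \<Rightarrow> enn2real (\<tau> p q))}"
    then have pq: "p \<in> \<Omega>" "q \<in> \<Omega>" "P (enn2real (\<tau> p q))" by auto
    then obtain e where "0 < e" and e: "\<forall>p'\<in>Z. \<forall>q'\<in>Z.
        D p p' < e \<longrightarrow> D q q' < e \<longrightarrow> P (enn2real (\<tau> p' q'))" using nbhd by blast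
    show "\<exists>U V. openin \<Omega>.mtopology U \<and> openin \<Omega>.mtopology V \<and> p \<in> U \<and> q \<in> V \<and>
      U \<times> V \<subseteq> {z \<in> topspace (?T). P (case z of (p, q) \<Rightarrow> enn2real (\<tau> p q))}"
    proof (rule exI[of _ "\<Omega>.mball p e"], rule exI[of _ "\<Omega>.mball q e"], intro conjI)
      show "\<Omega>.mball p e \<times> \<Omega>.mball q e \<subseteq>
        {z \<in> topspace (?T). P (case z of (p, q) \<Rightarrow> enn2real (\<tau> p q))}"
      proof clarify
        fix p' q' assume "p' \<in> \<Omega>.mball p e" "q' \<in> \<Omega>.mball q e"
        then have "p' \<in> \<Omega>" "q' \<in> \<Omega>" "D p p' < e" "D q q' < e" by auto
        then have "P (enn2real (\<tau> p' q'))" using e assms by blast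
        with \<open>p' \<in> \<Omega>\<close> \<open>q' \<in> \<Omega>\<close>
        show "(p', q') \<in> topspace (?T) \<and> P (enn2real (\<tau> p' q'))"
          by simp
      qed
    qed (use pq \<open>0 < e\<close> in auto)
  qed
  show ?thesis
    unfolding continuous_map_upper_lower_semicontinuous_lt
  proof (intro conjI allI)
    fix a :: real
    show "openin (?T)
      {z \<in> topspace (?T). a < (case z of (p, q) \<Rightarrow> enn2real (\<tau> p q))}"
    proof (rule openI[of "\<lambda>r. a < r"])
      fix p q assume pq: "p \<in> \<Omega>" "q \<in> \<Omega>" "a < enn2real (\<tau> p q)"
      show "\<exists>e>0. \<forall>p'\<in>Z. \<forall>q'\<in>Z. D p p' < e \<longrightarrow> D q q' < e \<longrightarrow> a < enn2real (\<tau> p' q')"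
      \<comment> \<open>Values of \<open>enn2real\<close> are nonnegative, so a negative bound
        always holds; a nonnegative one passes to \<open>ennreal\<close> unchanged.\<close>
      proof (cases "a < 0")
        case True
        then show ?thesis by (intro exI[of _ "1::real"]) (auto intro: less_le_trans)
      next
        case False
        have lt: "a < enn2real (\<tau> p' q') \<longleftrightarrow> ennreal a < \<tau> p' q'" for p' q'
          using False fin[of p' q'] by (cases "\<tau> p' q'") (auto simp: ennreal_less_iff)
        obtain s x t y where *: "p = (s, x)" "q = (t, y)" by (cases p, cases q) auto
        have mem: "s \<in> I" "t \<in> I" "x \<in> X" "y \<in> X" using pq assms by (auto simp: *)
        show ?thesis
          using tau_lsc[OF mem, of "ennreal a"] pq(3) unfolding lt * by metis
      qed
    qed
    show "openin (?T)
      {z \<in> topspace (?T). (case z of (p, q) \<Rightarrow> enn2real (\<tau> p q)) < a}"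
    proof (rule openI[of "\<lambda>r. r < a"])
      fix p q assume pq: "p \<in> \<Omega>" "q \<in> \<Omega>" "enn2real (\<tau> p q) < a"
      have "0 < a" using pq(3) by (rule le_less_trans[rotated]) simp
      then have lt: "enn2real (\<tau> p' q') < a \<longleftrightarrow> \<tau> p' q' < ennreal a" for p' q'
        using fin[of p' q'] by (cases "\<tau> p' q'") (auto simp: ennreal_less_iff)
      obtain s x t y where *: "p = (s, x)" "q = (t, y)" by (cases p, cases q) auto
      have mem: "s \<in> I" "t \<in> I" "x \<in> X" "y \<in> X" using pq assms by (auto simp: *)
      show "\<exists>e>0. \<forall>p'\<in>Z. \<forall>q'\<in>Z. D p p' < e \<longrightarrow> D q q' < e \<longrightarrow> enn2real (\<tau> p' q') < a"
        using tau_usc[OF mem, of a] pq(3) unfolding lt * by metis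
    qed
  qed
qed

text \<open>Along a fibre geodesic the exact multiplier can be used without slack, so
  \<open>\<tau>\<close> is attained. If the endpoints are not chronologically related,
  \<open>\<tau>\<close> is 0 and the null rate \<open>H\<close> gives a causal curve.\<close>

lemma maximal_graph:
  assumes "s \<in> I" "t \<in> I" "x \<in> X" "y \<in> X" "le (s, x) (t, y)" "(s, x) \<noteq> (t, y)" "joined x y"
  obtains \<gamma> where "causal_curve \<gamma> s t" "\<gamma> s = (s, x)" "\<gamma> t = (t, y)"
    "tau_length \<tau> \<gamma> s t = \<tau> (s, x) (t, y)"
proof -
  note ord = le_dist[OF assms(1-5)]
  have st: "s < t"
  proof (rule ccontr)
    assume "\<not> s < t"
    then have "s = t" using ord by simp
    then show False using assms ord(2) nonneg[of x y] by simp
  qed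
  obtain c where c: "c 0 = x" "c (d x y) = y" "\<And>p. p \<in> {0..d x y} \<Longrightarrow> c p \<in> X"
     "\<And>p q. \<lbrakk>p \<in> {0..d x y}; q \<in> {0..d x y}\<rbrakk> \<Longrightarrow> d (c p) (c q) = \<bar>p - q\<bar>"
    using assms(7) unfolding joined_def by blast
  show thesis
  proof (cases "d x y < H t - H s")
    case True
    obtain l where l: "0 \<le> l" "A l t - A l s = d x y" "\<tau> (s, x) (t, y) = ennreal (B l t - B l s)"
      by (rule tau_slope[OF assms(1,2) st assms(3,4) True])
    define \<gamma> where "\<gamma> = (\<lambda>u. (u, c (A l u - A l s)))"
    have lip: "c p \<in> X" "d (c p) (c q) \<le> \<bar>p - q\<bar>" if "p \<in> {0..A l t - A l s}" "q \<in> {0..A l t - A l s}" for p q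
      using c(3,4) that unfolding l(2) by auto
    have ends: "\<gamma> s = (s, x)" "\<gamma> t = (t, y)" using c l by (simp_all add: \<gamma>_def)
    show thesis
    proof (rule that[OF _ ends])
      show "causal_curve \<gamma> s t"
        unfolding \<gamma>_def by (rule graph_lpls_causal[OF assms(1,2) st A_mono[OF l(1)] A_le_H lip(1) lip(2)]) auto
      have "ennreal (B l t - B l s) \<le> tau_length \<tau> \<gamma> s t"
        unfolding \<gamma>_def by (rule graph_tau_length[OF assms(1,2) st A_mono[OF l(1)] A_le_H lip(1) lip(2) refl l(1)]) auto
      then show "tau_length \<tau> \<gamma> s t = \<tau> (s, x) (t, y)"
        using tau_length_le[OF st, of \<tau> \<gamma>] ends l(3) by (intro antisym) auto
    qed
  next
    case False
    then have eq: "H t - H s = d x y" using ord by simp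
    define \<gamma> where "\<gamma> = (\<lambda>u. (u, c (H u - H s)))"
    have lip: "c p \<in> X" "d (c p) (c q) \<le> \<bar>p - q\<bar>" if "p \<in> {0..H t - H s}" "q \<in> {0..H t - H s}" for p q
      using c(3,4) that unfolding eq by auto
    have ends: "\<gamma> s = (s, x)" "\<gamma> t = (t, y)" using c eq by (simp_all add: \<gamma>_def)
    show thesis
    proof (rule that[OF _ ends])
      show "causal_curve \<gamma> s t"
        unfolding \<gamma>_def by (rule graph_lpls_causal[OF assms(1,2) st H_le order_refl lip(1) lip(2)]) auto
      show "tau_length \<tau> \<gamma> s t = \<tau> (s, x) (t, y)"
        using tau_length_le[OF st, of \<tau> \<gamma>] tau_eq_0[OF assms(1-4)] False ends by simp
    qed
  qed
qed

text \<open>The diamond is small enough that its fibre points are pairwise joined by geodesics, and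
  it is causally convex. Hence maximal curves of the whole cone stay inside, and the global
  \<open>\<tau>\<close> can serve as \<open>\<omega>\<close>.\<close>

lemma cone_localizable: "localizable Z D le ll \<tau>"
  unfolding localizable_def
proof (rule ballI, goal_cases)
  case (1 p)
  then have p: "p \<in> Z" .
  obtain t0 x0 where p0: "p = (t0, x0)" by (cases p)
  have t0: "t0 \<in> I" and x0: "x0 \<in> X" using p p0 by auto
  obtain \<rho> where \<rho>: "0 < \<rho>" "\<And>x y. x \<in> mball x0 \<rho> \<Longrightarrow> y \<in> mball x0 \<rho> \<Longrightarrow> joined x y"
    using local_geodesics[OF x0] by metis
  obtain \<epsilon> where e: "0 < \<epsilon>" "t0 - \<epsilon> \<in> I" "t0 + \<epsilon> \<in> I" "H (t0 + \<epsilon>) - H (t0 - \<epsilon>) < \<rho>"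
    and p\<Omega>: "(t0, x0) \<in> diamond (t0 - \<epsilon>, x0) (t0 + \<epsilon>, x0)"
    and sub: "\<And>u y. (u, y) \<in> diamond (t0 - \<epsilon>, x0) (t0 + \<epsilon>, x0) \<Longrightarrow>
       u \<in> I \<and> y \<in> X \<and> t0 - \<epsilon> < u \<and> u < t0 + \<epsilon> \<and> d x0 y < H (t0 + \<epsilon>) - H (t0 - \<epsilon>)"
    by (rule small_diamond[OF t0 x0 \<rho>(1)]) blast
  define P where "P = (t0 - \<epsilon>, x0)"
  define Q where "Q = (t0 + \<epsilon>, x0)"
  define \<Omega> where "\<Omega> = diamond P Q"
  define \<omega> where "\<omega> z w = enn2real (\<tau> z w)" for z w
  have PQ: "P \<in> Z" "Q \<in> Z" using e x0 by (auto simp: P_def Q_def)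
  have \<Omega>Y: "\<Omega> \<subseteq> Z" by (auto simp: \<Omega>_def diamond_def)
  have \<omega>: "ennreal (\<omega> z w) = \<tau> z w" for z w
    using tau_less_top[of "fst z" "snd z" "fst w" "snd w"] by (simp add: \<omega>_def)
  have f1: "openin Y.mtopology \<Omega>" unfolding \<Omega>_def by (rule open_diamond[OF PQ])
  have f2: "p \<in> \<Omega>" using p\<Omega> by (simp add: \<Omega>_def P_def Q_def p0)
  have f3: "\<forall>\<gamma> a b. causal_curve \<gamma> a b \<and> \<gamma> ` {a..b} \<subseteq> \<Omega> \<longrightarrow>
     curve_length D \<gamma> a b \<le> ennreal ((t0 + \<epsilon>) - (t0 - \<epsilon>) + (H (t0 + \<epsilon>) - H (t0 - \<epsilon>)))"
  proof (intro allI impI)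
    fix \<gamma> a b assume g: "causal_curve \<gamma> a b \<and> \<gamma> ` {a..b} \<subseteq> \<Omega>"
    show "curve_length D \<gamma> a b \<le> ennreal ((t0 + \<epsilon>) - (t0 - \<epsilon>) + (H (t0 + \<epsilon>) - H (t0 - \<epsilon>)))"
    proof (rule causal_curve_length_bound[OF conjunct1[OF g] _ e(2,3)])
      fix u assume "u \<in> {a..b}"
      then have "\<gamma> u \<in> \<Omega>" using g by auto
      then show "t0 - \<epsilon> \<le> fst (\<gamma> u) \<and> fst (\<gamma> u) \<le> t0 + \<epsilon>"
        using sub[of "fst (\<gamma> u)" "snd (\<gamma> u)"] by (simp add: \<Omega>_def P_def Q_def)
    qed
  qed
  have f4: "continuous_map (prod_topology (Metric_space.mtopology \<Omega> D) (Metric_space.mtopology \<Omega> D))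
             euclideanreal (\<lambda>(x, y). \<omega> x y)"
    unfolding \<omega>_def by (rule tau_continuous[OF \<Omega>Y])
  have f5: "\<forall>x\<in>\<Omega>. \<forall>y\<in>\<Omega>. 0 \<le> \<omega> x y" by (simp add: \<omega>_def)
  have f6: "lorentzian_pre_length_space \<Omega> D le ll (\<lambda>x y. ennreal (\<omega> x y))"
    unfolding \<omega> using lorentzian_pre_length_space_subset[OF cone_pre_length_space \<Omega>Y] by simp
  have f7: "\<forall>y\<in>\<Omega>. (\<exists>z\<in>\<Omega>. ll y z) \<and> (\<exists>z\<in>\<Omega>. ll z y)"
  proof
    fix y assume "y \<in> \<Omega>"
    then have y: "y \<in> Z" "ll P y" "ll y Q" by (auto simp: \<Omega>_def diamond_def)
    obtain z where z: "z \<in> Z" "ll y z" "ll z Q" using ll_interpolate[OF y(1) PQ(2) y(3)] .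
    obtain w where w: "w \<in> Z" "ll P w" "ll w y" using ll_interpolate[OF PQ(1) y(1,2)] .
    have "z \<in> \<Omega>" "w \<in> \<Omega>"
      using z w y ll_le_trans[OF PQ(1) y(1) z(1) y(2) ll_imp_le] ll_le_trans[OF w(1) y(1) PQ(2) w(3) ll_imp_le] PQ
      by (auto simp: \<Omega>_def diamond_def)
    then show "(\<exists>z\<in>\<Omega>. ll y z) \<and> (\<exists>z\<in>\<Omega>. ll z y)" using z w by blast
  qed
  have f8: "\<forall>x\<in>\<Omega>. \<forall>y\<in>\<Omega>. le x y \<and> x \<noteq> y \<longrightarrow>
              (\<exists>\<gamma> a b. causal_curve \<gamma> a b \<and> \<gamma> ` {a..b} \<subseteq> \<Omega> \<and>
                 \<gamma> a = x \<and> \<gamma> b = y \<and>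
                 (\<forall>\<sigma> a' b'. causal_curve \<sigma> a' b' \<and> \<sigma> ` {a'..b'} \<subseteq> \<Omega> \<and>
                     \<sigma> a' = x \<and> \<sigma> b' = y \<longrightarrow> tau_length \<tau> \<sigma> a' b' \<le> tau_length \<tau> \<gamma> a b) \<and>
                 tau_length \<tau> \<gamma> a b = ennreal (\<omega> x y) \<and>
                 ennreal (\<omega> x y) \<le> \<tau> x y)"
  proof (intro ballI impI)
    fix z w assume z: "z \<in> \<Omega>" and w: "w \<in> \<Omega>" and zw: "le z w \<and> z \<noteq> w"
    obtain s x t y where *: "z = (s, x)" "w = (t, y)" by (cases z, cases w) auto
    have mem: "s \<in> I" "t \<in> I" "x \<in> X" "y \<in> X" using z w \<Omega>Y by (auto simp: *)
    have "x \<in> mball x0 \<rho>" "y \<in> mball x0 \<rho>"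
      using sub[of s x] sub[of t y] z w e(4) x0 by (auto simp: * \<Omega>_def P_def Q_def)
    then have "joined x y" by (rule \<rho>(2))
    then obtain \<gamma> where g: "causal_curve \<gamma> s t" "\<gamma> s = z" "\<gamma> t = w"
      "tau_length \<tau> \<gamma> s t = \<tau> z w"
      using maximal_graph[OF mem] zw unfolding * by metis
    have st: "s < t" and im: "\<gamma> ` {s..t} \<subseteq> Z"
      and gle: "\<And>u v. s \<le> u \<Longrightarrow> u < v \<Longrightarrow> v \<le> t \<Longrightarrow> le (\<gamma> u) (\<gamma> v)"
      using g(1) unfolding lpls_causal_curve_def by blast+
    have zwY: "z \<in> Z" "w \<in> Z" "ll P z" "ll w Q" using z w by (auto simp: \<Omega>_def diamond_def)
    \<comment> \<open>Causal convexity: a point causally between two points of the diamond is in it,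
      by push-up from both vertices.\<close>
    have im\<Omega>: "\<gamma> ` {s..t} \<subseteq> \<Omega>"
    proof (rule image_subsetI)
      fix u assume u: "u \<in> {s..t}"
      have uY: "\<gamma> u \<in> Z" using im u by auto
      have "le z (\<gamma> u)" using gle[of s u] u g(2) cone_le_refl by (cases "u = s") auto
      moreover have "le (\<gamma> u) w" using gle[of u t] u g(3) cone_le_refl by (cases "u = t") auto
      ultimately have "ll P (\<gamma> u)" "ll (\<gamma> u) Q"
        using ll_le_trans[OF PQ(1) zwY(1) uY] le_ll_trans[OF uY zwY(2) PQ(2)] zwY by auto
      then show "\<gamma> u \<in> \<Omega>" using uY by (simp add: \<Omega>_def diamond_def)
    qed
    have maxi: "tau_length \<tau> \<sigma> a' b' \<le> tau_length \<tau> \<gamma> s t"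
      if "causal_curve \<sigma> a' b' \<and> \<sigma> ` {a'..b'} \<subseteq> \<Omega> \<and> \<sigma> a' = z \<and> \<sigma> b' = w" for \<sigma> a' b'
      using tau_length_le[of a' b' \<tau> \<sigma>] that g(4) by (simp add: lpls_causal_curve_def)
    show "\<exists>\<gamma> a b. causal_curve \<gamma> a b \<and> \<gamma> ` {a..b} \<subseteq> \<Omega> \<and>
                 \<gamma> a = z \<and> \<gamma> b = w \<and>
                 (\<forall>\<sigma> a' b'. causal_curve \<sigma> a' b' \<and> \<sigma> ` {a'..b'} \<subseteq> \<Omega> \<and>
                     \<sigma> a' = z \<and> \<sigma> b' = w \<longrightarrow> tau_length \<tau> \<sigma> a' b' \<le> tau_length \<tau> \<gamma> a b) \<and>
                 tau_length \<tau> \<gamma> a b = ennreal (\<omega> z w) \<and> ennreal (\<omega> z w) \<le> \<tau> z w"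
      by (rule exI[of _ \<gamma>], rule exI[of _ s], rule exI[of _ t]) (use g \<omega> im\<Omega> maxi in auto)
  qed
  show ?case
  proof (rule exI[of _ \<Omega>], intro conjI f1 f2, goal_cases)
    case 1 then show ?case by (rule exI) (rule f3)
  next
    case 2 then show ?case by (rule exI[of _ \<omega>]) (intro conjI f4 f5 f6 f7 f8)
  qed
qed

end

theorem theorem4p8:
  fixes X :: "'a set" and d :: "'a \<Rightarrow> 'a \<Rightarrow> real"
    and I :: "real set" and f :: "real \<Rightarrow> real"
  assumes "Metric_space X d"
    and "length_space X d"
    and "locally_compact_space (Metric_space.mtopology X d)"
    and "open I" and "is_interval I"
    and "continuous_on I f" and "\<forall>t\<in>I. 0 < f t"
  shows "lorentzian_length_space (I \<times> X) (cone_dist d) (cone_le I X d f) (cone_ll I X d f) (cone_tau I X d f)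
       \<and> strongly_causal (I \<times> X) (cone_dist d) (cone_ll I X d f)"
proof -
  interpret Metric_space X d by (rule assms(1))
  interpret length_cone X d I f
    by unfold_locales (use assms in auto)
  show ?thesis
    unfolding lorentzian_length_space_def
    using cone_pre_length_space cone_path_connected cone_causally_closed cone_localizable tau_eq_tau_T cone_strongly_causal by blast
qed

end
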